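(* In the setting of the context (iterates $\mathbf{W}^{(k+1)}=\mathbf{P}^{(k)}\mathbf{W}^{(k)}-\alpha^{(k)}\mathbf{G}^{(k)}$ with connectivity bound $B$ and contraction factor $\rho$), assume: each $\mathbf{P}^{(k)}$ satisfies the weight conditions; each $F_i$ has $L_i$-Lipschitz gradient, is $\mu_i$-strongly convex, and satisfies $\|\nabla F_i(\mathbf{w})-\nabla F(\mathbf{w})\|\le\delta_i$ for all $\mathbf{w}\in\mathbb{R}^n$ (with $\delta_i>0$); the gradient errors have zero mean, mean square at most $\sigma_i^2$, and are independent across devices; and the physical graph and broadcast events satisfy the connectivity conditions with integers $B_1,B_2$. Let the step sizes $\alpha^{(k)}>0$ be non-increasing, $\alpha^{(k+1)}\le\alpha^{(k)}$ for all $k\ge0$, and suppose $$\alpha^{(0)}\le\frac{1-\rho^2}{8BL(1+\Gamma_1)^{B-1}},\qquad \Gamma_1=\frac{1-\rho^2}{2\sqrt2\,B}.$$ Then $\rho(\mathbf{\Phi}^{(k)})<1$ for all $k \geq 0$, and (entrywise) $$\mathbf{\Xi}^{(kB)}\le\mathcal{O}\big(\phi_{11}^{(k-1:K)}\big)\mathcal{O}\big(\phi_{22}^{(K-1:0)}\big)\mathbf{\Xi}^{(0)}+\mathcal{O}\big(\phi_{11}^{(k-1:K)}\big)\sum_{r=1}^{K-1}\mathcal{O}\big(\phi_{22}^{(K-1:r)}\big)\mathbf{\Psi}^{(r-1)}+\sum_{r=K}^{k-1}\mathcal{O}\big(\phi_{11}^{(k-1:r)}\big)\mathbf{\Psi}^{(r-1)}+\mathbf{\Psi}^{(k-1)},$$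 where $K$ is determined by $\phi_{11}^{(k)}<\phi_{22}^{(k)}$ for all $k=0,\dots,K-1$ and $\phi_{11}^{(k)}\ge\phi_{22}^{(k)}$ for $k\ge K$ (and $k\ge\max\{K,1\}$ in the displayed bound). Furthermore, for all $k\ge 0$, entrywise, $$\mathbf{\Psi}^{(k)}\le\big(\alpha^{(kB)}\big)^2B\begin{bmatrix}\dfrac{\sigma^2}{m}+\nu^{(kB)}\\[2mm] 2mB\Big\{2\,\dfrac{\delta^2+2\mu\alpha^{(kB)}\nu^{(kB)}}{1-\rho^2}+\sigma^2\Big\}\end{bmatrix},$$ where $\nu^{(k)}=\frac{2}{\mu}(B-1)L^2(1+\Gamma_1)^{2(B-1)}\Big(\frac{(1+\Gamma_1)\delta^2}{\sqrt2L}+\alpha^{(k)}\sigma^2\Big)$.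
   Context: Setup. Devices $\mathcal{M}=\{1,\dots,m\}$; local losses $F_i:\mathbb{R}^n\to\mathbb{R}$ differentiable; $F=\frac1m\sum_{i=1}^mF_i$. $\|\cdot\|$ is the Euclidean norm of vectors and the Frobenius norm of matrices; $\mathbf{1}_m$ is the all-ones column vector. $\mathbf{W}^{(k)}\in\mathbb{R}^{m\times n}$ has rows $(\mathbf{w}_i^{(k)})^T$ (device models) and $\mathbf{G}^{(k)}$ has rows $(\mathbf{g}_i^{(k)})^T$, $\mathbf{g}_i^{(k)}=\nabla F_i(\mathbf{w}_i^{(k)})+\boldsymbol\epsilon_i^{(k)}$. The iterates satisfy $\mathbf{W}^{(k+1)}=\mathbf{P}^{(k)}\mathbf{W}^{(k)}-\alpha^{(k)}\mathbf{G}^{(k)}$, $k\ge0$. $\bar{\mathbf{w}}^{(k)}=\frac1m\mathbf{1}_m^T\mathbf{W}^{(k)}$ (row vector), and $\mathbf{w}^\star$ is the unique minimizer of $F$ (as a row vector). Smoothness, convexity, heterogeneity: $\|\nabla F_i(\mathbf{w})-\nabla F_i(\mathbf{w}')\|\le L_i\|\mathbf{w}-\mathbf{w}'\|$; $\langle\nabla F_i(\mathbf{w})-\nabla F_i(\mathbf{w}'),\mathbf{w}-\mathbf{w}'\rangle\ge\mu_i\|\mathbf{w}-\mathbf{w}'\|^2$, $\mu_i>0$; $L=\max_iL_i$, $\mu=\min_i\mu_i$, $\delta=\max_i\delta_i$. Gradient errors: $\mathbb{E}[\boldsymbol\epsilon_i^{(k)}]=0$, $\mathbb{E}\|\boldsymbol\epsilon_i^{(k)}\|^2\le\sigma_i^2\le\sigma^2$,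 $\sigma=\max_i\sigma_i$, $\boldsymbol\epsilon_i^{(k)}$ independent of $\boldsymbol\epsilon_j^{(k)}$ for $j\ne i$; the errors at iteration $k$ are independent of $\mathbf{W}^{(0)}$ and the errors at iterations $0,\dots,k-1$. Graphs and weights: at iteration $k$, $\mathcal{G}^{(k)}=(\mathcal{M},\mathcal{E}^{(k)})$ is the undirected physical graph and $v_i^{(k)}\in\{0,1\}$ indicates whether device $i$ broadcasts. The information flow graph $\mathcal{G}'^{(k)}=(\mathcal{M},\mathcal{E}'^{(k)})$ consists of the links $(i,j)\in\mathcal{E}^{(k)}$ that are newly available at iteration $k$ or have $v_i^{(k)}=1$ or $v_j^{(k)}=1$. All graphs, indicators and $\mathbf{P}^{(k)}=[p_{ij}^{(k)}]$ are treated as deterministic. Weight conditions: $p_{ii}^{(k)}>0$; for $j\ne i$, $p_{ij}^{(k)}>0$ if $(i,j)\in\mathcal{E}'^{(k)}$ and $p_{ij}^{(k)}=0$ otherwise; $\mathbf{P}^{(k)}$ is doubly stochastic and symmetric. Connectivity conditions: for every $k\ge0$ the graph $(\mathcal{M},\bigcup_{s=0}^{B_1-1}\mathcal{E}^{(k+s)})$ is connected, and for every $i$ and $k\ge 0$, $\max\{v_i^{(k)},\dots,v_i^{(k+B_2-1)}\}=1$. $B=(\tilde l+2)B_1$ with $\tilde l$ the integer such that $\tilde lB_1\le B_2\le(\tilde l+1)B_1-1$; then $(\mathcal{M},\bigcup_{s=0}^{B-1}\mathcal{E}'^{(k+s)})$ is connected for all $k$. $\mathbf{P}^{(k:s)}=\mathbf{P}^{(k)}\cdots\mathbf{P}^{(s)}$,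 and $\rho=\sup_{k\ge0}\|\mathbf{P}^{(k+B-1:k)}-\frac1m\mathbf{1}_m\mathbf{1}_m^T\|_{\rm spectral}$, with $0<\rho<1$. Error vector: $\mathbf{\Xi}^{(k)}=\big(\mathbb{E}\|\bar{\mathbf{w}}^{(k)}-\mathbf{w}^\star\|^2,\ \mathbb{E}\|\mathbf{W}^{(k)}-\mathbf{1}_m\bar{\mathbf{w}}^{(k)}\|^2\big)^T$. Coefficients: $a_{11}^{(k)}=1-\mu\alpha^{(k)}$, $a_{12}^{(k)}=(1+\mu\alpha^{(k)})\alpha^{(k)}L^2/(\mu m)$, $a_{21}^{(k)}=0$, $a_{22}^{(k)}=(1+2\sqrt2\alpha^{(k)}L)^2$, $c_1^{(k)}=(\alpha^{(k)})^2\sigma^2/m$, $c_2^{(k)}=m(\alpha^{(k)})^2\big(\frac{2(1+2\sqrt2\alpha^{(k)}L)}{2\sqrt2\alpha^{(k)}L}\delta^2+\sigma^2\big)$; $\mathbf{A}^{(k)}=[a_{ij}^{(k)}]$, $\mathbf{C}^{(k)}=[c_1^{(k)},c_2^{(k)}]^T$, $\mathbf{A}^{(k:s)}=\mathbf{A}^{(k)}\cdots\mathbf{A}^{(s)}=[a_{ij}^{(k:s)}]$. Block quantities: $\mathbf{\Phi}^{(k)}=[\phi_{ij}^{(k)}]_{1\le i,j\le2}$ with $\phi_{11}^{(k)}=a_{11}^{((k+1)B-1:kB)}$, $\phi_{12}^{(k)}=a_{12}^{((k+1)B-1:kB)}$, $\phi_{21}^{(k)}=0$, $\phi_{22}^{(k)}=\frac{1+\rho^2}{2}+\frac{16BL^2}{1-\rho^2}\sum_{r=kB+1}^{(k+1)B}(\alpha^{(r-1)})^2a_{22}^{(r-2:kB)}$.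 $\mathbf{\Psi}^{(k)}=[\psi_1^{(k)},\psi_2^{(k)}]^T$ with $\psi_1^{(k)}$ the first entry of $\sum_{r=kB+1}^{(k+1)B-1}\mathbf{A}^{((k+1)B-1:r)}\mathbf{C}^{(r-1)}+\mathbf{C}^{((k+1)B-1)}$, and $\psi_2^{(k)}=2B\sum_{r=kB+1}^{(k+1)B}(\alpha^{(r-1)})^2\Big\{\frac{2}{1-\rho^2}\Big[m\delta^2+4L^2\sum_{l=kB+1}^{r-1}a_{22}^{(r-2:l)}c_2^{(l-1)}\Big]+m\sigma^2\Big\}$. Further $\phi_{ii}^{(k:s)}=\phi_{ii}^{(k)}\cdots\phi_{ii}^{(s)}$. Empty products are $1$ (or the identity), empty sums are $0$, and terms with $\mathbf{\Psi}^{(-1)}$ are omitted. $\rho(\mathbf{\Phi}^{(k)})$ is the spectral radius of $\mathbf{\Phi}^{(k)}$. $\mathcal{O}(x)$ denotes a nonnegative real quantity bounded by $Cx$, where the constant $C$ does not depend on $k$ or the summation index $r$ (it may depend on the problem parameters, the step-size sequence and the initial values).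
   Formalization: The first entry of the displayed bound at k=1 is not claimed when the first entry of Ξ^(0) is 0 and the second is not; there it would read Ξ_1^(B) ≤ Ψ_1^(0), which fails for non-quadratic losses with large initial disagreement. *)

theory Defs
  imports "HOL-Probability.Probability"
begin

text \<open>Devices are the elements of a finite type 'm and models are vectors of type real^'n.
  On real^'n^'m (rows indexed by the devices) the norm is the Frobenius norm.\<close>

definition grad :: "(real^'n \<Rightarrow> real) \<Rightarrow> real^'n \<Rightarrow> real^'n" where
  "grad f x = (THE D. GDERIV f x :> D)"

definition avg_loss :: "('m::finite \<Rightarrow> real^'n \<Rightarrow> real) \<Rightarrow> real^'n \<Rightarrow> real" where
  "avg_loss F w = (\<Sum>i\<in>UNIV. F i w) / real CARD('m)"

definition avg_model :: "real^'n^'m::finite \<Rightarrow> real^'n" where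
  "avg_model W = (1 / real CARD('m)) *\<^sub>R (\<Sum>i\<in>UNIV. W $ i)"

definition replicate_rows :: "real^'n \<Rightarrow> real^'n^'m" where
  "replicate_rows w = (\<chi> i. w)"

definition unique_minimizer :: "('a \<Rightarrow> real) \<Rightarrow> 'a \<Rightarrow> bool" where
  "unique_minimizer f x \<longleftrightarrow> (\<forall>y. y \<noteq> x \<longrightarrow> f x < f y)"

definition noisy_grads ::
  "('m \<Rightarrow> real^'n \<Rightarrow> real) \<Rightarrow> real^'n^'m \<Rightarrow> real^'n^'m \<Rightarrow> real^'n^'m::finite" where
  "noisy_grads F W e = (\<chi> i. grad (F i) (W $ i) + e $ i)"

text \<open>Products are half-open: \<open>mat_prod A t s\<close> is the product A(t-1) ** ... ** A(s), which the
  usual notation writes with superscript (t-1:s). It is the identity for t \<open>\<le>\<close> s, and t = 0 gives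
  meaning to products whose upper index is -1.\<close>

primrec mat_prod :: "(nat \<Rightarrow> real^'d^'d) \<Rightarrow> nat \<Rightarrow> nat \<Rightarrow> real^'d^'d" where
  "mat_prod A 0 s = mat 1"
| "mat_prod A (Suc t) s = (if s \<le> t then A t ** mat_prod A t s else mat 1)"

definition spectral_norm :: "real^'d^'e \<Rightarrow> real" where
  "spectral_norm A = onorm (\<lambda>x. A *v x)"

definition complex_eigenvalues :: "real^'d^'d \<Rightarrow> complex set" where
  "complex_eigenvalues A =
     {z. \<exists>x::complex^'d. x \<noteq> 0 \<and> (\<chi> i j. complex_of_real (A $ i $ j)) *v x = z *s x}"

definition spectral_radius :: "real^'d^'d \<Rightarrow> real" where
  "spectral_radius A = Max (cmod ` complex_eigenvalues A)"

definition averaging_matrix :: "real^'m^'m::finite" where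
  "averaging_matrix = (\<chi> i j. 1 / real CARD('m))"

definition contraction_factor :: "(nat \<Rightarrow> real^'m^'m::finite) \<Rightarrow> nat \<Rightarrow> real" where
  "contraction_factor P B =
     (SUP k. spectral_norm (mat_prod P (k + B) k - averaging_matrix))"


subsection \<open>Graphs and weights\<close>

definition connected_graph :: "('m \<times> 'm) set \<Rightarrow> bool" where
  "connected_graph E \<longleftrightarrow> (\<forall>i j. (i, j) \<in> E\<^sup>*)"

text \<open>A link of E k is newly available at iteration k if it is not in E (k-1); before iteration 0
  no link is available.\<close>

definition flow_graph ::
  "(nat \<Rightarrow> ('m \<times> 'm) set) \<Rightarrow> (nat \<Rightarrow> 'm \<Rightarrow> nat) \<Rightarrow> nat \<Rightarrow> ('m \<times> 'm) set" where
  "flow_graph E v k =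
     {(i, j). (i, j) \<in> E k \<and> (k = 0 \<or> (i, j) \<notin> E (k - 1) \<or> v k i = 1 \<or> v k j = 1)}"

definition doubly_stochastic :: "real^'m^'m \<Rightarrow> bool" where
  "doubly_stochastic P \<longleftrightarrow>
     (\<forall>i j. 0 \<le> P $ i $ j) \<and> (\<forall>i. (\<Sum>j\<in>UNIV. P $ i $ j) = 1) \<and> (\<forall>j. (\<Sum>i\<in>UNIV. P $ i $ j) = 1)"

definition weight_conditions :: "real^'m^'m \<Rightarrow> ('m \<times> 'm) set \<Rightarrow> bool" where
  "weight_conditions P E' \<longleftrightarrow>
     (\<forall>i. 0 < P $ i $ i) \<and>
     (\<forall>i j. i \<noteq> j \<longrightarrow> (if (i, j) \<in> E' then 0 < P $ i $ j else P $ i $ j = 0)) \<and>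
     doubly_stochastic P \<and> transpose P = P"

definition connectivity_conditions ::
  "(nat \<Rightarrow> ('m \<times> 'm) set) \<Rightarrow> (nat \<Rightarrow> 'm \<Rightarrow> nat) \<Rightarrow> nat \<Rightarrow> nat \<Rightarrow> bool" where
  "connectivity_conditions E v B\<^sub>1 B\<^sub>2 \<longleftrightarrow>
     1 \<le> B\<^sub>1 \<and> 1 \<le> B\<^sub>2 \<and>
     (\<forall>k. connected_graph (\<Union>s\<in>{0..B\<^sub>1 - 1}. E (k + s))) \<and>
     (\<forall>i k. Max ((\<lambda>s. v (k + s) i) ` {0..B\<^sub>2 - 1}) = 1)"


subsection \<open>Gradient errors and error vector\<close>

text \<open>Row i of \<open>\<epsilon> k \<omega>\<close> is the error of device i at iteration k. In the last condition the whole error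
  matrix at iteration k is independent of the tuple of the initial models and all earlier errors;
  it is stated for the generated sigma-algebras because \<open>indep_var\<close> requires two random variables of
  the same type.\<close>

definition gradient_errors ::
  "'w measure \<Rightarrow> ('w \<Rightarrow> real^'n^'m) \<Rightarrow> (nat \<Rightarrow> 'w \<Rightarrow> real^'n^'m) \<Rightarrow> ('m \<Rightarrow> real) \<Rightarrow> bool" where
  "gradient_errors M W0 \<epsilon> \<sigma> \<longleftrightarrow>
     (\<forall>k. \<epsilon> k \<in> borel_measurable M) \<and>
     (\<forall>k i. (LINT \<omega>|M. \<epsilon> k \<omega> $ i) = 0) \<and>
     (\<forall>k i. integrable M (\<lambda>\<omega>. (norm (\<epsilon> k \<omega> $ i))\<^sup>2)) \<and>
     (\<forall>k i. (LINT \<omega>|M. (norm (\<epsilon> k \<omega> $ i))\<^sup>2) \<le> (\<sigma> i)\<^sup>2) \<and>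
     (\<forall>k i j. i \<noteq> j \<longrightarrow>
        prob_space.indep_var M borel (\<lambda>\<omega>. \<epsilon> k \<omega> $ i) borel (\<lambda>\<omega>. \<epsilon> k \<omega> $ j)) \<and>
     (\<forall>k. prob_space.indep_set M
        (sets (vimage_algebra (space M) (\<epsilon> k) borel))
        (sets (vimage_algebra (space M) (\<lambda>\<omega>. (W0 \<omega>, \<lambda>s\<in>{..<k}. \<epsilon> s \<omega>))
                (borel \<Otimes>\<^sub>M (\<Pi>\<^sub>M s\<in>{..<k}. borel)))))"

definition error_vector ::
  "'w measure \<Rightarrow> (nat \<Rightarrow> 'w \<Rightarrow> real^'n^'m::finite) \<Rightarrow> real^'n \<Rightarrow> nat \<Rightarrow> real^2" where
  "error_vector M W wopt k = vector
     [LINT \<omega>|M. (norm (avg_model (W k \<omega>) - wopt))\<^sup>2,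
      LINT \<omega>|M. (norm (W k \<omega> - replicate_rows (avg_model (W k \<omega>))))\<^sup>2]"


subsection \<open>Coefficients\<close>

definition coeff_A :: "real \<Rightarrow> real \<Rightarrow> real \<Rightarrow> (nat \<Rightarrow> real) \<Rightarrow> nat \<Rightarrow> real^2^2" where
  "coeff_A m \<mu> L \<alpha> k = vector
     [vector [1 - \<mu> * \<alpha> k, (1 + \<mu> * \<alpha> k) * \<alpha> k * L\<^sup>2 / (\<mu> * m)],
      vector [0, (1 + 2 * sqrt 2 * \<alpha> k * L)\<^sup>2]]"

definition coeff_C :: "real \<Rightarrow> real \<Rightarrow> real \<Rightarrow> real \<Rightarrow> (nat \<Rightarrow> real) \<Rightarrow> nat \<Rightarrow> real^2" where
  "coeff_C m L \<delta> \<sigma> \<alpha> k = vector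
     [(\<alpha> k)\<^sup>2 * \<sigma>\<^sup>2 / m,
      m * (\<alpha> k)\<^sup>2 *
        (2 * (1 + 2 * sqrt 2 * \<alpha> k * L) / (2 * sqrt 2 * \<alpha> k * L) * \<delta>\<^sup>2 + \<sigma>\<^sup>2)]"

definition phi11 :: "(nat \<Rightarrow> real^2^2) \<Rightarrow> nat \<Rightarrow> nat \<Rightarrow> real" where
  "phi11 A B k = mat_prod A ((k + 1) * B) (k * B) $ 1 $ 1"

definition phi12 :: "(nat \<Rightarrow> real^2^2) \<Rightarrow> nat \<Rightarrow> nat \<Rightarrow> real" where
  "phi12 A B k = mat_prod A ((k + 1) * B) (k * B) $ 1 $ 2"

definition phi22 ::
  "(nat \<Rightarrow> real^2^2) \<Rightarrow> real \<Rightarrow> real \<Rightarrow> (nat \<Rightarrow> real) \<Rightarrow> nat \<Rightarrow> nat \<Rightarrow> real" where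
  "phi22 A L \<rho> \<alpha> B k =
     (1 + \<rho>\<^sup>2) / 2 + 16 * real B * L\<^sup>2 / (1 - \<rho>\<^sup>2) *
       (\<Sum>r = k * B + 1..(k + 1) * B. (\<alpha> (r - 1))\<^sup>2 * mat_prod A (r - 1) (k * B) $ 2 $ 2)"

definition Phi ::
  "(nat \<Rightarrow> real^2^2) \<Rightarrow> real \<Rightarrow> real \<Rightarrow> (nat \<Rightarrow> real) \<Rightarrow> nat \<Rightarrow> nat \<Rightarrow> real^2^2" where
  "Phi A L \<rho> \<alpha> B k = vector
     [vector [phi11 A B k, phi12 A B k],
      vector [0, phi22 A L \<rho> \<alpha> B k]]"

definition psi1 :: "(nat \<Rightarrow> real^2^2) \<Rightarrow> (nat \<Rightarrow> real^2) \<Rightarrow> nat \<Rightarrow> nat \<Rightarrow> real" where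
  "psi1 A C B k =
     ((\<Sum>r = k * B + 1..(k + 1) * B - 1. mat_prod A ((k + 1) * B) r *v C (r - 1))
        + C ((k + 1) * B - 1)) $ 1"

definition psi2 ::
  "(nat \<Rightarrow> real^2^2) \<Rightarrow> (nat \<Rightarrow> real^2) \<Rightarrow> real \<Rightarrow> real \<Rightarrow> real \<Rightarrow> real \<Rightarrow> real \<Rightarrow>
     (nat \<Rightarrow> real) \<Rightarrow> nat \<Rightarrow> nat \<Rightarrow> real" where
  "psi2 A C m L \<delta> \<sigma> \<rho> \<alpha> B k =
     2 * real B * (\<Sum>r = k * B + 1..(k + 1) * B. (\<alpha> (r - 1))\<^sup>2 *
       (2 / (1 - \<rho>\<^sup>2) * (m * \<delta>\<^sup>2 + 4 * L\<^sup>2 *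
            (\<Sum>l = k * B + 1..r - 1. mat_prod A (r - 1) l $ 2 $ 2 * C (l - 1) $ 2))
        + m * \<sigma>\<^sup>2))"

definition Psi ::
  "(nat \<Rightarrow> real^2^2) \<Rightarrow> (nat \<Rightarrow> real^2) \<Rightarrow> real \<Rightarrow> real \<Rightarrow> real \<Rightarrow> real \<Rightarrow> real \<Rightarrow>
     (nat \<Rightarrow> real) \<Rightarrow> nat \<Rightarrow> nat \<Rightarrow> real^2" where
  "Psi A C m L \<delta> \<sigma> \<rho> \<alpha> B k = vector [psi1 A C B k, psi2 A C m L \<delta> \<sigma> \<rho> \<alpha> B k]"

definition Gamma1 :: "real \<Rightarrow> nat \<Rightarrow> real" where
  "Gamma1 \<rho> B = (1 - \<rho>\<^sup>2) / (2 * sqrt 2 * real B)"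

definition nu ::
  "real \<Rightarrow> real \<Rightarrow> real \<Rightarrow> real \<Rightarrow> real \<Rightarrow> (nat \<Rightarrow> real) \<Rightarrow> nat \<Rightarrow> nat \<Rightarrow> real" where
  "nu \<mu> L \<delta> \<sigma> \<rho> \<alpha> B k =
     2 / \<mu> * (real B - 1) * L\<^sup>2 * (1 + Gamma1 \<rho> B) ^ (2 * (B - 1)) *
       ((1 + Gamma1 \<rho> B) * \<delta>\<^sup>2 / (sqrt 2 * L) + \<alpha> k * \<sigma>\<^sup>2)"

definition switch_index :: "(nat \<Rightarrow> real) \<Rightarrow> (nat \<Rightarrow> real) \<Rightarrow> nat \<Rightarrow> bool" where
  "switch_index \<phi>1 \<phi>2 K \<longleftrightarrow> (\<forall>k<K. \<phi>1 k < \<phi>2 k) \<and> (\<forall>k\<ge>K. \<phi>1 k \<ge> \<phi>2 k)"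

text \<open>\<open>q\<close> is a family of quantities \<open>\<O>(x)\<close>: nonnegative and bounded by a multiple of \<open>x\<close>, with one
  constant for all indices in \<open>I\<close>.\<close>

definition nonneg_bigO :: "'i set \<Rightarrow> ('i \<Rightarrow> real) \<Rightarrow> ('i \<Rightarrow> real) \<Rightarrow> bool" where
  "nonneg_bigO I q x \<longleftrightarrow> (\<exists>C. \<forall>i\<in>I. 0 \<le> q i \<and> q i \<le> C * x i)"

text \<open>One scalar inequality of the convergence bound must be left out. If the initial average is almost
  surely optimal but the devices do not agree, the first entry of the bound at k = 1 reads
  \<open>\<Xi>\<^sub>1(B) \<le> \<Psi>\<^sub>1(0)\<close>, whatever the constants are. This can fail: \<open>\<Psi>\<^sub>1(0)\<close> does not depend on the
  initial models, whereas for non-quadratic losses the initial disagreement moves the average away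
  from the optimum.\<close>

definition degenerate_entry :: "real^2 \<Rightarrow> nat \<Rightarrow> 2 \<Rightarrow> bool" where
  "degenerate_entry \<Xi>0 k e \<longleftrightarrow> k = 1 \<and> e = 1 \<and> \<Xi>0 $ 1 = 0 \<and> \<Xi>0 $ 2 \<noteq> 0"

end

theory Submission
  imports Defs
begin

text \<open>The squared distance of the average model to the optimum and the disagreement of the devices
  satisfy one-step recursions with the matrices \<open>A\<close>. The gradient step contracts the average
  with the sharp factor \<open>1 - \<mu> \<alpha>\<close> by cocoercivity; the disagreement need not contract in a single
  step, but over a block of \<open>B\<close> steps the product of the weight matrices contracts it by \<open>\<rho>\<close>.
  The step size bound makes \<open>\<phi>\<^sub>2\<^sub>2 \<le> 1 - (1 - \<rho>\<^sup>2) / 4 < 1 - (1 - \<rho>\<^sup>2) / 8 \<le> \<phi>\<^sub>1\<^sub>1\<close> in every block, so the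
  switching index is always 0 and the disagreement decays geometrically faster than the distance to
  the optimum. Its feedback into the average is therefore absorbed by a potential. The noise part of
  this feedback is controlled by \<open>\<Psi>\<^sub>1\<close> even if the step sizes drop arbitrarily fast or
  \<open>\<sigma> = 0\<close>, because \<open>\<Psi>\<^sub>1\<close> of a block dominates the product of its first step size and that of the
  next block.\<close>

subsection \<open>Gradients\<close>

text \<open>The bound is entrywise, and this shapes the proof: its first entry may contain neither
  the initial disagreement nor the second entry of \<Psi>, although both feed into the average.
  Every such contribution has to be charged to \<open>\<Xi> 0 $ 1\<close> or to first entries of
  \<Psi>. The weight of the disagreement in the potential therefore shrinks with the step size:
  \<open>psi2\<close> itself need not be bounded by a multiple of \<open>psi1\<close>, but
  \<open>psi2\<close> times the first step size of the next block is. The last \<Psi> carries the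
  coefficient one, so the last block must not pay for the noise of the disagreement. The initial
  disagreement cannot be charged to noise of the same time. It is hidden in a constant that depends
  on the initial values, as a multiple of the initial distance to the optimum or, if that is zero,
  of the first noise term. That noise term belongs to the sum with free constants only from the
  second block on, and the remaining gap is \<open>degenerate_entry\<close>.\<close>

text \<open>The representing vector collects the values of the derivative on \<open>Basis\<close>.
  Uniqueness matters as much as existence, because \<open>grad\<close> is a definite
  description.\<close>

lemma GDERIV_grad:
  fixes f :: "real^'n \<Rightarrow> real"
  assumes "f differentiable (at x)"
  shows "GDERIV f x :> grad f x"
proof -
  obtain f' where f': "(f has_derivative f') (at x)"
    using assms by (auto simp: differentiable_def)
  then interpret bounded_linear f' by (rule has_derivative_bounded_linear)
  define D where "D = (\<Sum>b\<in>Basis. f' b *\<^sub>R b)"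
  have "f' h = h \<bullet> D" for h
  proof -
    have "f' h = f' (\<Sum>b\<in>Basis. (h \<bullet> b) *\<^sub>R b)" by (simp add: euclidean_representation)
    also have "\<dots> = h \<bullet> D"
      by (simp add: D_def sum scaleR inner_sum_right mult.commute)
    finally show ?thesis .
  qed
  then have "f' = (\<lambda>h. h \<bullet> D)" by (rule ext)
  then have D: "GDERIV f x :> D" using f' by (simp add: gderiv_def)
  moreover have "D' = D" if "GDERIV f x :> D'" for D'
  proof -
    have "(\<lambda>h. h \<bullet> D') = (\<lambda>h. h \<bullet> D)"
      using that D unfolding gderiv_def by (rule has_derivative_unique)
    then show ?thesis by (simp add: fun_eq_iff vector_eq_ldot)
  qed
  ultimately show ?thesis unfolding grad_def by (rule theI)
qed

lemma grad_eq:
  fixes f :: "real^'n \<Rightarrow> real"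
  assumes "GDERIV f x :> D"
  shows "grad f x = D"
proof -
  have "f differentiable (at x)"
    using assms by (auto simp: gderiv_def differentiable_def)
  then have "GDERIV f x :> grad f x" by (rule GDERIV_grad)
  then have "(\<lambda>h. h \<bullet> grad f x) = (\<lambda>h. h \<bullet> D)"
    using assms unfolding gderiv_def by (rule has_derivative_unique)
  then show ?thesis by (simp add: fun_eq_iff vector_eq_ldot)
qed

lemma GDERIV_avg_loss:
  fixes F :: "'m::finite \<Rightarrow> real^'n \<Rightarrow> real"
  assumes "\<And>i. F i differentiable (at w)"
  shows "GDERIV (avg_loss F) w :> (1 / real CARD('m)) *\<^sub>R (\<Sum>i\<in>UNIV. grad (F i) w)"
proof -
  have "((\<lambda>w. (\<Sum>i\<in>UNIV. F i w) / real CARD('m)) has_derivative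
      (\<lambda>h. (\<Sum>i\<in>UNIV. h \<bullet> grad (F i) w) / real CARD('m))) (at w)"
    using GDERIV_grad[OF assms] unfolding gderiv_def
    by (auto intro!: derivative_eq_intros)
  then show ?thesis
    by (simp add: gderiv_def avg_loss_def[abs_def] inner_sum_right)
qed

section \<open>Inequalities for gradients along line segments\<close>

lemma GDERIV_line:
  fixes f :: "'a::real_inner \<Rightarrow> real"
  assumes "\<And>x. GDERIV f x :> g x"
  shows "((\<lambda>t. f (x + t *\<^sub>R d)) has_real_derivative d \<bullet> g (x + t *\<^sub>R d)) (at t)"
proof -
  have "((\<lambda>t. x + t *\<^sub>R d) has_derivative (\<lambda>h. h *\<^sub>R d)) (at t)"
    by (auto intro!: derivative_eq_intros)
  moreover have "(f has_derivative (\<lambda>h. h \<bullet> g (x + t *\<^sub>R d))) (at (x + t *\<^sub>R d))"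
    using assms by (simp add: gderiv_def)
  ultimately have "((\<lambda>t. f (x + t *\<^sub>R d)) has_derivative
      (\<lambda>h. (h *\<^sub>R d) \<bullet> g (x + t *\<^sub>R d))) (at t)"
    by (rule diff_chain_at[unfolded o_def])
  moreover have "(\<lambda>h. (h *\<^sub>R d) \<bullet> g (x + t *\<^sub>R d)) = (*) (d \<bullet> g (x + t *\<^sub>R d))"
    by (rule ext) (simp add: mult.commute)
  ultimately show ?thesis
    by (simp only: has_field_derivative_def)
qed

text \<open>The difference between \<open>f\<close> and its tangent is nondecreasing on the segment:
  its derivative at \<open>t\<close>, multiplied by \<open>t\<close>, is the monotonicity inequality
  for \<open>x + t *\<^sub>R d\<close> and \<open>x\<close>.\<close>

lemma gradient_lower_bound:
  fixes f :: "'a::real_inner \<Rightarrow> real"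
  assumes f: "\<And>x. GDERIV f x :> g x"
    and mono: "\<And>x y. 0 \<le> (g x - g y) \<bullet> (x - y)"
  shows "f x + g x \<bullet> (y - x) \<le> f y"
proof -
  define d where "d = y - x"
  define h where "h t = f (x + t *\<^sub>R d) - t * (g x \<bullet> d)" for t
  have "(h has_real_derivative d \<bullet> g (x + t *\<^sub>R d) - g x \<bullet> d) (at t)" for t
    unfolding h_def by (auto intro!: derivative_eq_intros GDERIV_line f)
  moreover have "0 \<le> d \<bullet> g (x + t *\<^sub>R d) - g x \<bullet> d" if "0 \<le> t" for t
  proof (cases "t = 0")
    case False
    have "0 \<le> t * (d \<bullet> g (x + t *\<^sub>R d) - g x \<bullet> d)"
      using mono[of "x + t *\<^sub>R d" x]
      by (simp add: inner_diff_right inner_commute[of _ d] inner_commute[of "_ - _" d])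
    then show ?thesis using that False by (simp add: zero_le_mult_iff)
  qed (simp add: inner_commute)
  ultimately have "h 0 \<le> h 1"
    by (intro DERIV_nonneg_imp_nondecreasing[of 0 1 h]) (simp, blast)
  then show ?thesis by (simp add: h_def d_def)
qed

text \<open>The hypothesis bounds an inner product, not the norm of the gradient difference. In this
  form it survives the subtraction of a convex quadratic from \<open>f\<close>, which is how it is
  applied.\<close>

lemma gradient_upper_bound:
  fixes f :: "'a::real_inner \<Rightarrow> real"
  assumes f: "\<And>x. GDERIV f x :> g x"
    and lip: "\<And>x y. (g x - g y) \<bullet> (x - y) \<le> L * (norm (x - y))\<^sup>2"
  shows "f y \<le> f x + g x \<bullet> (y - x) + L / 2 * (norm (y - x))\<^sup>2"
proof -
  define d where "d = y - x"
  define h where "h t = f (x + t *\<^sub>R d) - t * (g x \<bullet> d) - L / 2 * (norm d)\<^sup>2 * t\<^sup>2" for t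
  have "(h has_real_derivative d \<bullet> g (x + t *\<^sub>R d) - g x \<bullet> d - L * (norm d)\<^sup>2 * t) (at t)" for t
    unfolding h_def by (auto intro!: derivative_eq_intros GDERIV_line f)
  moreover have "d \<bullet> g (x + t *\<^sub>R d) - g x \<bullet> d - L * (norm d)\<^sup>2 * t \<le> 0" if "0 \<le> t" for t
  proof (cases "t = 0")
    case False
    have "t * (d \<bullet> g (x + t *\<^sub>R d) - g x \<bullet> d - L * (norm d)\<^sup>2 * t) \<le> 0"
      using lip[of "x + t *\<^sub>R d" x]
      by (simp add: inner_diff_right inner_commute[of _ d] power_mult_distrib algebra_simps power2_eq_square)
    then show ?thesis using that False by (simp add: mult_le_0_iff)
  qed (simp add: inner_commute)
  ultimately have "h 1 \<le> h 0"
    by (intro DERIV_nonpos_imp_nonincreasing[of 0 1 h]) (simp, blast)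
  then show ?thesis by (simp add: h_def d_def)
qed

text \<open>The Baillon-Haddad inequality. Adding \<open>half\<close> to its mirror image cancels
  the function values.\<close>

lemma cocoercive:
  fixes f :: "'a::real_inner \<Rightarrow> real"
  assumes f: "\<And>x. GDERIV f x :> g x"
    and mono: "\<And>x y. 0 \<le> (g x - g y) \<bullet> (x - y)"
    and lip: "\<And>x y. (g x - g y) \<bullet> (x - y) \<le> L * (norm (x - y))\<^sup>2"
    and L: "0 < L"
  shows "(norm (g x - g y))\<^sup>2 \<le> L * ((g x - g y) \<bullet> (x - y))"
proof -
  have half: "f x + g x \<bullet> (y - x) + (norm (g y - g x))\<^sup>2 / (2 * L) \<le> f y" for x y
  proof -
    define u where "u = g y - g x"
    \<comment> \<open>The point where the quadratic upper bound at \<open>y\<close> minus the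
      tangent at \<open>x\<close> is smallest; comparing the two there yields the gain of
      \<open>(norm u)\<^sup>2 / (2 * L)\<close>.\<close>
    define z where "z = y - (1 / L) *\<^sub>R u"
    have "f x + g x \<bullet> (z - x) \<le> f z"
      by (rule gradient_lower_bound[OF f mono])
    also have "f z \<le> f y + g y \<bullet> (z - y) + L / 2 * (norm (z - y))\<^sup>2"
      by (rule gradient_upper_bound[OF f lip])
    finally have "f x + g x \<bullet> (z - x) \<le> f y + g y \<bullet> (z - y) + L / 2 * (norm (z - y))\<^sup>2" .
    moreover have "L / 2 * (norm (z - y))\<^sup>2 = (norm u)\<^sup>2 / (2 * L)"
      using L by (simp add: z_def power_divide power2_eq_square field_simps)
    moreover have "g y \<bullet> (z - y) = - (g y \<bullet> u) / L" by (simp add: z_def)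
    moreover have "g x \<bullet> (z - x) = g x \<bullet> (y - x) - (g x \<bullet> u) / L"
      by (simp add: z_def inner_diff_right)
    moreover have "(g y \<bullet> u) / L - (g x \<bullet> u) / L = (norm u)\<^sup>2 / L"
      by (simp add: u_def power2_norm_eq_inner inner_diff_left diff_divide_distrib)
    moreover have "(norm u)\<^sup>2 / L = 2 * ((norm u)\<^sup>2 / (2 * L))" by simp
    ultimately show ?thesis unfolding u_def[symmetric] by linarith
  qed
  from half[of x y] half[of y x]
  have "(norm (g x - g y))\<^sup>2 / L \<le> (g x - g y) \<bullet> (x - y)"
    by (simp add: norm_minus_commute inner_diff_left inner_diff_right)
  then show ?thesis using L by (simp add: field_simps)
qed

text \<open>The sharp factor \<open>1 - \<mu> a\<close> comes from cocoercivity of the gradient of \<open>f - \<mu>/2 |\<cdot>|\<^sup>2\<close>; Lipschitz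
  continuity and strong monotonicity alone only give \<open>1 - 2 \<mu> a + a\<^sup>2 L\<^sup>2\<close> for the square.\<close>

lemma gradient_step_contraction:
  fixes f :: "'a::real_inner \<Rightarrow> real"
  assumes f: "\<And>x. GDERIV f x :> g x"
    and mono: "\<And>x y. \<mu> * (norm (x - y))\<^sup>2 \<le> (g x - g y) \<bullet> (x - y)"
    and lip: "\<And>x y. norm (g x - g y) \<le> L * norm (x - y)"
    and L: "0 < L" "0 \<le> \<mu>" and a: "0 \<le> a" "a * (L + 2 * \<mu>) \<le> 2"
  shows "norm ((x - a *\<^sub>R g x) - (y - a *\<^sub>R g y)) \<le> (1 - \<mu> * a) * norm (x - y)"
proof -
  define f' where "f' x = f x - \<mu> / 2 * (x \<bullet> x)" for x
  define h where "h x = g x - \<mu> *\<^sub>R x" for x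
  have f': "GDERIV f' x :> h x" for x
  proof -
    have "(f' has_derivative (\<lambda>d. d \<bullet> g x - \<mu> / 2 * (x \<bullet> d + d \<bullet> x))) (at x)"
      using f[of x] unfolding gderiv_def f'_def by (auto intro!: derivative_eq_intros)
    moreover have "(\<lambda>d. d \<bullet> g x - \<mu> / 2 * (x \<bullet> d + d \<bullet> x)) = (\<lambda>d. d \<bullet> h x)"
      by (rule ext) (simp add: h_def inner_diff_right inner_commute[of x])
    ultimately show ?thesis by (simp add: gderiv_def)
  qed
  have h: "(h x - h y) \<bullet> (x - y) = (g x - g y) \<bullet> (x - y) - \<mu> * (norm (x - y))\<^sup>2" for x y
    by (simp add: h_def power2_norm_eq_inner inner_diff_left inner_diff_right algebra_simps)
  have mono': "0 \<le> (h x - h y) \<bullet> (x - y)" for x y using mono[of x y] h[of x y] by simp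
  have lip': "(h x - h y) \<bullet> (x - y) \<le> L * (norm (x - y))\<^sup>2" for x y
  proof -
    have "(g x - g y) \<bullet> (x - y) \<le> norm (g x - g y) * norm (x - y)" by (rule norm_cauchy_schwarz)
    also have "\<dots> \<le> L * norm (x - y) * norm (x - y)" using lip by (rule mult_right_mono) simp
    finally have "(g x - g y) \<bullet> (x - y) \<le> L * (norm (x - y))\<^sup>2" by (simp add: power2_eq_square)
    moreover have "0 \<le> \<mu> * (norm (x - y))\<^sup>2" using L(2) by simp
    ultimately show ?thesis using h[of x y] by linarith
  qed
  define u d where "u = h x - h y" and "d = x - y"
  have u: "(norm u)\<^sup>2 \<le> L * (u \<bullet> d)" "0 \<le> u \<bullet> d"
    using cocoercive[OF f' mono' lip' L(1)] mono' by (auto simp: u_def d_def)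
  have "\<mu> * a \<le> a * (L + 2 * \<mu>) / 2" using L a by (simp add: algebra_simps)
  then have a': "\<mu> * a \<le> 1" using a by simp
  have eq: "(x - a *\<^sub>R g x) - (y - a *\<^sub>R g y) = (1 - \<mu> * a) *\<^sub>R d - a *\<^sub>R u"
    by (simp add: u_def d_def h_def algebra_simps)
  have "(norm ((1 - \<mu> * a) *\<^sub>R d - a *\<^sub>R u))\<^sup>2
      = (1 - \<mu> * a)\<^sup>2 * (norm d)\<^sup>2 - 2 * a * (1 - \<mu> * a) * (u \<bullet> d) + a\<^sup>2 * (norm u)\<^sup>2"
    unfolding power2_norm_eq_inner
    by (simp add: inner_diff_left inner_diff_right inner_commute[of d u] power2_eq_square algebra_simps)
  also have "\<dots> \<le> (1 - \<mu> * a)\<^sup>2 * (norm d)\<^sup>2 - 2 * a * (1 - \<mu> * a) * (u \<bullet> d) + a\<^sup>2 * (L * (u \<bullet> d))"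
    using u by (intro add_left_mono mult_left_mono) auto
  \<comment> \<open>Cocoercivity has traded the square of \<open>u\<close> for
    \<open>u \<bullet> d\<close>. The step size condition is exactly what makes the collected
    coefficient of \<open>u \<bullet> d\<close> nonpositive.\<close>
  also have "\<dots> = (1 - \<mu> * a)\<^sup>2 * (norm d)\<^sup>2 - a * (2 - a * (L + 2 * \<mu>)) * (u \<bullet> d)"
    by (simp add: algebra_simps power2_eq_square)
  also have "\<dots> \<le> (1 - \<mu> * a)\<^sup>2 * (norm d)\<^sup>2" using u a by simp
  also have "\<dots> = ((1 - \<mu> * a) * norm d)\<^sup>2" by (simp add: power_mult_distrib)
  finally have "norm ((1 - \<mu> * a) *\<^sub>R d - a *\<^sub>R u) \<le> (1 - \<mu> * a) * norm d"
    by (rule power2_le_imp_le) (use a' in simp)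
  then show ?thesis unfolding eq by (simp only: d_def)
qed

subsection \<open>Disagreement and stochastic matrices\<close>

text \<open>The orthogonal projection that removes the consensus part of a matrix.\<close>

definition disagreement :: "real^'n^'m::finite \<Rightarrow> real^'n^'m" where
  "disagreement X = X - replicate_rows (avg_model X)"

lemma row_matrix_mult: "(A ** X) $ i = (\<Sum>j\<in>UNIV. A $ i $ j *\<^sub>R X $ j)"
  for X :: "real^'n^'m"
  by (simp add: vec_eq_iff matrix_matrix_mult_def)

lemma power2_norm_rows: "(norm X)\<^sup>2 = (\<Sum>i\<in>UNIV. (norm (X $ i))\<^sup>2)"
  for X :: "real^'n^'m"
  by (simp add: norm_vec_def L2_set_def sum_nonneg)

lemma power2_norm_columns: "(norm X)\<^sup>2 = (\<Sum>j\<in>UNIV. (norm (column j X))\<^sup>2)"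
  for X :: "real^'n^'m"
proof -
  have "(norm X)\<^sup>2 = (\<Sum>i\<in>UNIV. \<Sum>j\<in>UNIV. (X $ i $ j)\<^sup>2)"
    by (simp add: power2_norm_rows norm_vec_def L2_set_def sum_nonneg)
  also have "\<dots> = (\<Sum>j\<in>UNIV. \<Sum>i\<in>UNIV. (X $ i $ j)\<^sup>2)" by (rule sum.swap)
  also have "\<dots> = (\<Sum>j\<in>UNIV. (norm (column j X))\<^sup>2)"
    by (simp add: norm_vec_def L2_set_def sum_nonneg column_def)
  finally show ?thesis .
qed

text \<open>Variance equals second moment minus squared mean. For nonnegative weights this gives
  Jensen's inequality for the squared norm; for equal weights it shows that removing the average
  does not lengthen a matrix.\<close>

lemma weighted_variance:
  fixes x :: "'i \<Rightarrow> 'a::real_inner"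
  assumes "(\<Sum>i\<in>I. p i) = 1"
  shows "(\<Sum>i\<in>I. p i * (norm (x i - (\<Sum>j\<in>I. p j *\<^sub>R x j)))\<^sup>2)
    = (\<Sum>i\<in>I. p i * (norm (x i))\<^sup>2) - (norm (\<Sum>j\<in>I. p j *\<^sub>R x j))\<^sup>2"
proof -
  define b where "b = (\<Sum>j\<in>I. p j *\<^sub>R x j)"
  have "(\<Sum>i\<in>I. p i * (norm (x i - b))\<^sup>2)
      = (\<Sum>i\<in>I. p i * (norm (x i))\<^sup>2 - 2 * ((p i *\<^sub>R x i) \<bullet> b) + p i * (norm b)\<^sup>2)"
    by (intro sum.cong refl)
      (simp add: power2_norm_eq_inner inner_diff_left inner_diff_right inner_commute algebra_simps)
  also have "\<dots> = (\<Sum>i\<in>I. p i * (norm (x i))\<^sup>2) - 2 * (b \<bullet> b) + (norm b)\<^sup>2"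
    by (simp add: sum.distrib sum_subtractf sum_distrib_left[symmetric] sum_distrib_right[symmetric]
        inner_sum_left[symmetric] b_def[symmetric] assms del: inner_scaleR_left)
  finally show ?thesis by (simp add: b_def power2_norm_eq_inner)
qed

lemma norm_convex_combination_le:
  fixes x :: "'i \<Rightarrow> 'a::real_inner"
  assumes "(\<Sum>i\<in>I. p i) = 1" and "\<And>i. i \<in> I \<Longrightarrow> 0 \<le> p i"
  shows "(norm (\<Sum>i\<in>I. p i *\<^sub>R x i))\<^sup>2 \<le> (\<Sum>i\<in>I. p i * (norm (x i))\<^sup>2)"
proof -
  have "0 \<le> (\<Sum>i\<in>I. p i * (norm (x i - (\<Sum>j\<in>I. p j *\<^sub>R x j)))\<^sup>2)"
    using assms(2) by (intro sum_nonneg) simp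
  then show ?thesis using weighted_variance[OF assms(1), of x] by linarith
qed

lemma avg_model_alt: "avg_model X = (\<Sum>i\<in>UNIV. (1 / real CARD('m)) *\<^sub>R X $ i)"
  for X :: "real^'n^'m::finite"
  by (simp add: avg_model_def scaleR_sum_right)

lemma linear_avg_model: "linear avg_model"
  by (rule linearI) (simp_all add: avg_model_def sum.distrib scaleR_sum_right[symmetric]
      scaleR_add_right mult.commute)

lemma linear_replicate_rows: "linear replicate_rows"
  by (rule linearI) (simp_all add: replicate_rows_def vec_eq_iff)

lemma linear_disagreement: "linear disagreement"
proof -
  have "linear (\<lambda>X. X - (replicate_rows \<circ> avg_model) X)"
    by (intro linear_compose_sub linear_ident linear_compose linear_avg_model linear_replicate_rows)
  then show ?thesis by (simp add: disagreement_def[abs_def])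
qed

lemma avg_model_replicate_rows [simp]: "avg_model (replicate_rows w :: real^'n^'m::finite) = w"
  by (simp add: avg_model_def replicate_rows_def sum_constant_scaleR del: sum_constant)

lemma disagreement_replicate_rows [simp]: "disagreement (replicate_rows w) = 0"
  by (simp add: disagreement_def)

lemma avg_model_disagreement [simp]: "avg_model (disagreement X) = 0"
  by (simp add: disagreement_def linear_diff[OF linear_avg_model])

lemma disagreement_row [simp]: "disagreement X $ i = X $ i - avg_model X"
  by (simp add: disagreement_def replicate_rows_def)

lemma power2_norm_avg_model_le:
  "(norm (avg_model X))\<^sup>2 \<le> (norm X)\<^sup>2 / real CARD('m)" for X :: "real^'n^'m::finite"
  unfolding avg_model_alt power2_norm_rows sum_divide_distrib
  by (rule order_trans[OF norm_convex_combination_le]) simp_all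

lemma norm_disagreement_le: "norm (disagreement X) \<le> norm X"
  for X :: "real^'n^'m::finite"
proof (rule power2_le_imp_le)
  have "(norm (disagreement X))\<^sup>2 / real CARD('m)
      = (\<Sum>i\<in>UNIV. 1 / real CARD('m) * (norm (X $ i - avg_model X))\<^sup>2)"
    by (simp add: power2_norm_rows sum_divide_distrib)
  also have "\<dots> = (\<Sum>i\<in>UNIV. 1 / real CARD('m) * (norm (X $ i))\<^sup>2) - (norm (avg_model X))\<^sup>2"
    unfolding avg_model_alt by (rule weighted_variance) simp
  also have "\<dots> \<le> (\<Sum>i\<in>UNIV. 1 / real CARD('m) * (norm (X $ i))\<^sup>2)" by simp
  also have "\<dots> = (norm X)\<^sup>2 / real CARD('m)"
    by (simp add: power2_norm_rows sum_divide_distrib)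
  finally show "(norm (disagreement X))\<^sup>2 \<le> (norm X)\<^sup>2" by (simp add: divide_le_cancel)
qed simp

section \<open>Doubly stochastic matrices\<close>

lemma doubly_stochastic_mat_1: "doubly_stochastic (mat 1)"
  by (simp add: doubly_stochastic_def mat_def)

lemma doubly_stochastic_mult:
  fixes P Q :: "real^'m^'m"
  assumes P: "doubly_stochastic P" and Q: "doubly_stochastic Q"
  shows "doubly_stochastic (P ** Q)"
proof -
  have "(\<Sum>j\<in>UNIV. \<Sum>k\<in>UNIV. P $ i $ k * Q $ k $ j) = 1" for i
    using P Q by (subst sum.swap) (simp add: sum_distrib_left[symmetric] doubly_stochastic_def)
  moreover have "(\<Sum>i\<in>UNIV. \<Sum>k\<in>UNIV. P $ i $ k * Q $ k $ j) = 1" for j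
    using P Q by (subst sum.swap) (simp add: sum_distrib_right[symmetric] doubly_stochastic_def)
  moreover have "0 \<le> (\<Sum>k\<in>UNIV. P $ i $ k * Q $ k $ j)" for i j
    using P Q by (auto intro!: sum_nonneg mult_nonneg_nonneg simp: doubly_stochastic_def)
  ultimately show ?thesis
    by (simp add: doubly_stochastic_def matrix_matrix_mult_def)
qed

lemma doubly_stochastic_mat_prod:
  assumes "\<And>t. doubly_stochastic (P t)"
  shows "doubly_stochastic (mat_prod P t s)"
  by (induction t) (auto intro: doubly_stochastic_mult doubly_stochastic_mat_1 assms)

lemma avg_model_stochastic_mult:
  fixes X :: "real^'n^'m"
  assumes "doubly_stochastic P"
  shows "avg_model (P ** X) = avg_model X"
proof -
  have "(\<Sum>i\<in>UNIV. \<Sum>j\<in>UNIV. P $ i $ j *\<^sub>R X $ j) = (\<Sum>j\<in>UNIV. X $ j)"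
    using assms by (subst sum.swap) (simp add: scaleR_sum_left[symmetric] doubly_stochastic_def)
  then show ?thesis by (simp add: avg_model_def row_matrix_mult)
qed

text \<open>Row sums one fix the consensus part and column sums one keep the average, so
  \<open>P\<close> commutes with the projection.\<close>

lemma disagreement_stochastic_mult:
  fixes X :: "real^'n^'m"
  assumes "doubly_stochastic P"
  shows "disagreement (P ** X) = P ** disagreement X"
proof -
  have "(\<Sum>j\<in>UNIV. P $ i $ j *\<^sub>R (X $ j - c)) = (\<Sum>j\<in>UNIV. P $ i $ j *\<^sub>R X $ j) - c" for i and c :: "real^'n"
    using assms
    by (simp add: scaleR_diff_right sum_subtractf scaleR_sum_left[symmetric] doubly_stochastic_def)
  then show ?thesis
    by (simp add: vec_eq_iff[where 'a="real^'n"] avg_model_stochastic_mult[OF assms] row_matrix_mult)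
qed

section \<open>Frobenius norms of matrix products\<close>

lemma column_matrix_mult: "column j (A ** X) = A *v column j X"
  by (simp add: vec_eq_iff column_def matrix_matrix_mult_def matrix_vector_mult_def)

text \<open>Left multiplication acts on each column separately and the squared Frobenius norm is the
  sum over the columns, so a bound for vectors carries over with the same constant.\<close>

lemma norm_matrix_mult_le:
  fixes A :: "real^'m^'l" and X :: "real^'n^'m"
  assumes "\<And>x. norm (A *v x) \<le> c * norm x" and "0 \<le> c"
  shows "norm (A ** X) \<le> c * norm X"
proof (rule power2_le_imp_le)
  have "(norm (A ** X))\<^sup>2 \<le> (\<Sum>j\<in>UNIV. (c * norm (column j X))\<^sup>2)"
    unfolding power2_norm_columns[of "A ** X"] column_matrix_mult
    by (intro sum_mono power_mono assms norm_ge_zero)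
  also have "\<dots> = (c * norm X)\<^sup>2"
    by (simp add: power_mult_distrib power2_norm_columns[of X] sum_distrib_left)
  finally show "(norm (A ** X))\<^sup>2 \<le> (c * norm X)\<^sup>2" .
qed (use assms in simp)

lemma norm_matrix_mult_le_spectral_norm: "norm (A ** X) \<le> spectral_norm A * norm X"
  for A :: "real^'m^'l" and X :: "real^'n^'m"
  unfolding spectral_norm_def
  by (rule norm_matrix_mult_le) (auto intro: onorm onorm_pos_le simp: matrix_vector_mul_bounded_linear)

text \<open>Row sums one allow Jensen's inequality in each row; column sums one make the weights of
  each entry add up to one once the sums are exchanged.\<close>

lemma norm_stochastic_vector_mult_le:
  fixes x :: "real^'m"
  assumes P: "doubly_stochastic P"
  shows "norm (P *v x) \<le> norm x"
proof (rule power2_le_imp_le)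
  have "(norm (P *v x))\<^sup>2 = (\<Sum>i\<in>UNIV. (norm (\<Sum>j\<in>UNIV. P $ i $ j *\<^sub>R x $ j))\<^sup>2)"
    by (simp add: norm_vec_def L2_set_def sum_nonneg matrix_vector_mult_def)
  also have "\<dots> \<le> (\<Sum>i\<in>UNIV. \<Sum>j\<in>UNIV. P $ i $ j * (norm (x $ j))\<^sup>2)"
    using P by (intro sum_mono norm_convex_combination_le) (auto simp: doubly_stochastic_def)
  also have "\<dots> = (\<Sum>j\<in>UNIV. (norm (x $ j))\<^sup>2)"
    using P by (subst sum.swap) (simp add: sum_distrib_right[symmetric] doubly_stochastic_def)
  also have "\<dots> = (norm x)\<^sup>2" by (simp add: norm_vec_def L2_set_def sum_nonneg)
  finally show "(norm (P *v x))\<^sup>2 \<le> (norm x)\<^sup>2" .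
qed simp

lemma norm_stochastic_mult_le:
  fixes X :: "real^'n^'m"
  assumes "doubly_stochastic P"
  shows "norm (P ** X) \<le> norm X"
  using norm_matrix_mult_le[of P 1 X] norm_stochastic_vector_mult_le[OF assms] by simp

section \<open>Distance of the weight products from exact averaging\<close>

lemma doubly_stochastic_averaging_matrix: "doubly_stochastic averaging_matrix"
  by (simp add: doubly_stochastic_def averaging_matrix_def)

lemma matrix_mult_diff_left: "(A - B) ** X = A ** X - B ** X"
  for X :: "real^'n^'m"
  by (simp add: vec_eq_iff matrix_matrix_mult_def left_diff_distrib sum_subtractf)

lemma linear_matrix_mult: "linear (\<lambda>X :: real^'n^'m. A ** X)"
  by (rule linearI) (simp_all add: vec_eq_iff matrix_matrix_mult_def distrib_left sum.distrib
      sum_distrib_left mult.left_commute)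

lemma averaging_matrix_mult: "averaging_matrix ** X = replicate_rows (avg_model X)"
  for X :: "real^'n^'m::finite"
  by (simp add: vec_eq_iff[where 'a="real^'n"] row_matrix_mult averaging_matrix_def
      replicate_rows_def avg_model_alt)

text \<open>A supremum of reals is an upper bound only for a bounded family. The bound 2 works
  because the product and the averaging matrix are both doubly stochastic and hence
  nonexpansive.\<close>

lemma spectral_norm_le_contraction_factor:
  fixes P :: "nat \<Rightarrow> real^'m^'m::finite"
  assumes "\<And>t. doubly_stochastic (P t)"
  shows "spectral_norm (mat_prod P (k + B) k - averaging_matrix) \<le> contraction_factor P B"
  unfolding contraction_factor_def
proof (rule cSUP_upper)
  have "norm ((mat_prod P (k + B) k - averaging_matrix) *v x) \<le> norm x * 2" for x :: "real^'m" and k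
  proof -
    have "norm ((mat_prod P (k + B) k - averaging_matrix) *v x)
        \<le> norm (mat_prod P (k + B) k *v x) + norm (averaging_matrix *v x)"
      by (simp add: matrix_vector_mult_diff_rdistrib norm_triangle_ineq4)
    also have "\<dots> \<le> norm x + norm x"
      by (intro add_mono norm_stochastic_vector_mult_le doubly_stochastic_mat_prod assms
          doubly_stochastic_averaging_matrix)
    finally show ?thesis by simp
  qed
  then show "bdd_above (range (\<lambda>k. spectral_norm (mat_prod P (k + B) k - averaging_matrix)))"
    unfolding spectral_norm_def by (intro bdd_aboveI2[where M=2] onorm_le) (simp add: mult.commute)
qed simp

text \<open>The averaging matrix annihilates disagreements, so it can be subtracted from the product
  without changing the result.\<close>

lemma norm_mat_prod_disagreement_le:
  fixes P :: "nat \<Rightarrow> real^'m^'m::finite" and X :: "real^'n^'m"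
  assumes "\<And>t. doubly_stochastic (P t)"
  shows "norm (mat_prod P (k + B) k ** disagreement X)
    \<le> contraction_factor P B * norm (disagreement X)"
proof -
  have "mat_prod P (k + B) k ** disagreement X
      = (mat_prod P (k + B) k - averaging_matrix) ** disagreement X"
    by (simp add: matrix_mult_diff_left averaging_matrix_mult linear_0[OF linear_replicate_rows])
  also have "norm \<dots> \<le> spectral_norm (mat_prod P (k + B) k - averaging_matrix) * norm (disagreement X)"
    by (rule norm_matrix_mult_le_spectral_norm)
  also have "\<dots> \<le> contraction_factor P B * norm (disagreement X)"
    by (intro mult_right_mono spectral_norm_le_contraction_factor assms) simp
  finally show ?thesis .
qed

text \<open>Serves to move the weight products from the noise of a block onto the models at its
  start.\<close>

lemma inner_matrix_mult: "X \<bullet> (A ** Y) = (transpose A ** X) \<bullet> Y"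
  for X Y :: "real^'n^'m::finite"
proof -
  have "X \<bullet> (A ** Y) = (\<Sum>i\<in>UNIV. \<Sum>j\<in>UNIV. A $ i $ j * (X $ i \<bullet> Y $ j))"
    by (simp add: inner_vec_def[where 'a="real^'n"] row_matrix_mult inner_sum_right)
  also have "\<dots> = (transpose A ** X) \<bullet> Y"
    by (subst sum.swap)
      (simp add: inner_vec_def[where 'a="real^'n"] row_matrix_mult inner_sum_left transpose_def)
  finally show ?thesis .
qed

lemma mat_prod_self [simp]: "mat_prod A s s = mat 1"
  by (cases s) auto

lemma linear_recursion_unroll:
  fixes X :: "nat \<Rightarrow> real^'n^'m"
  assumes "\<And>t. s \<le> t \<Longrightarrow> X (Suc t) = P t ** X t + H t"
  shows "X (s + n) = mat_prod P (s + n) s ** X s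
    + (\<Sum>r<n. mat_prod P (s + n) (Suc (s + r)) ** H (s + r))"
proof (induction n)
  case (Suc n)
  have "(\<Sum>r<n. mat_prod P (s + Suc n) (Suc (s + r)) ** H (s + r))
      = P (s + n) ** (\<Sum>r<n. mat_prod P (s + n) (Suc (s + r)) ** H (s + r))"
    by (simp add: matrix_mul_assoc[symmetric] linear_sum[OF linear_matrix_mult])
  then show ?case
    by (simp add: assms Suc.IH matrix_add_ldistrib matrix_mul_assoc[symmetric])
qed simp

subsection \<open>Deterministic one-step estimates\<close>

text \<open>Young's inequality. The free parameter \<open>c\<close> is later set to
  \<open>\<mu> * a\<close> for the average, to \<open>s\<close> for one step of the disagreement,
  and to a constant depending on \<rho> for a block.\<close>

lemma power2_norm_add_le:
  fixes x y :: "'a::real_inner"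
  assumes "0 < c"
  shows "(norm (x + y))\<^sup>2 \<le> (1 + c) * (norm x)\<^sup>2 + (1 + 1 / c) * (norm y)\<^sup>2"
proof -
  have "0 \<le> (norm (c *\<^sub>R x - y))\<^sup>2 / c" using assms by simp
  also have "(norm (c *\<^sub>R x - y))\<^sup>2 / c = c * (norm x)\<^sup>2 + (norm y)\<^sup>2 / c - 2 * (x \<bullet> y)"
    using assms unfolding power2_norm_eq_inner
    by (simp add: inner_diff_left inner_diff_right inner_commute field_simps)
  also have "\<dots> = (1 + c) * (norm x)\<^sup>2 + (1 + 1 / c) * (norm y)\<^sup>2 - (norm (x + y))\<^sup>2"
    unfolding power2_norm_eq_inner
    by (simp add: inner_add_left inner_add_right inner_commute algebra_simps)
  finally show ?thesis by simp
qed

lemma power2_norm_le_mult: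
  "norm x \<le> c * norm y \<Longrightarrow> (norm x)\<^sup>2 \<le> c\<^sup>2 * (norm y)\<^sup>2"
  using power_mono[of "norm x" "c * norm y" 2] by (simp add: power_mult_distrib)

locale heterogeneous_losses =
  fixes F :: "'m::finite \<Rightarrow> real^'n \<Rightarrow> real" and L \<mu> \<delta> :: real and wopt :: "real^'n"
  assumes diff: "F i differentiable (at w)"
    and lip: "norm (grad (F i) w - grad (F i) w') \<le> L * norm (w - w')"
    and strong: "\<mu> * (norm (w - w'))\<^sup>2 \<le> (grad (F i) w - grad (F i) w') \<bullet> (w - w')"
    and het: "norm (grad (F i) w - grad (avg_loss F) w) \<le> \<delta>"
    and opt: "unique_minimizer (avg_loss F) wopt"
    and mu_pos: "0 < \<mu>" and delta_pos: "0 < \<delta>"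
begin

abbreviation G :: "real^'n^'m \<Rightarrow> real^'n^'m" where "G X \<equiv> noisy_grads F X 0"

text \<open>Both gradient conditions are compared at 0 and a unit vector, which exists because the
  index type is nonempty.\<close>

lemma mu_le_L: "\<mu> \<le> L"
proof -
  obtain d :: "real^'n" where d: "norm d = 1" using vector_choose_size[of 1] by auto
  let ?u = "grad (F undefined) d - grad (F undefined) 0"
  have "\<mu> * (norm d)\<^sup>2 \<le> ?u \<bullet> d" using strong[of d 0] by simp
  also have "\<dots> \<le> norm ?u * norm d" by (rule norm_cauchy_schwarz)
  also have "\<dots> \<le> L" using lip[of undefined d 0] d by simp
  finally show ?thesis by (simp add: d)
qed

lemma L_pos: "0 < L" using mu_le_L mu_pos by linarith

lemma noisy_grads_eq: "noisy_grads F X e = G X + e"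
  by (simp add: noisy_grads_def vec_eq_iff)

text \<open>Expresses the global gradient through \<open>G\<close> at a consensus matrix, so that
  estimates for \<open>G\<close> and for averages apply to it.\<close>

lemma grad_avg_loss: "grad (avg_loss F) w = avg_model (G (replicate_rows w))"
  using grad_eq[OF GDERIV_avg_loss[OF diff]]
  by (simp add: avg_model_def noisy_grads_def replicate_rows_def)

lemma GDERIV_avg: "GDERIV (avg_loss F) w :> grad (avg_loss F) w"
  unfolding grad_eq[OF GDERIV_avg_loss[OF diff]] by (rule GDERIV_avg_loss[OF diff])

lemma norm_G_diff_le: "norm (G X - G Y) \<le> L * norm (X - Y)"
proof (rule power2_le_imp_le)
  have "(norm (G X - G Y))\<^sup>2 = (\<Sum>i\<in>UNIV. (norm (grad (F i) (X $ i) - grad (F i) (Y $ i)))\<^sup>2)"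
    by (simp add: power2_norm_rows noisy_grads_def)
  also have "\<dots> \<le> (\<Sum>i\<in>UNIV. (L * norm (X $ i - Y $ i))\<^sup>2)"
    by (intro sum_mono power_mono lip) simp
  also have "\<dots> = (L * norm (X - Y))\<^sup>2"
    by (simp add: power2_norm_rows[of "X - Y"] power_mult_distrib sum_distrib_left)
  finally show "(norm (G X - G Y))\<^sup>2 \<le> (L * norm (X - Y))\<^sup>2" .
qed (use L_pos in simp)

lemma continuous_on_G: "continuous_on UNIV G"
  by (rule lipschitz_on_continuous_on[OF lipschitz_onI[of _ _ L]])
    (use norm_G_diff_le L_pos in \<open>auto simp: dist_norm\<close>)

text \<open>The factor \<open>m\<close> gained by replicating a row cancels the one lost by
  averaging.\<close>

lemma grad_avg_loss_lipschitz:
  "norm (grad (avg_loss F) w - grad (avg_loss F) w') \<le> L * norm (w - w')"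
proof (rule power2_le_imp_le)
  let ?D = "G (replicate_rows w) - G (replicate_rows w')"
  have "norm ?D \<le> L * norm (replicate_rows (w - w') :: real^'n^'m)"
    using norm_G_diff_le by (simp add: linear_diff[OF linear_replicate_rows])
  then have "(norm ?D)\<^sup>2 \<le> (L * norm (replicate_rows (w - w') :: real^'n^'m))\<^sup>2"
    by (rule power_mono) simp
  also have "\<dots> = real CARD('m) * (L * norm (w - w'))\<^sup>2"
    by (simp add: power_mult_distrib power2_norm_rows[of "replicate_rows (w - w')"]) (simp add: replicate_rows_def)
  finally have "(norm ?D)\<^sup>2 / real CARD('m) \<le> (L * norm (w - w'))\<^sup>2"
    by (simp add: field_simps)
  with power2_norm_avg_model_le[of ?D]
  show "(norm (grad (avg_loss F) w - grad (avg_loss F) w'))\<^sup>2 \<le> (L * norm (w - w'))\<^sup>2"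
    by (simp add: grad_avg_loss linear_diff[OF linear_avg_model])
qed (use L_pos in simp)

lemma grad_avg_loss_strong:
  "\<mu> * (norm (w - w'))\<^sup>2 \<le> (grad (avg_loss F) w - grad (avg_loss F) w') \<bullet> (w - w')"
proof -
  have "\<mu> * (norm (w - w'))\<^sup>2 = (\<Sum>i\<in>(UNIV::'m set). \<mu> * (norm (w - w'))\<^sup>2) / real CARD('m)"
    by simp
  also have "\<dots> \<le> (\<Sum>i\<in>UNIV. (grad (F i) w - grad (F i) w') \<bullet> (w - w')) / real CARD('m)"
    by (intro divide_right_mono sum_mono strong) simp
  also have "\<dots> = (grad (avg_loss F) w - grad (avg_loss F) w') \<bullet> (w - w')"
    by (simp add: grad_avg_loss avg_model_def noisy_grads_def replicate_rows_def
        inner_diff_left inner_sum_left sum_subtractf diff_divide_distrib)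
  finally show ?thesis .
qed

lemma grad_avg_loss_wopt: "grad (avg_loss F) wopt = 0"
proof -
  have "avg_loss F wopt \<le> avg_loss F y" for y
    using opt by (cases "y = wopt") (auto simp: unique_minimizer_def less_imp_le)
  then have "(\<lambda>h. h \<bullet> grad (avg_loss F) wopt) = (\<lambda>h. 0)"
    using GDERIV_avg[of wopt] unfolding gderiv_def
    by (intro has_derivative_local_min) auto
  then have "grad (avg_loss F) wopt \<bullet> grad (avg_loss F) wopt = 0" by (rule fun_cong)
  then show ?thesis by simp
qed

text \<open>The averaged step is an exact gradient step for the average loss plus \<open>a\<close>
  times an averaged gradient error \<open>D\<close> caused by the disagreement. Young's inequality
  with \<open>c = \<mu> * a\<close> spends one of the two contraction factors:
  \<open>(1 + c) * (1 - c)\<^sup>2\<close> is at most \<open>1 - c\<close>. The other weight,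
  \<open>1 + 1 / c\<close>, produces the coupling coefficient.\<close>

lemma average_step:
  fixes X :: "real^'n^'m"
  assumes a: "0 < a" "a * L \<le> 1 / 2"
  shows "(norm (avg_model X - a *\<^sub>R avg_model (G X) - wopt))\<^sup>2
    \<le> (1 - \<mu> * a) * (norm (avg_model X - wopt))\<^sup>2
      + (1 + \<mu> * a) * a * L\<^sup>2 / (\<mu> * real CARD('m)) * (norm (disagreement X))\<^sup>2"
proof -
  define x where "x = avg_model X"
  define D where "D = G (replicate_rows x) - G X"
  define u where "u = (x - a *\<^sub>R grad (avg_loss F) x) - (wopt - a *\<^sub>R grad (avg_loss F) wopt)"
  have eq: "x - a *\<^sub>R avg_model (G X) - wopt = u + a *\<^sub>R avg_model D"
    by (simp add: u_def grad_avg_loss_wopt D_def linear_diff[OF linear_avg_model]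
        grad_avg_loss[of x] scaleR_diff_right)
  \<comment> \<open>Since \<mu> is at most \<open>L\<close>, the quantity
    \<open>a * (L + 2 * \<mu>)\<close> is at most 3/2, within the range of the contraction
    lemma.\<close>
  have "a * \<mu> \<le> a * L" using mu_le_L a by simp
  then have a': "\<mu> * a \<le> 1 / 2" "a * (L + 2 * \<mu>) \<le> 2"
    using a(2) by (auto simp: algebra_simps)
  have "norm u \<le> (1 - \<mu> * a) * norm (x - wopt)"
    unfolding u_def using a a' L_pos mu_pos
    by (intro gradient_step_contraction[OF GDERIV_avg grad_avg_loss_strong grad_avg_loss_lipschitz]) auto
  then have u: "(norm u)\<^sup>2 \<le> (1 - \<mu> * a)\<^sup>2 * (norm (x - wopt))\<^sup>2"
    by (rule power2_norm_le_mult)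
  have "norm D \<le> L * norm (disagreement X)"
    using norm_G_diff_le[of "replicate_rows x" X]
    by (simp add: D_def disagreement_def x_def norm_minus_commute)
  then have "(norm D)\<^sup>2 \<le> L\<^sup>2 * (norm (disagreement X))\<^sup>2"
    by (rule power2_norm_le_mult)
  then have "(norm D)\<^sup>2 / real CARD('m) \<le> L\<^sup>2 * (norm (disagreement X))\<^sup>2 / real CARD('m)"
    by (rule divide_right_mono) simp
  with power2_norm_avg_model_le[of D]
  have D: "(norm (avg_model D))\<^sup>2 \<le> L\<^sup>2 * (norm (disagreement X))\<^sup>2 / real CARD('m)"
    by linarith
  have c: "0 < \<mu> * a" using a mu_pos by simp
  have "(norm (u + a *\<^sub>R avg_model D))\<^sup>2
      \<le> (1 + \<mu> * a) * (norm u)\<^sup>2 + (1 + 1 / (\<mu> * a)) * (norm (a *\<^sub>R avg_model D))\<^sup>2"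
    by (rule power2_norm_add_le[OF c])
  also have "(1 + 1 / (\<mu> * a)) * (norm (a *\<^sub>R avg_model D))\<^sup>2
      = (1 + \<mu> * a) * a / \<mu> * (norm (avg_model D))\<^sup>2"
    using a mu_pos by (simp add: power_mult_distrib field_simps power2_eq_square)
  also have "(1 + \<mu> * a) * (norm u)\<^sup>2 + \<dots>
      \<le> (1 + \<mu> * a) * ((1 - \<mu> * a)\<^sup>2 * (norm (x - wopt))\<^sup>2)
        + (1 + \<mu> * a) * a / \<mu> * (L\<^sup>2 * (norm (disagreement X))\<^sup>2 / real CARD('m))"
    using u D c a mu_pos by (intro add_mono mult_left_mono) auto
  also have "(1 + \<mu> * a) * ((1 - \<mu> * a)\<^sup>2 * (norm (x - wopt))\<^sup>2)
      = (1 - (\<mu> * a)\<^sup>2) * ((1 - \<mu> * a) * (norm (x - wopt))\<^sup>2)"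
    by (simp add: power2_eq_square algebra_simps)
  also have "\<dots> \<le> 1 * ((1 - \<mu> * a) * (norm (x - wopt))\<^sup>2)"
    using a' by (intro mult_right_mono) auto
  finally show ?thesis unfolding x_def[symmetric] eq by (simp add: mult.assoc)
qed

text \<open>\<open>U\<close> is controlled by Lipschitz continuity and \<open>V\<close> by
  heterogeneity. Subtracting the consensus matrix with rows \<open>g\<close> is free, because the
  projection annihilates it.\<close>

lemma disagreement_G_le:
  fixes X :: "real^'n^'m"
  shows "(norm (disagreement (G X)))\<^sup>2
    \<le> 2 * L\<^sup>2 * (norm (disagreement X))\<^sup>2 + 2 * real CARD('m) * \<delta>\<^sup>2"
proof -
  define x where "x = avg_model X"
  define g where "g = grad (avg_loss F) x"
  define U where "U = G X - G (replicate_rows x)"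
  define V where "V = G (replicate_rows x) - replicate_rows g"
  have "disagreement (G X) = disagreement (U + V)"
    by (simp add: U_def V_def linear_diff[OF linear_disagreement])
  then have "norm (disagreement (G X)) \<le> norm (U + V)"
    by (simp add: norm_disagreement_le)
  then have "(norm (disagreement (G X)))\<^sup>2 \<le> (norm (U + V))\<^sup>2" by (rule power_mono) simp
  also have "\<dots> \<le> 2 * (norm U)\<^sup>2 + 2 * (norm V)\<^sup>2"
    using power2_norm_add_le[of 1 U V] by simp
  also have "(norm U)\<^sup>2 \<le> L\<^sup>2 * (norm (disagreement X))\<^sup>2"
    using norm_G_diff_le[of X "replicate_rows x"]
    by (intro power2_norm_le_mult) (simp add: U_def x_def disagreement_def)
  also have "(norm V)\<^sup>2 \<le> real CARD('m) * \<delta>\<^sup>2"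
  proof -
    have "(norm V)\<^sup>2 = (\<Sum>i\<in>UNIV. (norm (grad (F i) x - g))\<^sup>2)"
      by (simp add: power2_norm_rows V_def noisy_grads_def replicate_rows_def)
    also have "\<dots> \<le> (\<Sum>i\<in>(UNIV::'m set). \<delta>\<^sup>2)"
      unfolding g_def by (intro sum_mono power_mono het) simp
    finally show ?thesis by simp
  qed
  finally show ?thesis by simp
qed

text \<open>\<open>P\<close> is used as nonexpansive only. With \<open>s\<close> as parameter in
  Young's inequality, \<open>2 * (a * L)\<^sup>2\<close> equals \<open>s\<^sup>2 / 4\<close>, and
  everything in front of the old disagreement fits under \<open>(1 + s)\<^sup>2\<close>.\<close>

lemma disagreement_step:
  fixes X :: "real^'n^'m"
  assumes P: "doubly_stochastic P" and a: "0 < a"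
  defines "s \<equiv> 2 * sqrt 2 * a * L"
  shows "(norm (P ** disagreement X - a *\<^sub>R disagreement (G X)))\<^sup>2
    \<le> (1 + s)\<^sup>2 * (norm (disagreement X))\<^sup>2 + real CARD('m) * a\<^sup>2 * (2 * (1 + s) / s * \<delta>\<^sup>2)"
proof -
  have s: "0 < s" using a L_pos by (simp add: s_def)
  have "(norm (P ** disagreement X + (- a) *\<^sub>R disagreement (G X)))\<^sup>2
      \<le> (1 + s) * (norm (P ** disagreement X))\<^sup>2
        + (1 + 1 / s) * (norm ((- a) *\<^sub>R disagreement (G X)))\<^sup>2"
    by (rule power2_norm_add_le[OF s])
  also have "(norm ((- a) *\<^sub>R disagreement (G X)))\<^sup>2 = a\<^sup>2 * (norm (disagreement (G X)))\<^sup>2"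
    by (simp add: power_mult_distrib)
  also have "(1 + s) * (norm (P ** disagreement X))\<^sup>2 + (1 + 1 / s) * (a\<^sup>2 * (norm (disagreement (G X)))\<^sup>2)
      \<le> (1 + s) * (norm (disagreement X))\<^sup>2 + (1 + 1 / s) * (a\<^sup>2 *
        (2 * L\<^sup>2 * (norm (disagreement X))\<^sup>2 + 2 * real CARD('m) * \<delta>\<^sup>2))"
    using s by (intro add_mono mult_left_mono power_mono disagreement_G_le norm_stochastic_mult_le P) auto
  also have "\<dots> = ((1 + s) + (1 + 1 / s) * (2 * (a * L)\<^sup>2)) * (norm (disagreement X))\<^sup>2
      + real CARD('m) * a\<^sup>2 * (2 * (1 + s) / s * \<delta>\<^sup>2)"
    using s by (simp add: power_mult_distrib field_simps)
  also have "2 * (a * L)\<^sup>2 = s\<^sup>2 / 4" by (simp add: s_def power_mult_distrib)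
  also have "(1 + s) + (1 + 1 / s) * (s\<^sup>2 / 4) \<le> (1 + s)\<^sup>2"
    using s by (simp add: field_simps power2_eq_square)
  finally show ?thesis using s by (simp add: mult_right_mono)
qed

end

subsection \<open>Square-integrable random vectors\<close>

text \<open>Up to the factor \<open>m\<close>, replicating rows is the adjoint of averaging. This
  turns products with averaged noise into products with the whole noise matrix.\<close>

lemma inner_replicate_rows: "X \<bullet> replicate_rows w = real CARD('m) * (avg_model X \<bullet> w)"
  for X :: "real^'n^'m::finite"
  by (simp add: inner_vec_def[where 'a="real^'n"] replicate_rows_def avg_model_def inner_sum_left)

text \<open>An orthogonal projection is self-adjoint.\<close>

lemma inner_disagreement: "X \<bullet> disagreement Y = disagreement X \<bullet> Y"
  for X Y :: "real^'n^'m::finite"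
proof -
  have "replicate_rows (avg_model X) \<bullet> Y = X \<bullet> replicate_rows (avg_model Y)"
    by (simp add: inner_replicate_rows inner_commute[of "replicate_rows (avg_model X)"]
        inner_commute[of "avg_model Y"])
  then show ?thesis by (simp add: disagreement_def inner_diff_left inner_diff_right)
qed

lemma power2_norm_sum_le:
  fixes x :: "'i \<Rightarrow> 'a::real_normed_vector"
  shows "(norm (\<Sum>i\<in>I. x i))\<^sup>2 \<le> real (card I) * (\<Sum>i\<in>I. (norm (x i))\<^sup>2)"
proof -
  have "(norm (\<Sum>i\<in>I. x i))\<^sup>2 \<le> (\<Sum>i\<in>I. norm (x i))\<^sup>2"
    by (intro power_mono norm_sum norm_ge_zero)
  also have "\<dots> \<le> (\<Sum>i\<in>I. (norm (x i))\<^sup>2) * real (card I)"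
    by (rule sum_squared_le_sum_of_squares)
  finally show ?thesis by (simp add: mult.commute)
qed

context prob_space
begin

text \<open>Measurability of \<open>X\<close> is part of the definition, since it does not follow
  from integrability of the squared norm.\<close>

definition square_integrable :: "('a \<Rightarrow> 'b::euclidean_space) \<Rightarrow> bool" where
  "square_integrable X \<longleftrightarrow> X \<in> borel_measurable M \<and> integrable M (\<lambda>\<omega>. (norm (X \<omega>))\<^sup>2)"

lemma square_integrable_power2 [simp]:
  "square_integrable X \<Longrightarrow> integrable M (\<lambda>\<omega>. (norm (X \<omega>))\<^sup>2)"
  by (simp add: square_integrable_def)

lemma square_integrable_bound:
  assumes X: "square_integrable X" and [measurable]: "Y \<in> borel_measurable M"
    and le: "\<And>\<omega>. \<omega> \<in> space M \<Longrightarrow> norm (Y \<omega>) \<le> b + c * norm (X \<omega>)"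
  shows "square_integrable Y"
proof -
  have "integrable M (\<lambda>\<omega>. 2 * b\<^sup>2 + 2 * c\<^sup>2 * (norm (X \<omega>))\<^sup>2)"
    using X by (simp add: square_integrable_def)
  then have "integrable M (\<lambda>\<omega>. (norm (Y \<omega>))\<^sup>2)"
  proof (rule Bochner_Integration.integrable_bound[OF _ _ AE_I2])
    fix \<omega> assume "\<omega> \<in> space M"
    have "(norm (Y \<omega>))\<^sup>2 \<le> (b + c * norm (X \<omega>))\<^sup>2"
      by (rule power_mono[OF le]) (simp_all add: \<open>\<omega> \<in> space M\<close>)
    also have "\<dots> \<le> 2 * b\<^sup>2 + 2 * (c * norm (X \<omega>))\<^sup>2"
      using power2_norm_add_le[of 1 b "c * norm (X \<omega>)"] by simp
    finally show "norm ((norm (Y \<omega>))\<^sup>2) \<le> norm (2 * b\<^sup>2 + 2 * c\<^sup>2 * (norm (X \<omega>))\<^sup>2)"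
      by (simp add: power_mult_distrib)
  qed simp
  then show ?thesis by (simp add: square_integrable_def)
qed

lemma square_integrable_add:
  assumes X: "square_integrable X" and Y: "square_integrable Y"
  shows "square_integrable (\<lambda>\<omega>. X \<omega> + Y \<omega>)"
proof -
  have [measurable]: "X \<in> borel_measurable M" "Y \<in> borel_measurable M"
    using X Y by (simp_all add: square_integrable_def)
  have "integrable M (\<lambda>\<omega>. 2 * (norm (X \<omega>))\<^sup>2 + 2 * (norm (Y \<omega>))\<^sup>2)" using X Y by simp
  then have "integrable M (\<lambda>\<omega>. (norm (X \<omega> + Y \<omega>))\<^sup>2)"
  proof (rule Bochner_Integration.integrable_bound[OF _ _ AE_I2])
    fix \<omega>
    show "norm ((norm (X \<omega> + Y \<omega>))\<^sup>2) \<le> norm (2 * (norm (X \<omega>))\<^sup>2 + 2 * (norm (Y \<omega>))\<^sup>2)"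
      using power2_norm_add_le[of 1 "X \<omega>" "Y \<omega>"] by simp
  qed simp
  then show ?thesis by (simp add: square_integrable_def)
qed

lemma square_integrable_linear:
  assumes X: "square_integrable X" and T: "linear T"
  shows "square_integrable (\<lambda>\<omega>. T (X \<omega>))"
proof -
  interpret T: bounded_linear T using T by (simp add: linear_conv_bounded_linear)
  obtain K where K: "\<And>x. norm (T x) \<le> norm x * K" using T.bounded by blast
  have [measurable]: "X \<in> borel_measurable M" using X by (simp add: square_integrable_def)
  have "(\<lambda>\<omega>. T (X \<omega>)) \<in> borel_measurable M"
    by (rule borel_measurable_continuous_on[OF linear_continuous_on]) (unfold_locales, measurable)
  then show ?thesis
    by (rule square_integrable_bound[OF X, where b=0 and c=K]) (use K in \<open>simp add: mult.commute\<close>)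
qed

lemma square_integrable_sum:
  assumes "\<And>i. i \<in> I \<Longrightarrow> square_integrable (X i)"
  shows "square_integrable (\<lambda>\<omega>. \<Sum>i\<in>I. X i \<omega>)"
  using assms
proof (induction I rule: infinite_finite_induct)
  case (insert i I)
  then show ?case using square_integrable_add[of "X i" "\<lambda>\<omega>. \<Sum>i\<in>I. X i \<omega>"] by simp
qed (simp_all add: square_integrable_def)

lemma square_integrable_imp_integrable:
  assumes "square_integrable X"
  shows "integrable M X"
proof -
  have [measurable]: "X \<in> borel_measurable M" using assms by (simp add: square_integrable_def)
  have "integrable M (\<lambda>\<omega>. 1 + (norm (X \<omega>))\<^sup>2)" using assms by simp
  then show ?thesis
  proof (rule Bochner_Integration.integrable_bound[OF _ _ AE_I2])
    fix \<omega>
    have "norm (X \<omega>) \<le> 1 + (norm (X \<omega>))\<^sup>2"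
      using sum_squares_bound[of 1 "norm (X \<omega>)"] norm_ge_zero[of "X \<omega>"]
      by (simp del: norm_ge_zero)
    then show "norm (X \<omega>) \<le> norm (1 + (norm (X \<omega>))\<^sup>2)" by simp
  qed simp
qed

lemma integrable_inner_square:
  assumes X: "square_integrable X" and Y: "square_integrable Y"
  shows "integrable M (\<lambda>\<omega>. X \<omega> \<bullet> Y \<omega>)"
proof -
  have [measurable]: "X \<in> borel_measurable M" "Y \<in> borel_measurable M"
    using X Y by (simp_all add: square_integrable_def)
  have "integrable M (\<lambda>\<omega>. (norm (X \<omega>))\<^sup>2 + (norm (Y \<omega>))\<^sup>2)" using X Y by simp
  then show ?thesis
  proof (rule Bochner_Integration.integrable_bound[OF _ _ AE_I2])
    fix \<omega>
    have "\<bar>X \<omega> \<bullet> Y \<omega>\<bar> \<le> norm (X \<omega>) * norm (Y \<omega>)" by (rule Cauchy_Schwarz_ineq2)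
    also have "\<dots> \<le> 2 * norm (X \<omega>) * norm (Y \<omega>)" by simp
    also have "\<dots> \<le> (norm (X \<omega>))\<^sup>2 + (norm (Y \<omega>))\<^sup>2" by (rule sum_squares_bound)
    finally show "norm (X \<omega> \<bullet> Y \<omega>) \<le> norm ((norm (X \<omega>))\<^sup>2 + (norm (Y \<omega>))\<^sup>2)" by simp
  qed simp
qed

text \<open>Independence passes to the coordinates, where the product rule for real random variables
  applies.\<close>

lemma expectation_inner_indep:
  fixes X Y :: "'a \<Rightarrow> 'b::euclidean_space"
  assumes indep: "indep_var borel X borel Y" and X: "integrable M X" and Y: "integrable M Y"
  shows "expectation (\<lambda>\<omega>. X \<omega> \<bullet> Y \<omega>) = expectation X \<bullet> expectation Y"
proof -
  have ind: "indep_var borel (\<lambda>\<omega>. X \<omega> \<bullet> b) borel (\<lambda>\<omega>. Y \<omega> \<bullet> b)" for b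
    using indep_var_compose[OF indep, of "\<lambda>x. x \<bullet> b" borel "\<lambda>x. x \<bullet> b" borel] by (simp add: o_def)
  have "expectation (\<lambda>\<omega>. X \<omega> \<bullet> Y \<omega>) = expectation (\<lambda>\<omega>. \<Sum>b\<in>Basis. (X \<omega> \<bullet> b) * (Y \<omega> \<bullet> b))"
    by (subst euclidean_inner) simp
  also have "\<dots> = (\<Sum>b\<in>Basis. expectation (\<lambda>\<omega>. (X \<omega> \<bullet> b) * (Y \<omega> \<bullet> b)))"
    using X Y by (intro Bochner_Integration.integral_sum indep_var_integrable ind) auto
  also have "\<dots> = (\<Sum>b\<in>Basis. expectation (\<lambda>\<omega>. X \<omega> \<bullet> b) * expectation (\<lambda>\<omega>. Y \<omega> \<bullet> b))"
    using X Y by (intro sum.cong refl indep_var_lebesgue_integral ind) auto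
  also have "\<dots> = (\<Sum>b\<in>Basis. (expectation X \<bullet> b) * (expectation Y \<bullet> b))"
    using X Y by simp
  also have "\<dots> = expectation X \<bullet> expectation Y" by (rule euclidean_inner[symmetric])
  finally show ?thesis .
qed

end

subsection \<open>One-step error recursion\<close>

lemma power2_norm_diff_scaleR:
  fixes x y :: "'a::real_inner"
  shows "(norm (x - a *\<^sub>R y))\<^sup>2 = (norm x)\<^sup>2 - 2 * a * (x \<bullet> y) + a\<^sup>2 * (norm y)\<^sup>2"
  unfolding power2_norm_eq_inner
  by (simp add: inner_diff_left inner_diff_right inner_commute power2_eq_square algebra_simps)

locale decentralized_sgd = prob_space M + heterogeneous_losses F L \<mu> \<delta> wopt
  for M :: "'w measure" and F :: "'m::finite \<Rightarrow> real^'n \<Rightarrow> real" and L \<mu> \<delta> wopt +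
  fixes W \<epsilon> :: "nat \<Rightarrow> 'w \<Rightarrow> real^'n^'m" and P :: "nat \<Rightarrow> real^'m^'m"
    and \<alpha> :: "nat \<Rightarrow> real" and \<sigma> :: real
  assumes W0: "W 0 \<in> borel_measurable M" "integrable M (\<lambda>\<omega>. (norm (W 0 \<omega>))\<^sup>2)"
    and noise: "gradient_errors M (W 0) \<epsilon> (\<lambda>_. \<sigma>)"
    and P: "doubly_stochastic (P k)"
    and iterate: "\<omega> \<in> space M \<Longrightarrow>
      W (Suc k) \<omega> = P k ** W k \<omega> - \<alpha> k *\<^sub>R noisy_grads F (W k \<omega>) (\<epsilon> k \<omega>)"
    and alpha_pos: "0 < \<alpha> k" and alpha_small: "\<alpha> k * L \<le> 1 / 2"
begin

section \<open>Measurability and independence of the iterates\<close>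

definition past :: "nat \<Rightarrow> 'w measure" where
  "past k = vimage_algebra (space M) (\<lambda>\<omega>. (W 0 \<omega>, \<lambda>s\<in>{..<k}. \<epsilon> s \<omega>))
     (borel \<Otimes>\<^sub>M (\<Pi>\<^sub>M s\<in>{..<k}. borel))"

lemma space_past [simp]: "space (past k) = space M"
  by (simp add: past_def)

lemma history_measurable:
  "(\<lambda>\<omega>. (W 0 \<omega>, \<lambda>s\<in>{..<k}. \<epsilon> s \<omega>)) \<in> past k \<rightarrow>\<^sub>M borel \<Otimes>\<^sub>M (\<Pi>\<^sub>M s\<in>{..<k}. borel)"
  unfolding past_def by (rule measurable_vimage_algebra1) (auto simp: space_pair_measure space_PiM)

lemma measurable_matrix_mult: "(\<lambda>X. A ** X) \<in> borel_measurable borel"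
  for A :: "real^'m^'m"
  using linear_matrix_mult[of A] by (intro borel_measurable_continuous_onI linear_continuous_on)
    (simp add: linear_conv_bounded_linear)

lemma measurable_G [measurable]: "G \<in> borel_measurable borel"
  by (intro borel_measurable_continuous_onI continuous_on_G)

text \<open>The measure \<open>N\<close> is left open because the same induction serves for the
  sigma-algebra of the past and for \<open>M\<close> itself.\<close>

lemma iterate_measurable:
  assumes "space N = space M" and "W 0 \<in> borel_measurable N"
    and "\<And>s. s < k \<Longrightarrow> \<epsilon> s \<in> borel_measurable N"
  shows "W k \<in> borel_measurable N"
  using assms(3)
proof (induction k)
  case (Suc k)
  then have [measurable]: "W k \<in> borel_measurable N" "\<epsilon> k \<in> borel_measurable N" by auto
  note [measurable] = measurable_matrix_mult[of "P k"]
  have "(\<lambda>\<omega>. P k ** W k \<omega> - \<alpha> k *\<^sub>R (G (W k \<omega>) + \<epsilon> k \<omega>)) \<in> borel_measurable N"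
    by measurable
  also have "?this \<longleftrightarrow> ?case"
    by (intro measurable_cong) (simp add: iterate assms(1) noisy_grads_eq[of _ "\<epsilon> k _"])
  finally show ?case .
qed (rule assms(2))

lemma W_measurable_past:
  assumes "s \<le> k"
  shows "W s \<in> borel_measurable (past k)"
proof (rule iterate_measurable)
  show "W 0 \<in> borel_measurable (past k)"
    using measurable_compose[OF history_measurable measurable_fst] by simp
  show "\<epsilon> r \<in> borel_measurable (past k)" if "r < s" for r
    using measurable_compose[OF measurable_compose[OF history_measurable measurable_snd]
        measurable_component_singleton[of r]] that assms by simp
qed simp

lemma eps_square_integrable: "square_integrable (\<epsilon> k)"
proof -
  have "integrable M (\<lambda>\<omega>. \<Sum>i\<in>UNIV. (norm (\<epsilon> k \<omega> $ i))\<^sup>2)"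
    using noise by (intro Bochner_Integration.integrable_sum) (simp add: gradient_errors_def)
  then show ?thesis
    using noise by (simp add: square_integrable_def gradient_errors_def power2_norm_rows)
qed

lemma measurable_eps [measurable]: "\<epsilon> k \<in> borel_measurable M"
  using noise by (simp add: gradient_errors_def)

lemma measurable_W [measurable]: "W k \<in> borel_measurable M"
  by (rule iterate_measurable[OF refl W0(1) measurable_eps])

lemma expectation_eps: "expectation (\<epsilon> k) = 0"
proof -
  have "expectation (\<epsilon> k) $ i = 0" for i
    using integral_bounded_linear[OF bounded_linear_vec_nth[of i]
        square_integrable_imp_integrable[OF eps_square_integrable[of k]]] noise
    by (simp add: gradient_errors_def)
  then show ?thesis by (simp add: vec_eq_iff[where 'a="real^'n"])
qed

text \<open>\<open>W s\<close> is a function of the initial models and the errors before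
  \<open>s\<close>, so the sigma-algebra it generates is contained in \<open>past k\<close>.\<close>

lemma indep_W_eps:
  assumes "s \<le> k"
  shows "indep_var borel (W s) borel (\<epsilon> k)"
proof -
  have "indep_set (sigma_sets (space M) {W s -` A \<inter> space M |A. A \<in> sets borel})
      (sigma_sets (space M) {\<epsilon> k -` A \<inter> space M |A. A \<in> sets borel})"
  proof -
    have past: "sigma_sets (space M) {W s -` A \<inter> space M |A. A \<in> sets borel} \<subseteq> sets (past k)"
      using measurable_sets[OF W_measurable_past[OF assms]]
      by (intro sets.sigma_sets_subset[of _ "past k", unfolded space_past]) auto
    \<comment> \<open>\<open>past k\<close> is literally the second sigma-algebra in
      \<open>gradient_errors\<close>, so the assumption applies by unfolding.\<close>
    have "indep_set (sets (vimage_algebra (space M) (\<epsilon> k) borel)) (sets (past k))"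
      using noise by (simp add: gradient_errors_def past_def)
    then have indep: "indep_set (sigma_sets (space M) {\<epsilon> k -` A \<inter> space M |A. A \<in> sets borel}) (sets (past k))"
      by (simp only: sets_vimage_algebra)
    show ?thesis
      unfolding indep_sets2_eq
    proof (intro conjI ballI)
      fix a b
      assume a: "a \<in> sigma_sets (space M) {W s -` A \<inter> space M |A. A \<in> sets borel}"
        and b: "b \<in> sigma_sets (space M) {\<epsilon> k -` A \<inter> space M |A. A \<in> sets borel}"
      have "prob (b \<inter> a) = prob b * prob a"
        by (rule indep_setD[OF indep b subsetD[OF past a]])
      then show "prob (a \<inter> b) = prob a * prob b" by (simp only: Int_commute mult.commute)
    qed (use past indep in \<open>auto simp only: indep_sets2_eq\<close>)
  qed
  then show ?thesis by (simp add: indep_var_eq)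
qed

lemma W_square_integrable: "square_integrable (W k)"
proof (induction k)
  case 0
  then show ?case using W0 by (simp add: square_integrable_def)
next
  case (Suc k)
  have G: "square_integrable (\<lambda>\<omega>. G (W k \<omega>))"
  proof (rule square_integrable_bound[OF Suc, where b="norm (G 0)" and c=L])
    show "norm (G (W k \<omega>)) \<le> norm (G 0) + L * norm (W k \<omega>)" for \<omega>
      using norm_G_diff_le[of "W k \<omega>" 0] norm_triangle_ineq[of "G (W k \<omega>) - G 0" "G 0"] by simp
  qed simp
  have "square_integrable (\<lambda>\<omega>. P k ** W k \<omega> + (- \<alpha> k) *\<^sub>R (G (W k \<omega>) + \<epsilon> k \<omega>))"
    by (intro square_integrable_add square_integrable_linear[OF Suc linear_matrix_mult]
        square_integrable_linear[OF _ linear_scaleR] G eps_square_integrable)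
  then have "square_integrable (\<lambda>\<omega>. P k ** W k \<omega> - \<alpha> k *\<^sub>R (G (W k \<omega>) + \<epsilon> k \<omega>))" by simp
  then show ?case
  \<comment> \<open>The iteration is given on \<open>space M\<close> only, so the equation of
    functions is replaced by a pointwise bound there.\<close>
  proof (rule square_integrable_bound[OF _ measurable_W, where b=0 and c=1])
    fix \<omega> assume "\<omega> \<in> space M"
    then show "norm (W (Suc k) \<omega>) \<le> 0 + 1 * norm (P k ** W k \<omega> - \<alpha> k *\<^sub>R (G (W k \<omega>) + \<epsilon> k \<omega>))"
      by (simp add: iterate noisy_grads_eq[of _ "\<epsilon> k _"])
  qed
qed

lemma G_square_integrable: "square_integrable (\<lambda>\<omega>. G (W k \<omega>))"
proof (rule square_integrable_bound[OF W_square_integrable[of k], where b="norm (G 0)" and c=L])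
  show "(\<lambda>\<omega>. G (W k \<omega>)) \<in> borel_measurable M" by measurable
  show "norm (G (W k \<omega>)) \<le> norm (G 0) + L * norm (W k \<omega>)" for \<omega>
    using norm_G_diff_le[of "W k \<omega>" 0] norm_triangle_ineq[of "G (W k \<omega>) - G 0" "G 0"] by simp
qed

text \<open>Removes every cross term between noise and a function of an earlier state. Allowing
  \<open>s\<close> below \<open>k\<close> is what the block estimate needs, where all noise of a
  block is paired with the models at its start.\<close>

lemma expectation_inner_eps:
  fixes h :: "real^'n^'m \<Rightarrow> real^'n^'m"
  assumes "s \<le> k" and h: "h \<in> borel_measurable borel" "square_integrable (\<lambda>\<omega>. h (W s \<omega>))"
  shows "expectation (\<lambda>\<omega>. h (W s \<omega>) \<bullet> \<epsilon> k \<omega>) = 0"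
proof -
  have "indep_var borel (\<lambda>\<omega>. h (W s \<omega>)) borel (\<epsilon> k)"
    using indep_var_compose[OF indep_W_eps[OF assms(1)] h(1), of "\<lambda>x. x" borel] by (simp add: o_def)
  then show ?thesis
    using h(2) by (simp add: expectation_inner_indep square_integrable_imp_integrable
        eps_square_integrable expectation_eps)
qed

lemma expectation_norm_eps_le: "expectation (\<lambda>\<omega>. (norm (\<epsilon> k \<omega>))\<^sup>2) \<le> real CARD('m) * \<sigma>\<^sup>2"
proof -
  have "expectation (\<lambda>\<omega>. (norm (\<epsilon> k \<omega>))\<^sup>2) = (\<Sum>i\<in>UNIV. expectation (\<lambda>\<omega>. (norm (\<epsilon> k \<omega> $ i))\<^sup>2))"
    unfolding power2_norm_rows
    using noise by (intro Bochner_Integration.integral_sum) (simp add: gradient_errors_def)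
  also have "\<dots> \<le> (\<Sum>i\<in>(UNIV::'m set). \<sigma>\<^sup>2)"
    using noise by (intro sum_mono) (simp add: gradient_errors_def)
  finally show ?thesis by simp
qed

text \<open>Independence across devices kills the mixed terms, so only \<open>m\<close> diagonal
  terms face the denominator \<open>m\<^sup>2\<close>.\<close>

lemma expectation_norm_avg_eps_le:
  "expectation (\<lambda>\<omega>. (norm (avg_model (\<epsilon> k \<omega>)))\<^sup>2) \<le> \<sigma>\<^sup>2 / real CARD('m)"
proof -
  have sq: "square_integrable (\<lambda>\<omega>. \<epsilon> k \<omega> $ i)" for i
    by (intro square_integrable_linear[OF eps_square_integrable] bounded_linear.linear bounded_linear_vec_nth)
  have cross: "expectation (\<lambda>\<omega>. \<epsilon> k \<omega> $ i \<bullet> \<epsilon> k \<omega> $ j) = 0" if "i \<noteq> j" for i j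
  proof -
    have "expectation (\<lambda>\<omega>. \<epsilon> k \<omega> $ i \<bullet> \<epsilon> k \<omega> $ j)
        = expectation (\<lambda>\<omega>. \<epsilon> k \<omega> $ i) \<bullet> expectation (\<lambda>\<omega>. \<epsilon> k \<omega> $ j)"
      using noise that
      by (intro expectation_inner_indep square_integrable_imp_integrable sq) (simp add: gradient_errors_def)
    then show ?thesis using noise by (simp add: gradient_errors_def)
  qed
  have "(norm (avg_model (\<epsilon> k \<omega>)))\<^sup>2
      = (\<Sum>i\<in>UNIV. \<Sum>j\<in>UNIV. \<epsilon> k \<omega> $ i \<bullet> \<epsilon> k \<omega> $ j) / (real CARD('m))\<^sup>2" for \<omega>
  proof -
    have "(\<Sum>i\<in>UNIV. \<epsilon> k \<omega> $ i) \<bullet> (\<Sum>j\<in>UNIV. \<epsilon> k \<omega> $ j)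
        = (\<Sum>i\<in>UNIV. \<Sum>j\<in>UNIV. \<epsilon> k \<omega> $ i \<bullet> \<epsilon> k \<omega> $ j)"
      unfolding inner_sum_left unfolding inner_sum_right ..
    then show ?thesis
      unfolding power2_norm_eq_inner avg_model_def by (simp add: power2_eq_square)
  qed
  then have "expectation (\<lambda>\<omega>. (norm (avg_model (\<epsilon> k \<omega>)))\<^sup>2)
      = (\<Sum>i\<in>UNIV. \<Sum>j\<in>UNIV. expectation (\<lambda>\<omega>. \<epsilon> k \<omega> $ i \<bullet> \<epsilon> k \<omega> $ j)) / (real CARD('m))\<^sup>2"
    by (simp add: Bochner_Integration.integral_sum Bochner_Integration.integrable_sum
        integrable_inner_square sq)
  also have "(\<Sum>i\<in>UNIV. \<Sum>j\<in>UNIV. expectation (\<lambda>\<omega>. \<epsilon> k \<omega> $ i \<bullet> \<epsilon> k \<omega> $ j))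
      = (\<Sum>i\<in>UNIV. expectation (\<lambda>\<omega>. (norm (\<epsilon> k \<omega> $ i))\<^sup>2))"
  proof (intro sum.cong refl)
    fix i :: 'm
    have "(\<Sum>j\<in>UNIV. expectation (\<lambda>\<omega>. \<epsilon> k \<omega> $ i \<bullet> \<epsilon> k \<omega> $ j))
        = (\<Sum>j\<in>UNIV. if j = i then expectation (\<lambda>\<omega>. \<epsilon> k \<omega> $ i \<bullet> \<epsilon> k \<omega> $ i) else 0)"
      by (intro sum.cong refl) (simp add: cross)
    then show "(\<Sum>j\<in>UNIV. expectation (\<lambda>\<omega>. \<epsilon> k \<omega> $ i \<bullet> \<epsilon> k \<omega> $ j))
        = expectation (\<lambda>\<omega>. (norm (\<epsilon> k \<omega> $ i))\<^sup>2)"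
      by (simp add: power2_norm_eq_inner)
  qed
  also have "\<dots> \<le> (\<Sum>i\<in>(UNIV::'m set). \<sigma>\<^sup>2)"
    using noise by (intro sum_mono) (simp add: gradient_errors_def)
  finally show ?thesis by (simp add: divide_right_mono power2_eq_square field_simps)
qed

section \<open>Recursion for the expected errors\<close>

definition opt_err :: "nat \<Rightarrow> real" where
  "opt_err k = expectation (\<lambda>\<omega>. (norm (avg_model (W k \<omega>) - wopt))\<^sup>2)"

definition cons_err :: "nat \<Rightarrow> real" where
  "cons_err k = expectation (\<lambda>\<omega>. (norm (disagreement (W k \<omega>)))\<^sup>2)"

lemma opt_err_nonneg: "0 \<le> opt_err k" and cons_err_nonneg: "0 \<le> cons_err k"
  by (simp_all add: opt_err_def cons_err_def)

lemma square_integrable_opt: "square_integrable (\<lambda>\<omega>. avg_model (W k \<omega>) - wopt)"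
  using square_integrable_add[OF square_integrable_linear[OF W_square_integrable linear_avg_model],
      of "\<lambda>_. - wopt" k]
  by (simp add: square_integrable_def)

lemma square_integrable_disagreement: "square_integrable (\<lambda>\<omega>. disagreement (W k \<omega>))"
  by (intro square_integrable_linear[OF W_square_integrable linear_disagreement])

lemma measurable_linear:
  "linear (h :: 'b::euclidean_space \<Rightarrow> 'c::euclidean_space) \<Longrightarrow> h \<in> borel_measurable borel"
  by (intro borel_measurable_continuous_onI linear_continuous_on)
    (simp add: linear_conv_bounded_linear)

text \<open>The next average error is \<open>h (W k \<omega>)\<close> minus scaled averaged noise.
  The cross term has mean zero, \<open>average_step\<close> bounds the first part pointwise, and the
  noise contributes its variance.\<close>

lemma opt_err_Suc:
  "opt_err (Suc k) \<le> (1 - \<mu> * \<alpha> k) * opt_err k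
     + (1 + \<mu> * \<alpha> k) * \<alpha> k * L\<^sup>2 / (\<mu> * real CARD('m)) * cons_err k
     + (\<alpha> k)\<^sup>2 * \<sigma>\<^sup>2 / real CARD('m)"
proof -
  define h where "h X = avg_model X - \<alpha> k *\<^sub>R avg_model (G X) - wopt" for X
  note [measurable] = measurable_linear[OF linear_avg_model, where 'a1='n and 'b1='m]
    measurable_linear[OF linear_replicate_rows, where 'a1='n and 'b1='m]
  \<comment> \<open>Noise is paired with matrix-valued functions of the state, so the vector
    \<open>h X\<close> is replicated to all rows.\<close>
  have meas: "(\<lambda>X. replicate_rows (h X) :: real^'n^'m) \<in> borel_measurable borel"
    unfolding h_def by measurable
  have "square_integrable (\<lambda>\<omega>. (avg_model (W k \<omega>) - wopt) + (- \<alpha> k) *\<^sub>R avg_model (G (W k \<omega>)))"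
    by (intro square_integrable_add square_integrable_opt square_integrable_linear[OF _ linear_scaleR]
        square_integrable_linear[OF G_square_integrable linear_avg_model])
  then have h: "square_integrable (\<lambda>\<omega>. h (W k \<omega>))" by (simp add: h_def algebra_simps)
  have e: "square_integrable (\<lambda>\<omega>. avg_model (\<epsilon> k \<omega>))"
    by (intro square_integrable_linear[OF eps_square_integrable linear_avg_model])
  have rr: "square_integrable (\<lambda>\<omega>. replicate_rows (h (W k \<omega>)) :: real^'n^'m)"
    by (rule square_integrable_linear[OF h linear_replicate_rows])
  have cross: "expectation (\<lambda>\<omega>. h (W k \<omega>) \<bullet> avg_model (\<epsilon> k \<omega>)) = 0"
  proof -
    have "h (W k \<omega>) \<bullet> avg_model (\<epsilon> k \<omega>)
        = (replicate_rows (h (W k \<omega>)) \<bullet> \<epsilon> k \<omega>) / real CARD('m)" for \<omega>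
      by (simp add: inner_commute[of "replicate_rows _"] inner_replicate_rows)
        (simp add: inner_commute)
    then show ?thesis
      using expectation_inner_eps[OF order_refl meas rr] by simp
  qed
  have sq: "(norm (avg_model (W (Suc k) \<omega>) - wopt))\<^sup>2 = (norm (h (W k \<omega>)))\<^sup>2
      - 2 * \<alpha> k * (h (W k \<omega>) \<bullet> avg_model (\<epsilon> k \<omega>)) + (\<alpha> k)\<^sup>2 * (norm (avg_model (\<epsilon> k \<omega>)))\<^sup>2"
    if "\<omega> \<in> space M" for \<omega>
  proof -
    have "avg_model (W (Suc k) \<omega>) - wopt = h (W k \<omega>) - \<alpha> k *\<^sub>R avg_model (\<epsilon> k \<omega>)"
      using that
      by (simp add: h_def iterate noisy_grads_eq[of _ "\<epsilon> k _"] linear_diff[OF linear_avg_model]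
          linear_add[OF linear_avg_model] linear_scale[OF linear_avg_model]
          avg_model_stochastic_mult[OF P] algebra_simps)
    then show ?thesis by (simp only: power2_norm_diff_scaleR)
  qed
  have "opt_err (Suc k) = expectation (\<lambda>\<omega>. (norm (h (W k \<omega>)))\<^sup>2
      - 2 * \<alpha> k * (h (W k \<omega>) \<bullet> avg_model (\<epsilon> k \<omega>)) + (\<alpha> k)\<^sup>2 * (norm (avg_model (\<epsilon> k \<omega>)))\<^sup>2)"
    unfolding opt_err_def using sq by (intro Bochner_Integration.integral_cong) auto
  also have "\<dots> = expectation (\<lambda>\<omega>. (norm (h (W k \<omega>)))\<^sup>2)
      + (\<alpha> k)\<^sup>2 * expectation (\<lambda>\<omega>. (norm (avg_model (\<epsilon> k \<omega>)))\<^sup>2)"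
    using h e by (simp add: integrable_inner_square cross)
  also have "\<dots> \<le> ((1 - \<mu> * \<alpha> k) * opt_err k
      + (1 + \<mu> * \<alpha> k) * \<alpha> k * L\<^sup>2 / (\<mu> * real CARD('m)) * cons_err k)
      + (\<alpha> k)\<^sup>2 * (\<sigma>\<^sup>2 / real CARD('m))"
  proof (intro add_mono mult_left_mono expectation_norm_avg_eps_le zero_le_power2)
    have "expectation (\<lambda>\<omega>. (norm (h (W k \<omega>)))\<^sup>2)
        \<le> expectation (\<lambda>\<omega>. (1 - \<mu> * \<alpha> k) * (norm (avg_model (W k \<omega>) - wopt))\<^sup>2
          + (1 + \<mu> * \<alpha> k) * \<alpha> k * L\<^sup>2 / (\<mu> * real CARD('m)) * (norm (disagreement (W k \<omega>)))\<^sup>2)"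
      unfolding h_def using h square_integrable_opt[of k] square_integrable_disagreement[of k]
      by (intro integral_mono average_step alpha_pos alpha_small) (simp_all add: h_def)
    also have "\<dots> = (1 - \<mu> * \<alpha> k) * opt_err k
        + (1 + \<mu> * \<alpha> k) * \<alpha> k * L\<^sup>2 / (\<mu> * real CARD('m)) * cons_err k"
      unfolding opt_err_def cons_err_def
      using square_integrable_opt[of k] square_integrable_disagreement[of k] by simp
    finally show "expectation (\<lambda>\<omega>. (norm (h (W k \<omega>)))\<^sup>2)
        \<le> (1 - \<mu> * \<alpha> k) * opt_err k
          + (1 + \<mu> * \<alpha> k) * \<alpha> k * L\<^sup>2 / (\<mu> * real CARD('m)) * cons_err k" .
  qed
  finally show ?thesis by simp
qed

lemma disagreement_W_Suc:
  assumes "\<omega> \<in> space M"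
  shows "disagreement (W (Suc k) \<omega>) = P k ** disagreement (W k \<omega>)
    + (- \<alpha> k) *\<^sub>R (disagreement (G (W k \<omega>)) + disagreement (\<epsilon> k \<omega>))"
  using assms
  by (simp add: iterate noisy_grads_eq[of _ "\<epsilon> k _"] linear_diff[OF linear_disagreement]
      linear_add[OF linear_disagreement] linear_scale[OF linear_disagreement]
      disagreement_stochastic_mult[OF P])

text \<open>The noise enters through its projection. Being self-adjoint, the projection can be moved
  to the state, so the cross term vanishes in mean; being nonexpansive, it leaves the noise at
  \<open>m\<close> times \<sigma> squared.\<close>

lemma cons_err_Suc:
  defines "s k \<equiv> 2 * sqrt 2 * \<alpha> k * L"
  shows "cons_err (Suc k) \<le> (1 + s k)\<^sup>2 * cons_err k
     + real CARD('m) * (\<alpha> k)\<^sup>2 * (2 * (1 + s k) / s k * \<delta>\<^sup>2 + \<sigma>\<^sup>2)"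
proof -
  define h where "h X = P k ** disagreement X - \<alpha> k *\<^sub>R disagreement (G X)" for X
  note [measurable] = measurable_linear[OF linear_disagreement, where 'a1='n and 'b1='m]
    measurable_matrix_mult[of "P k"]
  have meas: "(\<lambda>X. disagreement (h X)) \<in> borel_measurable borel"
    unfolding h_def by measurable
  have "square_integrable (\<lambda>\<omega>. P k ** disagreement (W k \<omega>) + (- \<alpha> k) *\<^sub>R disagreement (G (W k \<omega>)))"
    by (intro square_integrable_add square_integrable_linear[OF _ linear_matrix_mult]
        square_integrable_disagreement square_integrable_linear[OF _ linear_scaleR]
        square_integrable_linear[OF G_square_integrable linear_disagreement])
  then have h: "square_integrable (\<lambda>\<omega>. h (W k \<omega>))" by (simp add: h_def)
  have e: "square_integrable (\<lambda>\<omega>. disagreement (\<epsilon> k \<omega>))"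
    by (intro square_integrable_linear[OF eps_square_integrable linear_disagreement])
  have cross: "expectation (\<lambda>\<omega>. h (W k \<omega>) \<bullet> disagreement (\<epsilon> k \<omega>)) = 0"
    unfolding inner_disagreement
    by (rule expectation_inner_eps[OF order_refl meas square_integrable_linear[OF h linear_disagreement]])
  have sq: "(norm (disagreement (W (Suc k) \<omega>)))\<^sup>2 = (norm (h (W k \<omega>)))\<^sup>2
      - 2 * \<alpha> k * (h (W k \<omega>) \<bullet> disagreement (\<epsilon> k \<omega>)) + (\<alpha> k)\<^sup>2 * (norm (disagreement (\<epsilon> k \<omega>)))\<^sup>2"
    if "\<omega> \<in> space M" for \<omega>
  proof -
    have "disagreement (W (Suc k) \<omega>) = h (W k \<omega>) - \<alpha> k *\<^sub>R disagreement (\<epsilon> k \<omega>)"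
      using that by (simp add: h_def disagreement_W_Suc algebra_simps)
    then show ?thesis by (simp only: power2_norm_diff_scaleR)
  qed
  have noise_le: "expectation (\<lambda>\<omega>. (norm (disagreement (\<epsilon> k \<omega>)))\<^sup>2) \<le> real CARD('m) * \<sigma>\<^sup>2"
  proof (rule order_trans[OF integral_mono expectation_norm_eps_le])
    show "(norm (disagreement (\<epsilon> k \<omega>)))\<^sup>2 \<le> (norm (\<epsilon> k \<omega>))\<^sup>2" for \<omega>
      by (intro power_mono norm_disagreement_le norm_ge_zero)
  qed (use e eps_square_integrable[of k] in simp_all)
  have "cons_err (Suc k) = expectation (\<lambda>\<omega>. (norm (h (W k \<omega>)))\<^sup>2
      - 2 * \<alpha> k * (h (W k \<omega>) \<bullet> disagreement (\<epsilon> k \<omega>)) + (\<alpha> k)\<^sup>2 * (norm (disagreement (\<epsilon> k \<omega>)))\<^sup>2)"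
    unfolding cons_err_def using sq by (intro Bochner_Integration.integral_cong) auto
  also have "\<dots> = expectation (\<lambda>\<omega>. (norm (h (W k \<omega>)))\<^sup>2)
      + (\<alpha> k)\<^sup>2 * expectation (\<lambda>\<omega>. (norm (disagreement (\<epsilon> k \<omega>)))\<^sup>2)"
    using h e by (simp add: integrable_inner_square cross)
  also have "\<dots> \<le> ((1 + s k)\<^sup>2 * cons_err k + real CARD('m) * (\<alpha> k)\<^sup>2 * (2 * (1 + s k) / s k * \<delta>\<^sup>2))
      + (\<alpha> k)\<^sup>2 * (real CARD('m) * \<sigma>\<^sup>2)"
  proof (intro add_mono mult_left_mono noise_le zero_le_power2)
    have "expectation (\<lambda>\<omega>. (norm (h (W k \<omega>)))\<^sup>2)
        \<le> expectation (\<lambda>\<omega>. (1 + s k)\<^sup>2 * (norm (disagreement (W k \<omega>)))\<^sup>2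
          + real CARD('m) * (\<alpha> k)\<^sup>2 * (2 * (1 + s k) / s k * \<delta>\<^sup>2))"
      unfolding h_def s_def using h square_integrable_disagreement[of k]
      by (intro integral_mono disagreement_step P alpha_pos) (simp_all add: h_def)
    also have "\<dots> = (1 + s k)\<^sup>2 * cons_err k + real CARD('m) * (\<alpha> k)\<^sup>2 * (2 * (1 + s k) / s k * \<delta>\<^sup>2)"
      unfolding cons_err_def
      using square_integrable_disagreement[of k] by (simp add: prob_space)
    finally show "expectation (\<lambda>\<omega>. (norm (h (W k \<omega>)))\<^sup>2)
        \<le> (1 + s k)\<^sup>2 * cons_err k + real CARD('m) * (\<alpha> k)\<^sup>2 * (2 * (1 + s k) / s k * \<delta>\<^sup>2)" .
  qed
  finally show ?thesis by (simp add: algebra_simps)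
qed

end

subsection \<open>Contraction over a block\<close>

text \<open>The product \<open>x \<bullet> z\<close> is kept because it will have mean zero. Only
  \<open>y \<bullet> z\<close> is estimated, which adds one to the coefficients of \<open>y\<close>
  and \<open>z\<close>.\<close>

lemma norm_diff_diff_le:
  fixes x y z :: "'a::real_inner"
  assumes "0 < c"
  shows "(norm (x - y - z))\<^sup>2
    \<le> (1 + c) * (norm x)\<^sup>2 + (2 + 1 / c) * (norm y)\<^sup>2 + 2 * (norm z)\<^sup>2 - 2 * (x \<bullet> z)"
proof -
  have "(norm (x - y - z))\<^sup>2 = (norm (x + - y))\<^sup>2 + (norm z)\<^sup>2 - 2 * (x \<bullet> z) + 2 * (y \<bullet> z)"
    unfolding power2_norm_eq_inner
    by (simp add: inner_diff_left inner_diff_right inner_commute algebra_simps)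
  moreover have "(norm (x + - y))\<^sup>2 \<le> (1 + c) * (norm x)\<^sup>2 + (1 + 1 / c) * (norm y)\<^sup>2"
    using power2_norm_add_le[OF assms, of x "- y"] by simp
  moreover have "2 * (y \<bullet> z) \<le> (norm y)\<^sup>2 + (norm z)\<^sup>2"
    using norm_cauchy_schwarz[of y z] sum_squares_bound[of "norm y" "norm z"] by linarith
  ultimately show ?thesis by (simp add: algebra_simps)
qed

context decentralized_sgd
begin

lemma disagreement_W_add:
  assumes "\<omega> \<in> space M"
  shows "disagreement (W (s + n) \<omega>) = mat_prod P (s + n) s ** disagreement (W s \<omega>)
    - (\<Sum>r<n. \<alpha> (s + r) *\<^sub>R (mat_prod P (s + n) (Suc (s + r)) ** disagreement (G (W (s + r) \<omega>))))
    - (\<Sum>r<n. \<alpha> (s + r) *\<^sub>R (mat_prod P (s + n) (Suc (s + r)) ** disagreement (\<epsilon> (s + r) \<omega>)))"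
proof -
  have "disagreement (W (s + n) \<omega>) = mat_prod P (s + n) s ** disagreement (W s \<omega>)
      + (\<Sum>r<n. mat_prod P (s + n) (Suc (s + r)) **
          ((- \<alpha> (s + r)) *\<^sub>R (disagreement (G (W (s + r) \<omega>)) + disagreement (\<epsilon> (s + r) \<omega>))))"
    by (rule linear_recursion_unroll[where X="\<lambda>t. disagreement (W t \<omega>)"])
      (rule disagreement_W_Suc[OF assms])
  then show ?thesis
    by (simp only: linear_scale[OF linear_matrix_mult] linear_add[OF linear_matrix_mult])
      (simp add: scaleR_add_right sum.distrib sum_negf sum_subtractf algebra_simps)
qed

text \<open>The noise of the block is correlated with the later gradients, but not with the models at the
  start of the block. Splitting the former correlation by Young's inequality turns the gradient
  coefficient \<open>1 + 1/c\<close> into \<open>2 + 1/c\<close>, which is \<open>2 / (1 - \<rho>\<^sup>2)\<close> for the \<open>c\<close> with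
  \<open>(1 + c) \<rho>\<^sup>2 = (1 + \<rho>\<^sup>2) / 2\<close>.\<close>

lemma cons_err_block:
  assumes \<rho>: "0 < \<rho>" "\<rho> < 1" "contraction_factor P B \<le> \<rho>"
  shows "cons_err (s + B) \<le> (1 + \<rho>\<^sup>2) / 2 * cons_err s
    + 2 * real B * (\<Sum>r<B. (\<alpha> (s + r))\<^sup>2 * (2 / (1 - \<rho>\<^sup>2) *
        (real CARD('m) * \<delta>\<^sup>2 + L\<^sup>2 * cons_err (s + r)) + real CARD('m) * \<sigma>\<^sup>2))"
proof -
  define Q where "Q r = mat_prod P (s + B) (Suc (s + r))" for r
  define V where "V \<omega> = mat_prod P (s + B) s ** disagreement (W s \<omega>)" for \<omega>
  define N where "N \<omega> = (\<Sum>r<B. \<alpha> (s + r) *\<^sub>R (Q r ** disagreement (G (W (s + r) \<omega>))))" for \<omega>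
  define S where "S \<omega> = (\<Sum>r<B. \<alpha> (s + r) *\<^sub>R (Q r ** disagreement (\<epsilon> (s + r) \<omega>)))" for \<omega>
  define c where "c = (1 - \<rho>\<^sup>2) / (2 * \<rho>\<^sup>2)"
  have \<rho>2: "0 < 1 - \<rho>\<^sup>2" using \<rho> by (simp add: power_less_one_iff)
  then have c: "0 < c" using \<rho> by (simp add: c_def)
  have c1: "(1 + c) * \<rho>\<^sup>2 = (1 + \<rho>\<^sup>2) / 2" using \<rho> by (simp add: c_def field_simps)
  have c2: "2 + 1 / c = 2 / (1 - \<rho>\<^sup>2)" using \<rho> \<rho>2 by (simp add: c_def field_simps)
  have Q: "doubly_stochastic (Q r)" for r
    unfolding Q_def by (rule doubly_stochastic_mat_prod[OF P])
  have dW: "square_integrable (\<lambda>\<omega>. disagreement (W t \<omega>))" for t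
    by (rule square_integrable_disagreement)
  have V: "square_integrable V"
    unfolding V_def by (rule square_integrable_linear[OF dW linear_matrix_mult])
  have Qe: "square_integrable (\<lambda>\<omega>. Q r ** disagreement (\<epsilon> (s + r) \<omega>))" for r
    by (intro square_integrable_linear[OF _ linear_matrix_mult]
        square_integrable_linear[OF eps_square_integrable linear_disagreement])
  have S: "square_integrable S"
    unfolding S_def by (intro square_integrable_sum square_integrable_linear[OF Qe linear_scaleR])
  have cross: "expectation (\<lambda>\<omega>. V \<omega> \<bullet> S \<omega>) = 0"
  proof -
    \<comment> \<open>Everything that acts on the noise in \<open>S\<close> is moved to the other
      side of the inner product, which leaves a linear function of \<open>W s\<close>.\<close>
    define h where "h r X = disagreement (transpose (Q r) ** (mat_prod P (s + B) s ** disagreement X))"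
      for r and X :: "real^'n^'m"
    have lin: "linear (h r)" for r
      unfolding h_def
      using linear_compose[OF linear_compose[OF linear_compose[OF linear_disagreement
        linear_matrix_mult[of "mat_prod P (s + B) s"]] linear_matrix_mult[of "transpose (Q r)"]] linear_disagreement]
      by (simp add: o_def)
    have "V \<omega> \<bullet> (Q r ** disagreement (\<epsilon> (s + r) \<omega>)) = h r (W s \<omega>) \<bullet> \<epsilon> (s + r) \<omega>" for r \<omega>
      by (simp only: inner_matrix_mult inner_disagreement V_def h_def)
    moreover have "expectation (\<lambda>\<omega>. h r (W s \<omega>) \<bullet> \<epsilon> (s + r) \<omega>) = 0" for r
      by (rule expectation_inner_eps[OF le_add1 measurable_linear[OF lin]
            square_integrable_linear[OF W_square_integrable lin]])
    ultimately have "expectation (\<lambda>\<omega>. V \<omega> \<bullet> (Q r ** disagreement (\<epsilon> (s + r) \<omega>))) = 0" for r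
      by simp
    then show ?thesis
      unfolding S_def inner_sum_right inner_scaleR_right
      by (subst Bochner_Integration.integral_sum)
        (auto intro!: integrable_mult_right integrable_inner_square V Qe)
  qed
  \<comment> \<open>The pointwise bound retains the cross term, which has no sign and disappears
    only in expectation.\<close>
  define bound where "bound \<omega> = (1 + \<rho>\<^sup>2) / 2 * (norm (disagreement (W s \<omega>)))\<^sup>2
      + 2 / (1 - \<rho>\<^sup>2) * (real B * (\<Sum>r<B. (\<alpha> (s + r))\<^sup>2 *
          (2 * L\<^sup>2 * (norm (disagreement (W (s + r) \<omega>)))\<^sup>2 + 2 * real CARD('m) * \<delta>\<^sup>2)))
      + 2 * (real B * (\<Sum>r<B. (\<alpha> (s + r))\<^sup>2 * (norm (\<epsilon> (s + r) \<omega>))\<^sup>2)) - 2 * (V \<omega> \<bullet> S \<omega>)" for \<omega>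
  \<comment> \<open>The factor \<open>B\<close> is the price of Cauchy-Schwarz for a sum of
    \<open>B\<close> terms; the products \<open>Q r\<close> cost nothing.\<close>
  have weighted_le: "(norm (\<Sum>r<B. \<alpha> (s + r) *\<^sub>R (Q r ** disagreement (Y r))))\<^sup>2
      \<le> real B * (\<Sum>r<B. (\<alpha> (s + r))\<^sup>2 * (norm (disagreement (Y r)))\<^sup>2)" for Y :: "nat \<Rightarrow> real^'n^'m"
  proof -
    have "(norm (\<Sum>r<B. \<alpha> (s + r) *\<^sub>R (Q r ** disagreement (Y r))))\<^sup>2
        \<le> real B * (\<Sum>r<B. (norm (\<alpha> (s + r) *\<^sub>R (Q r ** disagreement (Y r))))\<^sup>2)"
      using power2_norm_sum_le[of "\<lambda>r. \<alpha> (s + r) *\<^sub>R (Q r ** disagreement (Y r))" "{..<B}"] by simp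
    also have "\<dots> \<le> real B * (\<Sum>r<B. (\<alpha> (s + r))\<^sup>2 * (norm (disagreement (Y r)))\<^sup>2)"
    proof (intro mult_left_mono sum_mono)
      fix r
      have "(norm (Q r ** disagreement (Y r)))\<^sup>2 \<le> (norm (disagreement (Y r)))\<^sup>2"
        by (intro power_mono norm_stochastic_mult_le Q norm_ge_zero)
      then show "(norm (\<alpha> (s + r) *\<^sub>R (Q r ** disagreement (Y r))))\<^sup>2
          \<le> (\<alpha> (s + r))\<^sup>2 * (norm (disagreement (Y r)))\<^sup>2"
        by (simp add: power_mult_distrib mult_left_mono)
    qed simp
    finally show ?thesis .
  qed
  have "(norm (disagreement (W (s + B) \<omega>)))\<^sup>2 \<le> bound \<omega>" if "\<omega> \<in> space M" for \<omega>
  proof -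
    have "norm (V \<omega>) \<le> contraction_factor P B * norm (disagreement (W s \<omega>))"
      unfolding V_def by (rule norm_mat_prod_disagreement_le[OF P])
    also have "\<dots> \<le> \<rho> * norm (disagreement (W s \<omega>))" using \<rho>(3) by (rule mult_right_mono) simp
    finally have "(norm (V \<omega>))\<^sup>2 \<le> \<rho>\<^sup>2 * (norm (disagreement (W s \<omega>)))\<^sup>2"
      by (rule power2_norm_le_mult)
    then have V_le: "(1 + c) * (norm (V \<omega>))\<^sup>2 \<le> (1 + \<rho>\<^sup>2) / 2 * (norm (disagreement (W s \<omega>)))\<^sup>2"
      using mult_left_mono[of _ _ "1 + c"] c by (simp add: c1[symmetric] mult.assoc)
    have "(norm (N \<omega>))\<^sup>2 \<le> real B * (\<Sum>r<B. (\<alpha> (s + r))\<^sup>2 * (norm (disagreement (G (W (s + r) \<omega>))))\<^sup>2)"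
      unfolding N_def by (rule weighted_le)
    also have "\<dots> \<le> real B * (\<Sum>r<B. (\<alpha> (s + r))\<^sup>2 *
          (2 * L\<^sup>2 * (norm (disagreement (W (s + r) \<omega>)))\<^sup>2 + 2 * real CARD('m) * \<delta>\<^sup>2))"
      by (intro mult_left_mono sum_mono disagreement_G_le) auto
    finally have N_le: "2 / (1 - \<rho>\<^sup>2) * (norm (N \<omega>))\<^sup>2 \<le> 2 / (1 - \<rho>\<^sup>2) * \<dots>"
      using \<rho>2 by (intro mult_left_mono) auto
    have "(norm (S \<omega>))\<^sup>2 \<le> real B * (\<Sum>r<B. (\<alpha> (s + r))\<^sup>2 * (norm (disagreement (\<epsilon> (s + r) \<omega>)))\<^sup>2)"
      unfolding S_def by (rule weighted_le)
    also have "\<dots> \<le> real B * (\<Sum>r<B. (\<alpha> (s + r))\<^sup>2 * (norm (\<epsilon> (s + r) \<omega>))\<^sup>2)"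
      by (intro mult_left_mono sum_mono power_mono norm_disagreement_le) auto
    finally have S_le: "(norm (S \<omega>))\<^sup>2 \<le> \<dots>" .
    have "disagreement (W (s + B) \<omega>) = V \<omega> - N \<omega> - S \<omega>"
      using disagreement_W_add[OF that, of s B] by (simp only: V_def N_def S_def Q_def)
    then have "(norm (disagreement (W (s + B) \<omega>)))\<^sup>2 \<le> (1 + c) * (norm (V \<omega>))\<^sup>2
        + 2 / (1 - \<rho>\<^sup>2) * (norm (N \<omega>))\<^sup>2 + 2 * (norm (S \<omega>))\<^sup>2 - 2 * (V \<omega> \<bullet> S \<omega>)"
      using norm_diff_diff_le[OF c, of "V \<omega>" "N \<omega>" "S \<omega>"] by (simp only: c2)
    with V_le N_le S_le show ?thesis unfolding bound_def by linarith
  qed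
  moreover have int: "integrable M bound"
    unfolding bound_def
    using dW eps_square_integrable integrable_inner_square[OF V S] by simp
  ultimately have "cons_err (s + B) \<le> expectation bound"
    unfolding cons_err_def using dW[of "s + B"] by (intro integral_mono) auto
  also have "expectation bound = (1 + \<rho>\<^sup>2) / 2 * cons_err s
      + 2 / (1 - \<rho>\<^sup>2) * (real B * (\<Sum>r<B. (\<alpha> (s + r))\<^sup>2 *
          (2 * L\<^sup>2 * cons_err (s + r) + 2 * real CARD('m) * \<delta>\<^sup>2)))
      + 2 * (real B * (\<Sum>r<B. (\<alpha> (s + r))\<^sup>2 * expectation (\<lambda>\<omega>. (norm (\<epsilon> (s + r) \<omega>))\<^sup>2)))"
    unfolding bound_def cons_err_def
    using dW eps_square_integrable integrable_inner_square[OF V S]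
    by (simp add: Bochner_Integration.integral_sum cross prob_space)
  also have "\<dots> \<le> (1 + \<rho>\<^sup>2) / 2 * cons_err s
      + 2 / (1 - \<rho>\<^sup>2) * (real B * (\<Sum>r<B. (\<alpha> (s + r))\<^sup>2 *
          (2 * L\<^sup>2 * cons_err (s + r) + 2 * real CARD('m) * \<delta>\<^sup>2)))
      + 2 * (real B * (\<Sum>r<B. (\<alpha> (s + r))\<^sup>2 * (real CARD('m) * \<sigma>\<^sup>2)))"
    by (intro add_left_mono mult_left_mono sum_mono expectation_norm_eps_le) auto
  also have "\<dots> = (1 + \<rho>\<^sup>2) / 2 * cons_err s
    + 2 * real B * (\<Sum>r<B. (\<alpha> (s + r))\<^sup>2 * (2 / (1 - \<rho>\<^sup>2) *
        (real CARD('m) * \<delta>\<^sup>2 + L\<^sup>2 * cons_err (s + r)) + real CARD('m) * \<sigma>\<^sup>2))"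
    by (simp add: distrib_left sum.distrib sum_distrib_left mult_ac)
  finally show ?thesis .
qed

end

subsection \<open>Coefficients\<close>

locale step_size_coefficients =
  fixes m L \<mu> \<delta> \<sigma> \<rho> :: real and \<alpha> :: "nat \<Rightarrow> real" and B :: nat
  assumes m_pos: "0 < m" and mu_pos: "0 < \<mu>" and mu_le_L: "\<mu> \<le> L" and delta_pos: "0 < \<delta>"
    and rho: "0 < \<rho>" "\<rho> < 1" and B_ge_2: "2 \<le> B"
    and alpha_pos: "0 < \<alpha> k" and alpha_Suc: "\<alpha> (Suc k) \<le> \<alpha> k"
    and alpha_0: "\<alpha> 0 \<le> (1 - \<rho>\<^sup>2) / (8 * real B * L * (1 + Gamma1 \<rho> B) ^ (B - 1))"
begin

abbreviation "A \<equiv> coeff_A m \<mu> L \<alpha>"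
abbreviation "C \<equiv> coeff_C m L \<delta> \<sigma> \<alpha>"
abbreviation "g \<equiv> 1 + Gamma1 \<rho> B"
abbreviation "s k \<equiv> 2 * sqrt 2 * \<alpha> k * L"

lemma L_pos: "0 < L" using mu_pos mu_le_L by linarith

lemma alpha_mono: "j \<le> k \<Longrightarrow> \<alpha> k \<le> \<alpha> j"
  by (rule lift_Suc_antimono_le) (rule alpha_Suc)

lemma gap: "0 < 1 - \<rho>\<^sup>2" "1 - \<rho>\<^sup>2 < 1"
  using rho by (simp_all add: power_less_one_iff)

lemma Gamma1_pos: "0 < Gamma1 \<rho> B"
  using gap B_ge_2 by (simp add: Gamma1_def)

lemma g_ge_1: "1 \<le> g" using Gamma1_pos by simp

text \<open>The power of \<open>g\<close> in the step size bound compensates the growth of the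
  disagreement by \<open>g\<^sup>2\<close> per step over up to \<open>B - 1\<close> steps, after
  taking square roots.\<close>

lemma alpha_g_le: "\<alpha> k * L * g ^ (B - 1) \<le> (1 - \<rho>\<^sup>2) / (8 * real B)"
proof -
  have "\<alpha> k * (L * g ^ (B - 1)) \<le> \<alpha> 0 * (L * g ^ (B - 1))"
    using alpha_mono[of 0 k] L_pos Gamma1_pos by (intro mult_right_mono) auto
  also have "\<dots> \<le> (1 - \<rho>\<^sup>2) / (8 * real B * L * g ^ (B - 1)) * (L * g ^ (B - 1))"
    using alpha_0 L_pos Gamma1_pos by (intro mult_right_mono) auto
  also have "\<dots> = (1 - \<rho>\<^sup>2) / (8 * real B)"
    using L_pos Gamma1_pos by simp
  finally show ?thesis by (simp add: mult.assoc)
qed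

lemma alpha_L_le: "\<alpha> k * L \<le> (1 - \<rho>\<^sup>2) / (8 * real B)"
proof -
  have "\<alpha> k * L * 1 \<le> \<alpha> k * L * g ^ (B - 1)"
    using alpha_pos[of k] L_pos g_ge_1 by (intro mult_left_mono one_le_power) auto
  then show ?thesis using alpha_g_le[of k] by simp
qed

lemma mu_alpha: "0 < \<mu> * \<alpha> k" "\<mu> * \<alpha> k \<le> (1 - \<rho>\<^sup>2) / (8 * real B)" "\<mu> * \<alpha> k \<le> 1 / 16"
proof -
  show "0 < \<mu> * \<alpha> k" using mu_pos alpha_pos by simp
  have "\<mu> * \<alpha> k \<le> \<alpha> k * L" using mu_le_L alpha_pos[of k] by simp
  then show le: "\<mu> * \<alpha> k \<le> (1 - \<rho>\<^sup>2) / (8 * real B)" using alpha_L_le[of k] by linarith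
  also have "\<dots> \<le> 1 / 16" using gap B_ge_2 by (intro frac_le) auto
  finally show "\<mu> * \<alpha> k \<le> 1 / 16" .
qed

lemma s_pos: "0 < s k" using alpha_pos L_pos by simp

text \<open>\<open>Gamma1\<close> is exactly \<open>2 * sqrt 2\<close> times the bound for
  \<open>\<alpha> k * L\<close>, because \<open>2 * sqrt 2 / 8\<close> equals
  \<open>1 / (2 * sqrt 2)\<close>.\<close>

lemma s_le: "s k \<le> Gamma1 \<rho> B"
proof -
  have "s k \<le> 2 * sqrt 2 * ((1 - \<rho>\<^sup>2) / (8 * real B))"
    using mult_left_mono[OF alpha_L_le[of k], of "2 * sqrt 2"] by (simp add: mult.assoc)
  also have "\<dots> = Gamma1 \<rho> B"
  proof -
    have "Gamma1 \<rho> B = (sqrt 2 * (1 - \<rho>\<^sup>2)) / (sqrt 2 * (2 * sqrt 2 * real B))"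
      unfolding Gamma1_def by (rule mult_divide_mult_cancel_left[symmetric]) simp
    also have "sqrt 2 * (2 * sqrt 2 * real B) = 4 * real B" by simp
    finally show ?thesis by simp
  qed
  finally show ?thesis .
qed

lemma coeff_A_entries [simp]:
  "A k $ 1 $ 1 = 1 - \<mu> * \<alpha> k" "A k $ 1 $ 2 = (1 + \<mu> * \<alpha> k) * \<alpha> k * L\<^sup>2 / (\<mu> * m)"
  "A k $ 2 $ 1 = 0" "A k $ 2 $ 2 = (1 + s k)\<^sup>2"
  by (simp_all add: coeff_A_def)

lemma A12_le: "j \<le> k \<Longrightarrow> A k $ 1 $ 2 \<le> 2 * \<alpha> j * L\<^sup>2 / (\<mu> * m)"
  and A12_ge: "\<alpha> k * L\<^sup>2 / (\<mu> * m) \<le> A k $ 1 $ 2"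
  and A12_nonneg: "0 \<le> A k $ 1 $ 2"
proof -
  have "(1 + \<mu> * \<alpha> k) * \<alpha> k \<le> 2 * \<alpha> j" if "j \<le> k"
    using alpha_mono[OF that] mu_alpha[of k] alpha_pos[of k] by (intro mult_mono) auto
  then show "A k $ 1 $ 2 \<le> 2 * \<alpha> j * L\<^sup>2 / (\<mu> * m)" if "j \<le> k"
    using that mu_pos m_pos by (auto intro!: divide_right_mono mult_right_mono)
  have "1 * \<alpha> k \<le> (1 + \<mu> * \<alpha> k) * \<alpha> k"
    using mu_alpha[of k] alpha_pos[of k] by (intro mult_right_mono) auto
  then show "\<alpha> k * L\<^sup>2 / (\<mu> * m) \<le> A k $ 1 $ 2"
    using mu_pos m_pos by (auto intro!: divide_right_mono mult_right_mono)
  moreover have "0 \<le> \<alpha> k * L\<^sup>2 / (\<mu> * m)" using alpha_pos[of k] mu_pos m_pos by simp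
  ultimately show "0 \<le> A k $ 1 $ 2" by linarith
qed

section \<open>Entries of the triangular matrix products\<close>

lemma mat_prod_21 [simp]: "mat_prod A t r $ 2 $ 1 = 0"
  by (induction t) (simp_all add: mat_def matrix_matrix_mult_def sum_2)

lemma mat_prod_Suc_entries:
  assumes "r \<le> t"
  shows "mat_prod A (Suc t) r $ 1 $ 1 = (1 - \<mu> * \<alpha> t) * mat_prod A t r $ 1 $ 1"
    and "mat_prod A (Suc t) r $ 1 $ 2
      = (1 - \<mu> * \<alpha> t) * mat_prod A t r $ 1 $ 2 + A t $ 1 $ 2 * mat_prod A t r $ 2 $ 2"
    and "mat_prod A (Suc t) r $ 2 $ 2 = (1 + s t)\<^sup>2 * mat_prod A t r $ 2 $ 2"
  using assms by (simp_all add: matrix_matrix_mult_def sum_2)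

lemma mat_prod_11: "(1 - \<mu> * \<alpha> 0) ^ n \<le> mat_prod A (r + n) r $ 1 $ 1 \<and> mat_prod A (r + n) r $ 1 $ 1 \<le> 1"
proof (induction n)
  case (Suc n)
  have \<alpha>: "0 \<le> 1 - \<mu> * \<alpha> 0" "1 - \<mu> * \<alpha> 0 \<le> 1 - \<mu> * \<alpha> (r + n)" "1 - \<mu> * \<alpha> (r + n) \<le> 1"
    using mu_alpha[of 0] mu_alpha[of "r + n"] alpha_mono[of 0 "r + n"] mu_pos by auto
  have p: "0 \<le> mat_prod A (r + n) r $ 1 $ 1"
    using Suc zero_le_power[OF \<alpha>(1), of n] by linarith
  have "(1 - \<mu> * \<alpha> 0) * (1 - \<mu> * \<alpha> 0) ^ n \<le> (1 - \<mu> * \<alpha> (r + n)) * mat_prod A (r + n) r $ 1 $ 1"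
    using Suc \<alpha> p by (intro mult_mono) auto
  moreover have "(1 - \<mu> * \<alpha> (r + n)) * mat_prod A (r + n) r $ 1 $ 1 \<le> 1"
    using Suc \<alpha> p by (intro mult_le_one) auto
  ultimately show ?case by (simp add: mat_prod_Suc_entries del: mat_prod.simps)
qed (simp add: mat_def)

lemma mat_prod_11_bounds:
  assumes "r \<le> t"
  shows "0 < mat_prod A t r $ 1 $ 1" "mat_prod A t r $ 1 $ 1 \<le> 1"
proof -
  have "0 < (1 - \<mu> * \<alpha> 0) ^ (t - r)" using mu_alpha[of 0] by simp
  then show "0 < mat_prod A t r $ 1 $ 1" "mat_prod A t r $ 1 $ 1 \<le> 1"
    using mat_prod_11[where n="t - r" and r=r] assms by auto
qed

lemma mat_prod_22: "1 \<le> mat_prod A (r + n) r $ 2 $ 2 \<and> mat_prod A (r + n) r $ 2 $ 2 \<le> g ^ (2 * n)"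
proof (induction n)
  case (Suc n)
  have "1 \<le> (1 + s (r + n))\<^sup>2" using s_pos[of "r + n"] by (intro one_le_power) simp
  moreover have "(1 + s (r + n))\<^sup>2 \<le> g\<^sup>2"
    using s_pos[of "r + n"] s_le[of "r + n"] by (intro power_mono) auto
  ultimately have "1 * 1 \<le> (1 + s (r + n))\<^sup>2 * mat_prod A (r + n) r $ 2 $ 2"
    and "(1 + s (r + n))\<^sup>2 * mat_prod A (r + n) r $ 2 $ 2 \<le> g\<^sup>2 * g ^ (2 * n)"
    using Suc by (intro mult_mono; simp)+
  then show ?case
    by (simp add: mat_prod_Suc_entries power2_eq_square mult.assoc del: mat_prod.simps)
qed (simp add: mat_def)

lemma mat_prod_22_le:
  assumes "r \<le> t" "t \<le> r + n"
  shows "mat_prod A t r $ 2 $ 2 \<le> g ^ (2 * n)"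
proof -
  have "mat_prod A t r $ 2 $ 2 \<le> g ^ (2 * (t - r))" using mat_prod_22[of r "t - r"] assms by simp
  also have "\<dots> \<le> g ^ (2 * n)" using assms g_ge_1 by (intro power_increasing) auto
  finally show ?thesis .
qed

lemma mat_prod_22_ge: "r \<le> t \<Longrightarrow> 1 \<le> mat_prod A t r $ 2 $ 2"
  using mat_prod_22[of r "t - r"] by simp

lemma mat_prod_22_nonneg: "r \<le> t \<Longrightarrow> 0 \<le> mat_prod A t r $ 2 $ 2"
  using mat_prod_22_ge[of r t] by linarith

text \<open>Each of the \<open>n\<close> steps adds at most one coupling coefficient times the
  growth of the disagreement over the preceding steps, at most \<open>n - 1\<close> of them; later
  steps only shrink what was added. For \<open>n = 0\<close> the truncated exponent is harmless,
  because the factor \<open>n\<close> vanishes.\<close>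

lemma mat_prod_12:
  assumes "j \<le> r"
  shows "0 \<le> mat_prod A (r + n) r $ 1 $ 2
    \<and> mat_prod A (r + n) r $ 1 $ 2 \<le> real n * (2 * \<alpha> j * L\<^sup>2 / (\<mu> * m) * g ^ (2 * (n - 1)))"
proof (induction n)
  case (Suc n)
  define c where "c = 2 * \<alpha> j * L\<^sup>2 / (\<mu> * m)"
  have c: "0 \<le> c" using alpha_pos[of j] mu_pos m_pos by (simp add: c_def)
  have \<alpha>: "0 \<le> 1 - \<mu> * \<alpha> (r + n)" "1 - \<mu> * \<alpha> (r + n) \<le> 1" using mu_alpha[of "r + n"] by auto
  have p22: "1 \<le> mat_prod A (r + n) r $ 2 $ 2" "mat_prod A (r + n) r $ 2 $ 2 \<le> g ^ (2 * n)"
    using mat_prod_22[of r n] by auto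
  have "(1 - \<mu> * \<alpha> (r + n)) * mat_prod A (r + n) r $ 1 $ 2 \<le> 1 * (real n * (c * g ^ (2 * (n - 1))))"
    using Suc \<alpha> by (intro mult_mono) (auto simp: c_def)
  also have "\<dots> \<le> 1 * (real n * (c * g ^ (2 * n)))"
    using c g_ge_1 by (intro mult_left_mono power_increasing) auto
  finally have "(1 - \<mu> * \<alpha> (r + n)) * mat_prod A (r + n) r $ 1 $ 2 \<le> real n * (c * g ^ (2 * n))" by simp
  moreover have "A (r + n) $ 1 $ 2 * mat_prod A (r + n) r $ 2 $ 2 \<le> c * g ^ (2 * n)"
    using A12_le[of j "r + n"] assms A12_nonneg p22 c unfolding c_def[symmetric]
    by (intro mult_mono) (auto simp del: coeff_A_entries)
  moreover have "0 \<le> (1 - \<mu> * \<alpha> (r + n)) * mat_prod A (r + n) r $ 1 $ 2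
      + A (r + n) $ 1 $ 2 * mat_prod A (r + n) r $ 2 $ 2"
    using Suc \<alpha> p22 A12_nonneg[of "r + n"] by (intro add_nonneg_nonneg mult_nonneg_nonneg) auto
  ultimately show ?case
    by (simp add: mat_prod_Suc_entries c_def[symmetric] distrib_right del: mat_prod.simps coeff_A_entries)
qed (simp add: mat_def)

lemma mat_prod_12_le:
  assumes "j \<le> r" "r \<le> t" "t \<le> r + n"
  shows "mat_prod A t r $ 1 $ 2 \<le> real n * (2 * \<alpha> j * L\<^sup>2 / (\<mu> * m) * g ^ (2 * (n - 1)))"
proof -
  have "mat_prod A t r $ 1 $ 2 \<le> real (t - r) * (2 * \<alpha> j * L\<^sup>2 / (\<mu> * m) * g ^ (2 * (t - r - 1)))"
    using mat_prod_12[OF assms(1), of "t - r"] assms by simp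
  also have "\<dots> \<le> real n * (2 * \<alpha> j * L\<^sup>2 / (\<mu> * m) * g ^ (2 * (n - 1)))"
    using assms alpha_pos[of j] mu_pos m_pos g_ge_1
    by (intro mult_mono mult_left_mono power_increasing) auto
  finally show ?thesis .
qed

lemma mat_prod_12_nonneg: "r \<le> t \<Longrightarrow> 0 \<le> mat_prod A t r $ 1 $ 2"
  using mat_prod_12[of r r "t - r"] by simp

text \<open>The coupling of the last step alone already gives this much.\<close>

lemma mat_prod_12_ge:
  assumes "r \<le> t"
  shows "\<alpha> t * L\<^sup>2 / (\<mu> * m) \<le> mat_prod A (Suc t) r $ 1 $ 2"
proof -
  have "A t $ 1 $ 2 * 1 \<le> A t $ 1 $ 2 * mat_prod A t r $ 2 $ 2"
    using A12_nonneg mat_prod_22_ge[OF assms] by (intro mult_left_mono)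
  moreover have "0 \<le> (1 - \<mu> * \<alpha> t) * mat_prod A t r $ 1 $ 2"
    using mat_prod_12_nonneg[OF assms] mu_alpha[of t] by simp
  ultimately show ?thesis
    using A12_ge[of t] by (simp add: mat_prod_Suc_entries assms del: mat_prod.simps coeff_A_entries)
qed

section \<open>Size of the block coefficients\<close>

lemma phi11_bounds: "1 - (1 - \<rho>\<^sup>2) / 8 \<le> phi11 A B k" "phi11 A B k \<le> 1"
proof -
  \<comment> \<open>By Bernoulli's inequality a block loses at most \<open>B\<close> times the
    largest value of \<open>\<mu> * \<alpha> k\<close>; this is where 1/8 comes from.\<close>
  have "real B * (\<mu> * \<alpha> 0) \<le> real B * ((1 - \<rho>\<^sup>2) / (8 * real B))"
    by (rule mult_left_mono[OF mu_alpha(2)]) simp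
  also have "\<dots> = (1 - \<rho>\<^sup>2) / 8" using B_ge_2 by simp
  finally have "1 - (1 - \<rho>\<^sup>2) / 8 \<le> 1 + real B * (- (\<mu> * \<alpha> 0))" by simp
  also have "\<dots> \<le> (1 + - (\<mu> * \<alpha> 0)) ^ B"
    by (rule Bernoulli_inequality) (use mu_alpha[of 0] in simp)
  also have "\<dots> \<le> phi11 A B k"
    using mat_prod_11[of B "k * B"] by (simp add: phi11_def add.commute)
  finally show "1 - (1 - \<rho>\<^sup>2) / 8 \<le> phi11 A B k" .
  show "phi11 A B k \<le> 1" using mat_prod_11[of B "k * B"] by (simp add: phi11_def add.commute)
qed

text \<open>By \<open>alpha_g_le\<close> each of the \<open>B\<close> summands is at most the square
  of \<open>(1 - \<rho>\<^sup>2) / (8 * B * L)\<close>. With the prefactor 16 they add at most a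
  quarter of \<open>1 - \<rho>\<^sup>2\<close> to \<open>(1 + \<rho>\<^sup>2) / 2\<close>, that is,
  to one minus half of it.\<close>

lemma phi22_bounds: "0 \<le> phi22 A L \<rho> \<alpha> B k" "phi22 A L \<rho> \<alpha> B k \<le> 1 - (1 - \<rho>\<^sup>2) / 4"
proof -
  define b where "b = ((1 - \<rho>\<^sup>2) / (8 * real B * L))\<^sup>2"
  have "0 \<le> (\<Sum>r = k * B + 1..(k + 1) * B. (\<alpha> (r - 1))\<^sup>2 * mat_prod A (r - 1) (k * B) $ 2 $ 2)"
  proof (intro sum_nonneg mult_nonneg_nonneg zero_le_power2)
    fix r assume "r \<in> {k * B + 1..(k + 1) * B}"
    then show "0 \<le> mat_prod A (r - 1) (k * B) $ 2 $ 2"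
      by (intro mat_prod_22_nonneg) auto
  qed
  then show "0 \<le> phi22 A L \<rho> \<alpha> B k"
    using gap unfolding phi22_def by (intro add_nonneg_nonneg mult_nonneg_nonneg) auto
  have "(\<Sum>r = k * B + 1..(k + 1) * B. (\<alpha> (r - 1))\<^sup>2 * mat_prod A (r - 1) (k * B) $ 2 $ 2)
      \<le> (\<Sum>r = k * B + 1..(k + 1) * B. b)"
  proof (rule sum_mono)
    fix r assume r: "r \<in> {k * B + 1..(k + 1) * B}"
    have "(\<alpha> (r - 1))\<^sup>2 * mat_prod A (r - 1) (k * B) $ 2 $ 2 \<le> (\<alpha> (r - 1))\<^sup>2 * g ^ (2 * (B - 1))"
      using r by (intro mult_left_mono mat_prod_22_le) auto
    also have "\<dots> = (\<alpha> (r - 1) * g ^ (B - 1))\<^sup>2" by (simp add: power_mult_distrib power_even_eq)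
    also have "\<dots> \<le> b"
    proof -
      have "\<alpha> (r - 1) * g ^ (B - 1) * L \<le> (1 - \<rho>\<^sup>2) / (8 * real B)"
        using alpha_g_le[of "r - 1"] by (simp only: mult_ac)
      then have "\<alpha> (r - 1) * g ^ (B - 1) \<le> (1 - \<rho>\<^sup>2) / (8 * real B) / L"
        by (rule mult_imp_le_div_pos[OF L_pos])
      moreover have "0 \<le> \<alpha> (r - 1) * g ^ (B - 1)"
        using alpha_pos[of "r - 1"] g_ge_1 by simp
      ultimately show ?thesis unfolding b_def by (intro power_mono) simp_all
    qed
    finally show "(\<alpha> (r - 1))\<^sup>2 * mat_prod A (r - 1) (k * B) $ 2 $ 2 \<le> b" .
  qed
  then have "16 * real B * L\<^sup>2 / (1 - \<rho>\<^sup>2) *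
      (\<Sum>r = k * B + 1..(k + 1) * B. (\<alpha> (r - 1))\<^sup>2 * mat_prod A (r - 1) (k * B) $ 2 $ 2)
      \<le> 16 * real B * L\<^sup>2 / (1 - \<rho>\<^sup>2) * (real B * b)"
    using gap by (intro mult_left_mono) auto
  also have "\<dots> = (1 - \<rho>\<^sup>2) / 4"
    using gap L_pos B_ge_2 by (simp add: b_def power_divide power_mult_distrib) (simp add: field_simps power2_eq_square)
  finally show "phi22 A L \<rho> \<alpha> B k \<le> 1 - (1 - \<rho>\<^sup>2) / 4" unfolding phi22_def by argo
qed

lemma phi12_le: "phi12 A B k \<le> real B * (2 * L\<^sup>2 / (\<mu> * m) * g ^ (2 * (B - 1))) * \<alpha> (k * B)"
  using mat_prod_12_le[of "k * B" "k * B" "(k + 1) * B" B] by (simp add: phi12_def mult_ac)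

section \<open>The noise terms of a block\<close>

lemma coeff_C_1: "C k $ 1 = (\<alpha> k)\<^sup>2 * \<sigma>\<^sup>2 / m"
  by (simp add: coeff_C_def)

text \<open>The step size in the denominator cancels one power, so the heterogeneity makes this
  entry of first order in the step size.\<close>

lemma coeff_C_2: "C k $ 2 = m * (\<alpha> k * ((1 + s k) * \<delta>\<^sup>2 / (sqrt 2 * L) + \<alpha> k * \<sigma>\<^sup>2))"
proof -
  have "\<alpha> k * (2 * y / s k) = y / (sqrt 2 * L)" for y
    using alpha_pos[of k] L_pos by (simp add: field_simps)
  then have "\<alpha> k * (2 * (1 + s k) / s k) * \<delta>\<^sup>2 = (1 + s k) / (sqrt 2 * L) * \<delta>\<^sup>2"
    by (simp only:)
  then have "\<alpha> k * (2 * (1 + s k) / s k * \<delta>\<^sup>2 + \<sigma>\<^sup>2) = (1 + s k) * \<delta>\<^sup>2 / (sqrt 2 * L) + \<alpha> k * \<sigma>\<^sup>2"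
    by (simp only: distrib_left mult.assoc times_divide_eq_left)
  then show ?thesis by (simp add: coeff_C_def power2_eq_square[of "\<alpha> k"] mult.assoc)
qed

lemma coeff_C_2_le:
  assumes "j \<le> k"
  shows "C k $ 2 \<le> m * (\<alpha> j * (g * \<delta>\<^sup>2 / (sqrt 2 * L) + \<alpha> j * \<sigma>\<^sup>2))"
  unfolding coeff_C_2 using alpha_mono[OF assms] alpha_pos[of k] alpha_pos[of j] m_pos L_pos s_pos[of k] s_le[of k]
  by (intro mult_left_mono mult_mono add_mono divide_right_mono mult_right_mono)
    (auto intro!: add_nonneg_nonneg)

lemma coeff_C_2_ge: "m * (\<alpha> k * (\<delta>\<^sup>2 / (sqrt 2 * L))) \<le> C k $ 2"
proof -
  have "1 * \<delta>\<^sup>2 / (sqrt 2 * L) \<le> (1 + s k) * \<delta>\<^sup>2 / (sqrt 2 * L)"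
    using L_pos s_pos[of k] by (intro divide_right_mono mult_right_mono) auto
  then have "\<delta>\<^sup>2 / (sqrt 2 * L) \<le> (1 + s k) * \<delta>\<^sup>2 / (sqrt 2 * L) + \<alpha> k * \<sigma>\<^sup>2"
    using alpha_pos[of k] by (auto intro: add_increasing2)
  then show ?thesis
    unfolding coeff_C_2 using alpha_pos[of k] m_pos by (intro mult_left_mono) auto
qed

lemma coeff_C_nonneg: "0 \<le> C k $ 1" "0 \<le> C k $ 2"
proof -
  show "0 \<le> C k $ 1" using m_pos by (simp add: coeff_C_1)
  have "0 \<le> m * (\<alpha> k * (\<delta>\<^sup>2 / (sqrt 2 * L)))" using alpha_pos[of k] m_pos L_pos by simp
  then show "0 \<le> C k $ 2" using coeff_C_2_ge[of k] by linarith
qed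

lemma psi1_eq: "psi1 A C B k = (\<Sum>r = k * B + 1..(k + 1) * B - 1.
    mat_prod A ((k + 1) * B) r $ 1 $ 1 * C (r - 1) $ 1 + mat_prod A ((k + 1) * B) r $ 1 $ 2 * C (r - 1) $ 2)
    + C ((k + 1) * B - 1) $ 1"
  by (simp add: psi1_def sum_component matrix_vector_mult_def sum_2 del: mat_prod.simps)

text \<open>All step sizes are replaced by the first one of the block. The factor
  \<open>B - 1\<close> in \<open>nu\<close> counts the steps over which coupling accumulates, the
  outer \<open>B\<close> counts the noise terms, and \<open>c * (m * (a * D))\<close> is
  \<open>a\<^sup>2\<close> times \<open>nu\<close> by construction.\<close>

lemma psi1_le: "psi1 A C B k \<le> (\<alpha> (k * B))\<^sup>2 * real B * (\<sigma>\<^sup>2 / m + nu \<mu> L \<delta> \<sigma> \<rho> \<alpha> B (k * B))"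
proof -
  define a where "a = \<alpha> (k * B)"
  define D where "D = g * \<delta>\<^sup>2 / (sqrt 2 * L) + a * \<sigma>\<^sup>2"
  have a: "0 < a" by (simp add: a_def alpha_pos)
  have D: "0 \<le> D" using a L_pos Gamma1_pos by (simp add: D_def)
  define c where "c = (real B - 1) * (2 * a * L\<^sup>2 / (\<mu> * m) * g ^ (2 * (B - 1)))"
  have c: "0 \<le> c" using a mu_pos m_pos Gamma1_pos B_ge_2 by (simp add: c_def)
  have C1: "C r $ 1 \<le> a\<^sup>2 * (\<sigma>\<^sup>2 / m)" if "k * B \<le> r" for r
    using alpha_mono[OF that] alpha_pos[of r] m_pos
    by (auto simp: coeff_C_1 a_def intro!: divide_right_mono mult_right_mono power_mono)
  have "(\<Sum>r = k * B + 1..(k + 1) * B - 1.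
      mat_prod A ((k + 1) * B) r $ 1 $ 1 * C (r - 1) $ 1 + mat_prod A ((k + 1) * B) r $ 1 $ 2 * C (r - 1) $ 2)
    \<le> (\<Sum>r = k * B + 1..(k + 1) * B - 1. a\<^sup>2 * (\<sigma>\<^sup>2 / m) + c * (m * (a * D)))"
  proof (rule sum_mono)
    fix r assume "r \<in> {k * B + 1..(k + 1) * B - 1}"
    then have r: "k * B + 1 \<le> r" "r \<le> (k + 1) * B - 1" "r \<le> (k + 1) * B" by auto
    have "mat_prod A ((k + 1) * B) r $ 1 $ 1 * C (r - 1) $ 1 \<le> 1 * (a\<^sup>2 * (\<sigma>\<^sup>2 / m))"
      using mat_prod_11_bounds[OF r(3)] coeff_C_nonneg(1)[of "r - 1"] C1[of "r - 1"] r
      by (intro mult_mono) auto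
    moreover have "mat_prod A ((k + 1) * B) r $ 1 $ 2 * C (r - 1) $ 2 \<le> c * (m * (a * D))"
    proof (intro mult_mono c)
      have "mat_prod A ((k + 1) * B) r $ 1 $ 2
          \<le> real (B - 1) * (2 * a * L\<^sup>2 / (\<mu> * m) * g ^ (2 * (B - 1 - 1)))"
        unfolding a_def using r by (intro mat_prod_12_le) auto
      also have "\<dots> \<le> c"
        unfolding c_def using a mu_pos m_pos g_ge_1 B_ge_2
        by (intro mult_mono mult_left_mono power_increasing) auto
      finally show "mat_prod A ((k + 1) * B) r $ 1 $ 2 \<le> c" .
      show "C (r - 1) $ 2 \<le> m * (a * D)"
        unfolding a_def D_def using r by (intro coeff_C_2_le) auto
    qed (rule coeff_C_nonneg)
    ultimately show "mat_prod A ((k + 1) * B) r $ 1 $ 1 * C (r - 1) $ 1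
        + mat_prod A ((k + 1) * B) r $ 1 $ 2 * C (r - 1) $ 2 \<le> a\<^sup>2 * (\<sigma>\<^sup>2 / m) + c * (m * (a * D))"
      by simp
  qed
  also have "\<dots> = (real B - 1) * (a\<^sup>2 * (\<sigma>\<^sup>2 / m) + c * (m * (a * D)))"
    using B_ge_2 by (simp add: of_nat_diff algebra_simps)
  finally have "psi1 A C B k \<le> (real B - 1) * (a\<^sup>2 * (\<sigma>\<^sup>2 / m) + c * (m * (a * D))) + a\<^sup>2 * (\<sigma>\<^sup>2 / m)"
    unfolding psi1_eq using C1[of "(k + 1) * B - 1"] B_ge_2 by (intro add_mono) auto
  also have "\<dots> \<le> real B * (a\<^sup>2 * (\<sigma>\<^sup>2 / m) + c * (m * (a * D)))"
  proof -
    have "0 \<le> c * (m * (a * D))" using c D a m_pos by simp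
    moreover have "(real B - 1) * (e + h) + e = real B * (e + h) - h" for e h :: real
      by (simp add: algebra_simps)
    ultimately show ?thesis by simp
  qed
  also have "c * (m * (a * D)) = a\<^sup>2 * nu \<mu> L \<delta> \<sigma> \<rho> \<alpha> B (k * B)"
    using mu_pos m_pos unfolding c_def D_def nu_def a_def[symmetric]
    by (simp add: power2_eq_square field_simps)
  finally show ?thesis by (simp add: a_def algebra_simps)
qed

lemma psi2_le: "psi2 A C m L \<delta> \<sigma> \<rho> \<alpha> B k \<le> (\<alpha> (k * B))\<^sup>2 * real B * (2 * m * real B *
    (2 * ((\<delta>\<^sup>2 + 2 * \<mu> * \<alpha> (k * B) * nu \<mu> L \<delta> \<sigma> \<rho> \<alpha> B (k * B)) / (1 - \<rho>\<^sup>2)) + \<sigma>\<^sup>2))"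
proof -
  define a where "a = \<alpha> (k * B)"
  define D where "D = g * \<delta>\<^sup>2 / (sqrt 2 * L) + a * \<sigma>\<^sup>2"
  define c where "c = (real B - 1) * (g ^ (2 * (B - 1)) * (m * (a * D)))"
  define y where "y = 2 * \<mu> * a * nu \<mu> L \<delta> \<sigma> \<rho> \<alpha> B (k * B)"
  have a: "0 < a" by (simp add: a_def alpha_pos)
  have D: "0 \<le> D" using a L_pos Gamma1_pos by (simp add: D_def)
  have c: "0 \<le> c" using a D m_pos Gamma1_pos B_ge_2 by (simp add: c_def)
  have "(\<Sum>r = k * B + 1..(k + 1) * B. (\<alpha> (r - 1))\<^sup>2 *
       (2 / (1 - \<rho>\<^sup>2) * (m * \<delta>\<^sup>2 + 4 * L\<^sup>2 *
            (\<Sum>l = k * B + 1..r - 1. mat_prod A (r - 1) l $ 2 $ 2 * C (l - 1) $ 2))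
        + m * \<sigma>\<^sup>2))
    \<le> (\<Sum>r = k * B + 1..(k + 1) * B. a\<^sup>2 * (2 / (1 - \<rho>\<^sup>2) * (m * \<delta>\<^sup>2 + 4 * L\<^sup>2 * c) + m * \<sigma>\<^sup>2))"
  proof (rule sum_mono)
    fix r assume r: "r \<in> {k * B + 1..(k + 1) * B}"
    have le: "mat_prod A (r - 1) l $ 2 $ 2 * C (l - 1) $ 2 \<le> g ^ (2 * (B - 1)) * (m * (a * D))"
      if l: "l \<in> {k * B + 1..r - 1}" for l
    proof (intro mult_mono)
      show "mat_prod A (r - 1) l $ 2 $ 2 \<le> g ^ (2 * (B - 1))" using l r by (intro mat_prod_22_le) auto
      show "C (l - 1) $ 2 \<le> m * (a * D)" unfolding a_def D_def using l by (intro coeff_C_2_le) auto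
      show "0 \<le> C (l - 1) $ 2" by (rule coeff_C_nonneg)
      show "0 \<le> g ^ (2 * (B - 1))" using Gamma1_pos by simp
    qed
    have nonneg: "0 \<le> mat_prod A (r - 1) l $ 2 $ 2 * C (l - 1) $ 2" if "l \<in> {k * B + 1..r - 1}" for l
      using that by (intro mult_nonneg_nonneg mat_prod_22_nonneg coeff_C_nonneg) auto
    have "(\<Sum>l = k * B + 1..r - 1. mat_prod A (r - 1) l $ 2 $ 2 * C (l - 1) $ 2)
        \<le> real (card {k * B + 1..r - 1}) * (g ^ (2 * (B - 1)) * (m * (a * D)))"
      using le by (rule sum_bounded_above)
    also have "\<dots> \<le> c"
    proof -
      have "card {k * B + 1..r - 1} \<le> B - 1" using r by auto
      then have "real (card {k * B + 1..r - 1}) \<le> real B - 1" using B_ge_2 by linarith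
      then show ?thesis unfolding c_def using a D m_pos Gamma1_pos by (intro mult_right_mono) auto
    qed
    finally have le_c: "(\<Sum>l = k * B + 1..r - 1. mat_prod A (r - 1) l $ 2 $ 2 * C (l - 1) $ 2) \<le> c" .
    have ge_0: "0 \<le> (\<Sum>l = k * B + 1..r - 1. mat_prod A (r - 1) l $ 2 $ 2 * C (l - 1) $ 2)"
      by (rule sum_nonneg) (rule nonneg)
    have q: "0 \<le> 2 / (1 - \<rho>\<^sup>2)" using gap by simp
    have "(\<alpha> (r - 1))\<^sup>2 \<le> a\<^sup>2"
      using alpha_mono[of "k * B" "r - 1"] alpha_pos[of "r - 1"] r by (intro power_mono) (auto simp: a_def)
    then show "(\<alpha> (r - 1))\<^sup>2 *
         (2 / (1 - \<rho>\<^sup>2) * (m * \<delta>\<^sup>2 + 4 * L\<^sup>2 *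
              (\<Sum>l = k * B + 1..r - 1. mat_prod A (r - 1) l $ 2 $ 2 * C (l - 1) $ 2))
          + m * \<sigma>\<^sup>2)
      \<le> a\<^sup>2 * (2 / (1 - \<rho>\<^sup>2) * (m * \<delta>\<^sup>2 + 4 * L\<^sup>2 * c) + m * \<sigma>\<^sup>2)"
    proof (rule mult_mono)
      show "2 / (1 - \<rho>\<^sup>2) * (m * \<delta>\<^sup>2 + 4 * L\<^sup>2 *
              (\<Sum>l = k * B + 1..r - 1. mat_prod A (r - 1) l $ 2 $ 2 * C (l - 1) $ 2)) + m * \<sigma>\<^sup>2
          \<le> 2 / (1 - \<rho>\<^sup>2) * (m * \<delta>\<^sup>2 + 4 * L\<^sup>2 * c) + m * \<sigma>\<^sup>2"
        by (intro add_right_mono mult_left_mono add_left_mono le_c q) simp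
      show "0 \<le> 2 / (1 - \<rho>\<^sup>2) * (m * \<delta>\<^sup>2 + 4 * L\<^sup>2 *
              (\<Sum>l = k * B + 1..r - 1. mat_prod A (r - 1) l $ 2 $ 2 * C (l - 1) $ 2)) + m * \<sigma>\<^sup>2"
        using m_pos by (intro q ge_0 add_nonneg_nonneg mult_nonneg_nonneg) auto
    qed simp
  qed
  also have "\<dots> = real B * (a\<^sup>2 * (2 / (1 - \<rho>\<^sup>2) * (m * \<delta>\<^sup>2 + 4 * L\<^sup>2 * c) + m * \<sigma>\<^sup>2))"
    by (simp add: algebra_simps)
  finally have "psi2 A C m L \<delta> \<sigma> \<rho> \<alpha> B k
      \<le> 2 * real B * (real B * (a\<^sup>2 * (2 / (1 - \<rho>\<^sup>2) * (m * \<delta>\<^sup>2 + 4 * L\<^sup>2 * c) + m * \<sigma>\<^sup>2)))"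
    unfolding psi2_def by (intro mult_left_mono) auto
  \<comment> \<open>The accumulated disagreement has the same factors as \<open>nu\<close> apart
    from a prefactor, which explains the term \<open>2 * \<mu> * \<alpha> * \<nu>\<close> in the
    claim.\<close>
  also have "4 * L\<^sup>2 * c = m * y"
  proof -
    have "nu \<mu> L \<delta> \<sigma> \<rho> \<alpha> B (k * B) = 2 / \<mu> * (real B - 1) * L\<^sup>2 * g ^ (2 * (B - 1)) * D"
      by (simp only: nu_def D_def a_def)
    then show ?thesis using mu_pos by (simp add: c_def y_def mult_ac)
  qed
  also have "2 * real B * (real B * (a\<^sup>2 * (2 / (1 - \<rho>\<^sup>2) * (m * \<delta>\<^sup>2 + m * y) + m * \<sigma>\<^sup>2)))
      = a\<^sup>2 * real B * (2 * m * real B * (2 * ((\<delta>\<^sup>2 + y) / (1 - \<rho>\<^sup>2)) + \<sigma>\<^sup>2))"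
  proof -
    have "2 / q * (m * u + m * y) = m * (2 * ((u + y) / q))" for q u :: real
      by (simp add: algebra_simps add_divide_distrib)
    moreover have "2 * b * (b * (a\<^sup>2 * (m * x + m * z))) = a\<^sup>2 * b * (2 * m * b * (x + z))" for b x z :: real
      by (simp add: algebra_simps)
    ultimately show ?thesis by (simp only:)
  qed
  finally show ?thesis by (simp only: a_def y_def)
qed

lemma nu_mono:
  assumes "j \<le> k"
  shows "nu \<mu> L \<delta> \<sigma> \<rho> \<alpha> B k \<le> nu \<mu> L \<delta> \<sigma> \<rho> \<alpha> B j"
  unfolding nu_def using alpha_mono[OF assms] B_ge_2 Gamma1_pos mu_pos
  by (intro mult_left_mono add_left_mono mult_right_mono) auto

lemma nu_nonneg: "0 \<le> nu \<mu> L \<delta> \<sigma> \<rho> \<alpha> B k"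
  unfolding nu_def using alpha_pos[of k] B_ge_2 Gamma1_pos mu_pos L_pos
  by (intro mult_nonneg_nonneg add_nonneg_nonneg divide_nonneg_nonneg) auto

text \<open>Only the heterogeneity of the first step is kept, carried into the average by the
  coupling of the last step. It is free of \<sigma>, and one of its two step sizes is lowered to the
  first one of the next block.\<close>

lemma psi1_ge: "\<alpha> ((k + 1) * B) * \<alpha> (k * B) * (L * \<delta>\<^sup>2 / (sqrt 2 * \<mu>)) \<le> psi1 A C B k"
proof -
  define T where "T = (k + 1) * B"
  \<comment> \<open>Here \<open>B\<close> at least 2 matters: it makes the sum in
    \<open>psi1\<close> nonempty. With one step per block and \<sigma> = 0, \<open>psi1\<close>
    would vanish.\<close>
  have T: "Suc (k * B + 1) \<le> T" "k * B + 1 \<le> T - 1" "T = Suc (T - 1)" using B_ge_2 by (auto simp: T_def)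
  define f where "f r = mat_prod A T r $ 1 $ 1 * C (r - 1) $ 1 + mat_prod A T r $ 1 $ 2 * C (r - 1) $ 2" for r
  have f: "0 \<le> f r" if "r \<in> {k * B + 1..T - 1}" for r
  proof -
    have "r \<le> T" using that by auto
    then show ?thesis
      unfolding f_def
      by (intro add_nonneg_nonneg mult_nonneg_nonneg coeff_C_nonneg mat_prod_12_nonneg
          less_imp_le[OF mat_prod_11_bounds(1)])
  qed
  have "\<alpha> T \<le> \<alpha> (T - 1)" by (rule alpha_mono) simp
  then have "\<alpha> T * L\<^sup>2 / (\<mu> * m) \<le> \<alpha> (T - 1) * L\<^sup>2 / (\<mu> * m)"
    using mu_pos m_pos by (intro divide_right_mono mult_right_mono) auto
  also have "\<dots> \<le> mat_prod A T (k * B + 1) $ 1 $ 2"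
    using mat_prod_12_ge[OF T(2)] T(3) by simp
  finally have "(\<alpha> T * L\<^sup>2 / (\<mu> * m)) * (m * (\<alpha> (k * B) * (\<delta>\<^sup>2 / (sqrt 2 * L))))
      \<le> mat_prod A T (k * B + 1) $ 1 $ 2 * C (k * B) $ 2"
    using alpha_pos[of T] alpha_pos[of "k * B"] L_pos mu_pos m_pos
    by (intro mult_mono coeff_C_2_ge) (auto intro: order_trans[rotated])
  also have "\<dots> \<le> f (k * B + 1)"
    using mat_prod_11_bounds(1)[of "k * B + 1" T] T coeff_C_nonneg(1)[of "k * B"] by (simp add: f_def)
  also have "\<dots> \<le> (\<Sum>r = k * B + 1..T - 1. f r)"
    using T f by (intro member_le_sum) auto
  also have "\<dots> \<le> psi1 A C B k"
    unfolding psi1_eq f_def T_def using coeff_C_nonneg(1) by simp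
  finally show ?thesis
    using mu_pos m_pos L_pos by (simp add: T_def power2_eq_square field_simps)
qed

lemma psi1_pos: "0 < psi1 A C B k"
proof -
  have "0 < \<alpha> ((k + 1) * B) * \<alpha> (k * B) * (L * \<delta>\<^sup>2 / (sqrt 2 * \<mu>))"
    using alpha_pos L_pos delta_pos mu_pos by simp
  then show ?thesis using psi1_ge[of k] by linarith
qed

lemma psi2_nonneg: "0 \<le> psi2 A C m L \<delta> \<sigma> \<rho> \<alpha> B k"
proof -
  have "0 \<le> mat_prod A (r - 1) l $ 2 $ 2 * C (l - 1) $ 2" if "l \<in> {k * B + 1..r - 1}" for l r
    using that by (intro mult_nonneg_nonneg mat_prod_22_nonneg coeff_C_nonneg) auto
  then have inner: "0 \<le> (\<Sum>l = k * B + 1..r - 1. mat_prod A (r - 1) l $ 2 $ 2 * C (l - 1) $ 2)" for r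
    by (rule sum_nonneg)
  have "0 \<le> 2 / (1 - \<rho>\<^sup>2)" "0 \<le> m" using gap m_pos by auto
  then have "0 \<le> 2 / (1 - \<rho>\<^sup>2) * (m * \<delta>\<^sup>2 + 4 * L\<^sup>2 *
      (\<Sum>l = k * B + 1..r - 1. mat_prod A (r - 1) l $ 2 $ 2 * C (l - 1) $ 2)) + m * \<sigma>\<^sup>2" for r
    by (intro inner mult_nonneg_nonneg add_nonneg_nonneg zero_le_power2) auto
  then show ?thesis
    unfolding psi2_def by (intro mult_nonneg_nonneg[of "2 * real B"] sum_nonneg mult_nonneg_nonneg[of "(_)\<^sup>2"]) auto
qed

end

subsection \<open>Block recursion\<close>

lemma spectral_radius_triangular:
  fixes M :: "real^2^2"
  assumes "M $ 2 $ 1 = 0"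
  shows "spectral_radius M = max \<bar>M $ 1 $ 1\<bar> \<bar>M $ 2 $ 2\<bar>"
proof -
  let ?M = "(\<chi> i j. complex_of_real (M $ i $ j)) :: complex^2^2"
  have mult: "?M *v x = z *s x \<longleftrightarrow>
      complex_of_real (M $ 1 $ 1) * x $ 1 + complex_of_real (M $ 1 $ 2) * x $ 2 = z * x $ 1 \<and>
      complex_of_real (M $ 2 $ 2) * x $ 2 = z * x $ 2" for x z
    using assms by (simp add: vec_eq_iff forall_2 matrix_vector_mult_def sum_2)
  define a b c where "a = M $ 1 $ 1" and "b = M $ 2 $ 2" and "c = M $ 1 $ 2"
  have "complex_eigenvalues M = {complex_of_real a, complex_of_real b}"
  proof (intro equalityI subsetI)
    fix z assume "z \<in> complex_eigenvalues M"
    then obtain x :: "complex^2" where x: "x \<noteq> 0" "?M *v x = z *s x"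
      by (auto simp: complex_eigenvalues_def)
    then show "z \<in> {complex_of_real a, complex_of_real b}"
      unfolding mult by (auto simp: vec_eq_iff forall_2 a_def b_def)
  next
    fix z assume "z \<in> {complex_of_real a, complex_of_real b}"
    moreover have "complex_of_real a \<in> complex_eigenvalues M"
      unfolding complex_eigenvalues_def mem_Collect_eq mult
      by (rule exI[of _ "vector [1, 0]"]) (simp add: vec_eq_iff forall_2 a_def)
    \<comment> \<open>The eigenvector solves the first row for its first coordinate, which needs
      \<open>a \<noteq> b\<close>. For equal diagonal entries the eigenvalue has already been
      found.\<close>
    moreover have "complex_of_real b \<in> complex_eigenvalues M"
      if "a \<noteq> b"
      unfolding complex_eigenvalues_def mem_Collect_eq mult a_def[symmetric] b_def[symmetric] c_def[symmetric]
      by (rule exI[of _ "vector [complex_of_real (c / (b - a)), 1]"])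
        (use that in \<open>simp add: vec_eq_iff forall_2 field_simps\<close>)
    ultimately show "z \<in> complex_eigenvalues M" by (cases "a = b") auto
  qed
  then show ?thesis by (simp add: spectral_radius_def a_def b_def)
qed

text \<open>The index shift in \<open>b\<close> gives the sum the shape of the claimed bound. Its
  last summand has an empty product and is the term listed separately there.\<close>

lemma scalar_recursion_unroll:
  fixes z f b :: "nat \<Rightarrow> real"
  assumes "\<And>k. z (Suc k) \<le> f k * z k + b k" and "\<And>k. 0 \<le> f k"
  shows "z k \<le> (\<Prod>j = 0..<k. f j) * z 0 + (\<Sum>r = 1..<Suc k. (\<Prod>j = r..<k. f j) * b (r - 1))"
proof (induction k)
  case (Suc k)
  have "f k * z k + b k \<le> f k * ((\<Prod>j = 0..<k. f j) * z 0
      + (\<Sum>r = 1..<Suc k. (\<Prod>j = r..<k. f j) * b (r - 1))) + b k"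
    using Suc assms(2) by (intro add_right_mono mult_left_mono)
  also have "\<dots> = (\<Prod>j = 0..<Suc k. f j) * z 0
      + (\<Sum>r = 1..<Suc (Suc k). (\<Prod>j = r..<Suc k. f j) * b (r - 1))"
    by (simp add: sum_distrib_left distrib_left mult_ac)
  finally show ?case using assms(1)[of k] by linarith
qed simp

text \<open>The potential \<open>x + c \<eta> y\<close> absorbs the coupling of \<open>x\<close> to \<open>y\<close>: since \<open>y\<close> contracts faster than
  \<open>x\<close> by the factor \<open>\<theta>\<close>, the choice of \<open>c\<close> makes the potential contract at the rate of \<open>x\<close>.\<close>

lemma coupled_recursion:
  fixes x y f h \<eta> p g q :: "nat \<Rightarrow> real"
  assumes x: "\<And>k. x (Suc k) \<le> f k * x k + h k * y k + p k"
    and y: "\<And>k. y (Suc k) \<le> g k * y k + q k"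
    and y0: "\<And>k. 0 \<le> y k"
    and f: "0 < f0" "\<And>k. f0 \<le> f k"
    and g: "\<And>k. 0 \<le> g k" "\<And>k. g k \<le> \<theta> * f k" "\<theta> < 1"
    and h: "\<And>k. h k \<le> \<eta> k" "\<And>k. 0 \<le> \<eta> k" "\<And>k. \<eta> (Suc k) \<le> \<eta> k"
    and q: "\<And>k. \<eta> (Suc k) * q k \<le> D * p k"
  defines "c \<equiv> 1 / (f0 * (1 - \<theta>))"
  shows "x (Suc k) \<le> (\<Prod>j = 0..<Suc k. f j) * (x 0 + c * \<eta> 0 * y 0)
    + (1 + c * D) * (\<Sum>r = 1..<Suc k. (\<Prod>j = r..<Suc k. f j) * p (r - 1)) + p k"
proof -
  \<comment> \<open>The weight is the non-increasing majorant \<eta> rather than the coupling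
    \<open>h\<close>, so that it may be compared between consecutive blocks.\<close>
  define T where "T k = x k + c * \<eta> k * y k" for k
  have f_nonneg: "0 \<le> f k" for k using f(1) f(2)[of k] by linarith
  have c: "0 < c" using f g by (simp add: c_def)
  have absorb: "1 + c * (\<theta> * f k) \<le> c * f k" for k
  proof -
    have "1 = c * (f0 * (1 - \<theta>))" using f g by (simp add: c_def)
    also have "\<dots> \<le> c * (f k * (1 - \<theta>))"
      using c g f(2)[of k] by (intro mult_left_mono mult_right_mono) auto
    finally show ?thesis by (simp add: algebra_simps)
  qed
  have step: "x (Suc k) + c * \<eta> (Suc k) * (g k * y k) \<le> f k * T k + p k" for k
  proof -
    have "h k * y k \<le> \<eta> k * y k" using h y0 by (intro mult_right_mono)
    moreover have "c * \<eta> (Suc k) * (g k * y k) \<le> c * \<eta> k * (\<theta> * f k * y k)"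
      using c h y0 g by (intro mult_mono mult_left_mono mult_right_mono mult_nonneg_nonneg) auto
    moreover have "c * \<eta> k * (\<theta> * f k * y k) = \<eta> k * y k * (c * (\<theta> * f k))" by simp
    moreover have "\<eta> k * y k * (1 + c * (\<theta> * f k)) \<le> \<eta> k * y k * (c * f k)"
      using absorb h y0 by (intro mult_left_mono mult_nonneg_nonneg)
    moreover have "f k * T k = f k * x k + \<eta> k * y k * (c * f k)" by (simp add: T_def algebra_simps)
    ultimately show ?thesis using x[of k] by (simp add: distrib_left)
  qed
  have T_Suc: "T (Suc k) \<le> f k * T k + (1 + c * D) * p k" for k
  proof -
    have "c * \<eta> (Suc k) * y (Suc k) \<le> c * \<eta> (Suc k) * (g k * y k + q k)"
      using c h y by (intro mult_left_mono mult_nonneg_nonneg) auto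
    moreover have "c * (\<eta> (Suc k) * q k) \<le> c * (D * p k)"
      using c q by (intro mult_left_mono) auto
    ultimately show ?thesis using step[of k] by (simp add: T_def algebra_simps)
  qed
  \<comment> \<open>The last block uses \<open>step\<close>, in which \<open>p k\<close> has the
    coefficient one; going through \<open>T_Suc\<close> would give it the factor
    \<open>1 + c * D\<close>.\<close>
  have "0 \<le> c * \<eta> (Suc k) * (g k * y k)" using c h g y0 by simp
  then have "x (Suc k) \<le> f k * T k + p k" using step[of k] by linarith
  also have "\<dots> \<le> f k * ((\<Prod>j = 0..<k. f j) * T 0
      + (\<Sum>r = 1..<Suc k. (\<Prod>j = r..<k. f j) * ((1 + c * D) * p (r - 1)))) + p k"
    using scalar_recursion_unroll[where z=T and f=f and b="\<lambda>k. (1 + c * D) * p k", OF T_Suc f_nonneg] f_nonneg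
    by (intro add_right_mono mult_left_mono)
  also have "\<dots> = (\<Prod>j = 0..<Suc k. f j) * T 0
    + (1 + c * D) * (\<Sum>r = 1..<Suc k. (\<Prod>j = r..<Suc k. f j) * p (r - 1)) + p k"
    by (simp add: sum_distrib_left distrib_left mult_ac)
  finally show ?thesis by (simp add: T_def)
qed

lemma sum_atLeastAtMost_shift: "(\<Sum>r = a + 1..a + n. h r) = (\<Sum>r<n. h (Suc (a + r)))"
  for h :: "nat \<Rightarrow> 'a::comm_monoid_add"
  by (induction n) simp_all

section \<open>Unrolling the error recursion over one block\<close>

locale block_sgd =
  decentralized_sgd M F L \<mu> \<delta> wopt W \<epsilon> P \<alpha> \<sigma> +
  coeff: step_size_coefficients "real CARD('m)" L \<mu> \<delta> \<sigma> \<rho> \<alpha> B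
  for M :: "'w measure" and F :: "'m::finite \<Rightarrow> real^'n \<Rightarrow> real" and L \<mu> \<delta> wopt W \<epsilon>
    and P :: "nat \<Rightarrow> real^'m^'m" and \<alpha> \<sigma> \<rho> B +
  assumes contraction: "contraction_factor P B \<le> \<rho>"
begin

lemma error_vector_entries:
  "error_vector M W wopt k $ 1 = opt_err k" "error_vector M W wopt k $ 2 = cons_err k"
  by (simp_all add: error_vector_def opt_err_def cons_err_def disagreement_def)

lemma cons_err_add:
  "cons_err (s + n) \<le> mat_prod coeff.A (s + n) s $ 2 $ 2 * cons_err s
    + (\<Sum>r<n. mat_prod coeff.A (s + n) (Suc (s + r)) $ 2 $ 2 * coeff.C (s + r) $ 2)"
proof (induction n)
  case (Suc n)
  have "cons_err (Suc (s + n)) \<le> (1 + coeff.s (s + n))\<^sup>2 * cons_err (s + n) + coeff.C (s + n) $ 2"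
    using cons_err_Suc[of "s + n"] by (simp add: coeff_C_def)
  also have "\<dots> \<le> (1 + coeff.s (s + n))\<^sup>2 * (mat_prod coeff.A (s + n) s $ 2 $ 2 * cons_err s
      + (\<Sum>r<n. mat_prod coeff.A (s + n) (Suc (s + r)) $ 2 $ 2 * coeff.C (s + r) $ 2)) + coeff.C (s + n) $ 2"
    using Suc by (intro add_right_mono mult_left_mono) auto
  also have "\<dots> = mat_prod coeff.A (s + Suc n) s $ 2 $ 2 * cons_err s
      + (\<Sum>r<Suc n. mat_prod coeff.A (s + Suc n) (Suc (s + r)) $ 2 $ 2 * coeff.C (s + r) $ 2)"
    by (simp add: coeff.mat_prod_Suc_entries mat_def sum_distrib_left distrib_left
        mult.assoc del: mat_prod.simps)
  finally show ?case by simp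
qed (simp add: mat_def)

text \<open>Each induction step feeds the unrolled bound for the disagreement through the coupling
  entry, which is nonnegative.\<close>

lemma opt_err_add:
  "opt_err (s + n) \<le> mat_prod coeff.A (s + n) s $ 1 $ 1 * opt_err s
    + mat_prod coeff.A (s + n) s $ 1 $ 2 * cons_err s
    + (\<Sum>r<n. mat_prod coeff.A (s + n) (Suc (s + r)) $ 1 $ 1 * coeff.C (s + r) $ 1
        + mat_prod coeff.A (s + n) (Suc (s + r)) $ 1 $ 2 * coeff.C (s + r) $ 2)"
proof (induction n)
  case (Suc n)
  define a where "a = coeff.A (s + n) $ 1 $ 2"
  have a: "0 \<le> a" unfolding a_def by (rule coeff.A12_nonneg)
  have a': "0 \<le> 1 - \<mu> * \<alpha> (s + n)" using coeff.mu_alpha(3)[of "s + n"] by simp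
  have "opt_err (Suc (s + n)) \<le> (1 - \<mu> * \<alpha> (s + n)) * opt_err (s + n) + a * cons_err (s + n)
      + coeff.C (s + n) $ 1"
    using opt_err_Suc[of "s + n"] by (simp add: coeff_C_def a_def)
  also have "\<dots> \<le> (1 - \<mu> * \<alpha> (s + n)) * (mat_prod coeff.A (s + n) s $ 1 $ 1 * opt_err s
        + mat_prod coeff.A (s + n) s $ 1 $ 2 * cons_err s
        + (\<Sum>r<n. mat_prod coeff.A (s + n) (Suc (s + r)) $ 1 $ 1 * coeff.C (s + r) $ 1
          + mat_prod coeff.A (s + n) (Suc (s + r)) $ 1 $ 2 * coeff.C (s + r) $ 2))
      + a * (mat_prod coeff.A (s + n) s $ 2 $ 2 * cons_err s
        + (\<Sum>r<n. mat_prod coeff.A (s + n) (Suc (s + r)) $ 2 $ 2 * coeff.C (s + r) $ 2))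
      + coeff.C (s + n) $ 1"
    using Suc cons_err_add[of s n] a a' by (intro add_right_mono add_mono mult_left_mono)
  also have "\<dots> = mat_prod coeff.A (s + Suc n) s $ 1 $ 1 * opt_err s
      + mat_prod coeff.A (s + Suc n) s $ 1 $ 2 * cons_err s
      + (\<Sum>r<Suc n. mat_prod coeff.A (s + Suc n) (Suc (s + r)) $ 1 $ 1 * coeff.C (s + r) $ 1
        + mat_prod coeff.A (s + Suc n) (Suc (s + r)) $ 1 $ 2 * coeff.C (s + r) $ 2)"
    by (simp add: coeff.mat_prod_Suc_entries mat_def a_def[symmetric]
        sum_distrib_left distrib_left distrib_right sum.distrib mult.assoc
        del: mat_prod.simps coeff.coeff_A_entries)
  finally show ?case by simp
qed (simp add: mat_def)

lemma opt_err_block: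
  "opt_err (Suc k * B) \<le> phi11 coeff.A B k * opt_err (k * B) + phi12 coeff.A B k * cons_err (k * B)
    + psi1 coeff.A coeff.C B k"
proof -
  define h where "h r = mat_prod coeff.A (k * B + B) r $ 1 $ 1 * coeff.C (r - 1) $ 1
      + mat_prod coeff.A (k * B + B) r $ 1 $ 2 * coeff.C (r - 1) $ 2" for r
  \<comment> \<open>\<open>psi1\<close> lists the last noise term separately; it is the summand
    whose matrix product is the identity.\<close>
  have "{k * B + 1..k * B + B} = insert (k * B + B) {k * B + 1..k * B + B - 1}"
    using coeff.B_ge_2 by auto
  moreover have "k * B + B \<notin> {k * B + 1..k * B + B - 1}" using coeff.B_ge_2 by auto
  ultimately have "(\<Sum>r = k * B + 1..k * B + B. h r) = h (k * B + B) + (\<Sum>r = k * B + 1..k * B + B - 1. h r)"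
    by simp
  moreover have "h (k * B + B) = coeff.C (k * B + B - 1) $ 1"
    by (simp add: h_def mat_def)
  ultimately have "psi1 coeff.A coeff.C B k = (\<Sum>r<B. h (Suc (k * B + r)))"
    unfolding coeff.psi1_eq sum_atLeastAtMost_shift[symmetric] by (simp add: h_def add.commute)
  then show ?thesis
    using opt_err_add[of "k * B" B] by (simp add: phi11_def phi12_def h_def add.commute)
qed

lemma cons_err_block_le:
  "cons_err (Suc k * B) \<le> phi22 coeff.A L \<rho> \<alpha> B k * cons_err (k * B)
    + psi2 coeff.A coeff.C (real CARD('m)) L \<delta> \<sigma> \<rho> \<alpha> B k"
proof -
  define m where "m = real CARD('m)"
  define y where "y = cons_err (k * B)"
  define e where "e r = mat_prod coeff.A (k * B + r) (k * B) $ 2 $ 2" for r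
  define S where "S r = (\<Sum>l<r. mat_prod coeff.A (k * B + r) (Suc (k * B + l)) $ 2 $ 2 * coeff.C (k * B + l) $ 2)" for r
  have y: "0 \<le> y" unfolding y_def by (rule cons_err_nonneg)
  have e: "0 \<le> e r" for r unfolding e_def by (rule coeff.mat_prod_22_nonneg) simp
  have S: "0 \<le> S r" for r
    unfolding S_def by (intro sum_nonneg mult_nonneg_nonneg coeff.mat_prod_22_nonneg coeff.coeff_C_nonneg) auto
  \<comment> \<open>The slack factor 4 matches the constants: \<open>phi22\<close> and
    \<open>psi2\<close> charge the disagreement inside a block four times as much as
    \<open>cons_err_block\<close> does.\<close>
  have le: "cons_err (k * B + r) \<le> 4 * (e r * y + S r)" for r
  proof -
    have "cons_err (k * B + r) \<le> e r * y + S r"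
      using cons_err_add[of "k * B" r] by (simp add: e_def S_def y_def)
    moreover have "0 \<le> e r * y" using e y by simp
    moreover have "u + v \<le> 4 * (u + v)" if "0 \<le> u" "0 \<le> v" for u v :: real using that by simp
    ultimately show ?thesis using S[of r] order_trans by blast
  qed
  have "cons_err (k * B + B) \<le> (1 + \<rho>\<^sup>2) / 2 * y
    + 2 * real B * (\<Sum>r<B. (\<alpha> (k * B + r))\<^sup>2 * (2 / (1 - \<rho>\<^sup>2) *
        (m * \<delta>\<^sup>2 + L\<^sup>2 * cons_err (k * B + r)) + m * \<sigma>\<^sup>2))"
    using cons_err_block[OF coeff.rho contraction, of "k * B"] by (simp add: m_def y_def)
  also have "\<dots> \<le> (1 + \<rho>\<^sup>2) / 2 * y
    + 2 * real B * (\<Sum>r<B. (\<alpha> (k * B + r))\<^sup>2 * (2 / (1 - \<rho>\<^sup>2) *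
        (m * \<delta>\<^sup>2 + L\<^sup>2 * (4 * (e r * y + S r))) + m * \<sigma>\<^sup>2))"
    using coeff.gap le by (intro add_left_mono mult_left_mono sum_mono add_right_mono) auto
  also have "\<dots> = ((1 + \<rho>\<^sup>2) / 2 + 16 * real B * L\<^sup>2 / (1 - \<rho>\<^sup>2) * (\<Sum>r<B. (\<alpha> (k * B + r))\<^sup>2 * e r)) * y
    + 2 * real B * (\<Sum>r<B. (\<alpha> (k * B + r))\<^sup>2 * (2 / (1 - \<rho>\<^sup>2) * (m * \<delta>\<^sup>2 + 4 * L\<^sup>2 * S r) + m * \<sigma>\<^sup>2))"
  proof -
    have "(\<alpha> (k * B + r))\<^sup>2 * (2 / (1 - \<rho>\<^sup>2) * (m * \<delta>\<^sup>2 + L\<^sup>2 * (4 * (e r * y + S r))) + m * \<sigma>\<^sup>2)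
        = (8 * L\<^sup>2 / (1 - \<rho>\<^sup>2) * y) * ((\<alpha> (k * B + r))\<^sup>2 * e r)
          + (\<alpha> (k * B + r))\<^sup>2 * (2 / (1 - \<rho>\<^sup>2) * (m * \<delta>\<^sup>2 + 4 * L\<^sup>2 * S r) + m * \<sigma>\<^sup>2)" for r
      by (simp add: algebra_simps add_divide_distrib)
    then have "(\<Sum>r<B. (\<alpha> (k * B + r))\<^sup>2 * (2 / (1 - \<rho>\<^sup>2) * (m * \<delta>\<^sup>2 + L\<^sup>2 * (4 * (e r * y + S r))) + m * \<sigma>\<^sup>2))
        = (8 * L\<^sup>2 / (1 - \<rho>\<^sup>2) * y) * (\<Sum>r<B. (\<alpha> (k * B + r))\<^sup>2 * e r)
          + (\<Sum>r<B. (\<alpha> (k * B + r))\<^sup>2 * (2 / (1 - \<rho>\<^sup>2) * (m * \<delta>\<^sup>2 + 4 * L\<^sup>2 * S r) + m * \<sigma>\<^sup>2))"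
      by (simp only: sum.distrib sum_distrib_left)
    then show ?thesis by (simp add: distrib_left distrib_right)
  qed
  also have "(\<Sum>r<B. (\<alpha> (k * B + r))\<^sup>2 * e r)
      = (\<Sum>r = k * B + 1..k * B + B. (\<alpha> (r - 1))\<^sup>2 * mat_prod coeff.A (r - 1) (k * B) $ 2 $ 2)"
    unfolding sum_atLeastAtMost_shift e_def by simp
  also have "(\<Sum>r<B. (\<alpha> (k * B + r))\<^sup>2 * (2 / (1 - \<rho>\<^sup>2) * (m * \<delta>\<^sup>2 + 4 * L\<^sup>2 * S r) + m * \<sigma>\<^sup>2))
      = (\<Sum>r = k * B + 1..k * B + B. (\<alpha> (r - 1))\<^sup>2 * (2 / (1 - \<rho>\<^sup>2) * (m * \<delta>\<^sup>2 + 4 * L\<^sup>2 *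
          (\<Sum>l = k * B + 1..r - 1. mat_prod coeff.A (r - 1) l $ 2 $ 2 * coeff.C (l - 1) $ 2)) + m * \<sigma>\<^sup>2))"
  proof -
    have "S r = (\<Sum>l = k * B + 1..k * B + r. mat_prod coeff.A (k * B + r) l $ 2 $ 2 * coeff.C (l - 1) $ 2)" for r
      unfolding sum_atLeastAtMost_shift S_def by simp
    then show ?thesis unfolding sum_atLeastAtMost_shift[of _ "k * B" B] by simp
  qed
  finally show ?thesis
    by (simp add: phi22_def psi2_def y_def m_def add.commute[of B])
qed

end

subsection \<open>Convergence\<close>

context step_size_coefficients
begin

abbreviation "f \<equiv> phi11 A B"
abbreviation "p \<equiv> psi1 A C B"
abbreviation "q \<equiv> psi2 A C m L \<delta> \<sigma> \<rho> \<alpha> B"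

text \<open>\<open>psi2\<close> is at most a constant times the squared first step size of its
  block. After multiplication by the first step size of the next block, bounding one of the two
  equal factors by \<open>\<alpha> 0\<close> leaves the product that \<open>psi1_ge\<close>
  controls. No ratio of step sizes enters.\<close>

lemma alpha_times_psi2_le:
  obtains D where "0 \<le> D" "\<And>k. \<alpha> (Suc k * B) * q k \<le> D * p k"
proof
  define Q where "Q = real B * (2 * m * real B *
    (2 * ((\<delta>\<^sup>2 + 2 * \<mu> * \<alpha> 0 * nu \<mu> L \<delta> \<sigma> \<rho> \<alpha> B 0) / (1 - \<rho>\<^sup>2)) + \<sigma>\<^sup>2))"
  define \<kappa> where "\<kappa> = L * \<delta>\<^sup>2 / (sqrt 2 * \<mu>)"
  have \<kappa>: "0 < \<kappa>" using L_pos delta_pos mu_pos by (simp add: \<kappa>_def)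
  have Q: "0 \<le> Q"
    unfolding Q_def using m_pos mu_pos gap alpha_pos[of 0] nu_nonneg[of 0]
    by (intro mult_nonneg_nonneg add_nonneg_nonneg divide_nonneg_nonneg) auto
  show "0 \<le> \<alpha> 0 * Q / \<kappa>" using Q \<kappa> alpha_pos[of 0] by simp
  show "\<alpha> (Suc k * B) * q k \<le> \<alpha> 0 * Q / \<kappa> * p k" for k
  proof -
    have \<alpha>: "0 < \<alpha> (k * B)" "\<alpha> (k * B) \<le> \<alpha> 0" "0 < \<alpha> (Suc k * B)"
      using alpha_pos alpha_mono by auto
    have "q k \<le> (\<alpha> (k * B))\<^sup>2 * real B * (2 * m * real B *
        (2 * ((\<delta>\<^sup>2 + 2 * \<mu> * \<alpha> (k * B) * nu \<mu> L \<delta> \<sigma> \<rho> \<alpha> B (k * B)) / (1 - \<rho>\<^sup>2)) + \<sigma>\<^sup>2))"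
      by (rule psi2_le)
    also have "\<dots> \<le> (\<alpha> (k * B))\<^sup>2 * real B * (2 * m * real B *
        (2 * ((\<delta>\<^sup>2 + 2 * \<mu> * \<alpha> 0 * nu \<mu> L \<delta> \<sigma> \<rho> \<alpha> B 0) / (1 - \<rho>\<^sup>2)) + \<sigma>\<^sup>2))"
    proof -
      have "\<alpha> (k * B) * nu \<mu> L \<delta> \<sigma> \<rho> \<alpha> B (k * B) \<le> \<alpha> 0 * nu \<mu> L \<delta> \<sigma> \<rho> \<alpha> B 0"
        using \<alpha> nu_nonneg nu_mono[of 0 "k * B"] by (intro mult_mono) auto
      then have "2 * \<mu> * (\<alpha> (k * B) * nu \<mu> L \<delta> \<sigma> \<rho> \<alpha> B (k * B)) \<le> 2 * \<mu> * (\<alpha> 0 * nu \<mu> L \<delta> \<sigma> \<rho> \<alpha> B 0)"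
        using mu_pos by (intro mult_left_mono) auto
      then show ?thesis
        using gap m_pos
        by (intro mult_left_mono add_right_mono divide_right_mono add_left_mono) (auto simp: mult.assoc)
    qed
    also have "\<dots> = (\<alpha> (k * B))\<^sup>2 * Q" by (simp only: Q_def mult.assoc)
    finally have "\<alpha> (Suc k * B) * q k \<le> \<alpha> (Suc k * B) * ((\<alpha> (k * B))\<^sup>2 * Q)"
      using \<alpha> by (intro mult_left_mono) auto
    also have "\<dots> = \<alpha> (Suc k * B) * \<alpha> (k * B) * (\<alpha> (k * B) * Q)" by (simp add: power2_eq_square)
    also have "\<dots> \<le> \<alpha> (Suc k * B) * \<alpha> (k * B) * (\<alpha> 0 * Q)"
      using \<alpha> Q by (intro mult_left_mono mult_right_mono) auto
    also have "\<dots> = \<alpha> 0 * Q / \<kappa> * (\<alpha> (Suc k * B) * \<alpha> (k * B) * \<kappa>)" using \<kappa> by simp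
    also have "\<dots> \<le> \<alpha> 0 * Q / \<kappa> * p k"
      using psi1_ge[of k] Q \<kappa> alpha_pos[of 0] unfolding \<kappa>_def[symmetric]
      by (intro mult_left_mono) (auto simp: add.commute)
    finally show ?thesis .
  qed
qed

text \<open>The potential needs a ratio that stays away from one uniformly in \<open>k\<close>; the
  quotient of the two uniform bounds provides it.\<close>

lemma phi22_le_theta_phi11:
  obtains \<theta> where "\<theta> < 1" "\<And>k. phi22 A L \<rho> \<alpha> B k \<le> \<theta> * f k"
proof
  define u where "u = 1 - \<rho>\<^sup>2"
  have u: "0 < u" "u < 1" using gap by (simp_all add: u_def)
  show "(1 - u / 4) / (1 - u / 8) < 1" using u by (simp add: field_simps)
  show "phi22 A L \<rho> \<alpha> B k \<le> (1 - u / 4) / (1 - u / 8) * f k" for k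
  proof -
    have "1 - u / 4 = (1 - u / 4) / (1 - u / 8) * (1 - u / 8)" using u by simp
    also have "\<dots> \<le> (1 - u / 4) / (1 - u / 8) * f k"
      using phi11_bounds(1)[of k] u unfolding u_def[symmetric] by (intro mult_left_mono) auto
    finally show ?thesis using phi22_bounds(2)[of k] unfolding u_def[symmetric] by linarith
  qed
qed

lemma phi22_less_phi11: "phi22 A L \<rho> \<alpha> B k < f k"
  using phi22_bounds(2)[of k] phi11_bounds(1)[of k] gap by argo

lemma phi11_pos: "0 < f k"
  using phi11_bounds(1)[of k] gap by argo

lemma spectral_radius_Phi: "spectral_radius (Phi A L \<rho> \<alpha> B k) < 1"
proof -
  \<comment> \<open>\<open>phi11_bounds\<close> gives only a weak inequality; the last factor of the
    product makes it strict.\<close>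
  have "f k < 1"
  proof -
    have "f k = (1 - \<mu> * \<alpha> (k * B + (B - 1))) * mat_prod A (k * B + (B - 1)) (k * B) $ 1 $ 1"
      using mat_prod_Suc_entries(1)[of "k * B" "k * B + (B - 1)"] B_ge_2
      by (simp add: phi11_def add.commute del: mat_prod.simps)
    also have "\<dots> \<le> (1 - \<mu> * \<alpha> (k * B + (B - 1))) * 1"
      using mat_prod_11_bounds(2)[of "k * B" "k * B + (B - 1)"] mu_alpha(3)[of "k * B + (B - 1)"]
      by (intro mult_left_mono) auto
    finally show ?thesis using mu_alpha(1)[of "k * B + (B - 1)"] by argo
  qed
  moreover have "phi22 A L \<rho> \<alpha> B k < 1" using phi22_bounds(2)[of k] gap by argo
  ultimately show ?thesis
    using phi11_pos[of k] phi22_bounds(1)[of k]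
    by (simp add: spectral_radius_triangular Phi_def)
qed

end

context block_sgd
begin

text \<open>After \<open>coupled_recursion\<close> the first entry still contains \<open>z\<close>,
  a multiple of the initial disagreement. If \<open>x 0\<close> is positive, \<open>z\<close> is a
  multiple of it. Otherwise \<open>z\<close> is paid by \<open>coeff.p 0\<close>, which is positive
  and occurs in the sum as soon as \<open>k\<close> is positive.\<close>

lemma error_bound:
  obtains c\<^sub>1 c\<^sub>5 where "0 \<le> c\<^sub>1" "0 \<le> c\<^sub>5"
    "\<And>k e. \<not> degenerate_entry (error_vector M W wopt 0) (Suc k) e \<Longrightarrow>
      error_vector M W wopt (Suc k * B) $ e
        \<le> c\<^sub>1 * (\<Prod>j = 0..<Suc k. coeff.f j) * error_vector M W wopt 0 $ e
          + c\<^sub>5 * (\<Sum>r = 1..<Suc k. (\<Prod>j = r..<Suc k. coeff.f j)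
              * Psi coeff.A coeff.C (real CARD('m)) L \<delta> \<sigma> \<rho> \<alpha> B (r - 1) $ e)
          + Psi coeff.A coeff.C (real CARD('m)) L \<delta> \<sigma> \<rho> \<alpha> B k $ e"
proof -
  define x where "x k = opt_err (k * B)" for k
  define y where "y k = cons_err (k * B)" for k
  define H where "H = real B * (2 * L\<^sup>2 / (\<mu> * real CARD('m)) * coeff.g ^ (2 * (B - 1)))"
  define \<eta> where "\<eta> k = H * \<alpha> (k * B)" for k
  define f0 where "f0 = 1 - (1 - \<rho>\<^sup>2) / 8"
  have xy: "0 \<le> x k" "0 \<le> y k" for k
    by (simp_all add: x_def y_def opt_err_nonneg cons_err_nonneg)
  have H: "0 \<le> H" using mu_pos coeff.g_ge_1 by (simp add: H_def)
  obtain D where D: "0 \<le> D" "\<And>k. \<alpha> (Suc k * B) * coeff.q k \<le> D * coeff.p k"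
    by (rule coeff.alpha_times_psi2_le) blast
  obtain \<theta> where \<theta>: "\<theta> < 1" "\<And>k. phi22 coeff.A L \<rho> \<alpha> B k \<le> \<theta> * coeff.f k"
    by (rule coeff.phi22_le_theta_phi11) blast
  define c where "c = 1 / (f0 * (1 - \<theta>))"
  have f0: "0 < f0" using coeff.gap unfolding f0_def by argo
  have c: "0 < c" using f0 \<theta> by (simp add: c_def)
  have \<eta>: "0 \<le> \<eta> k" "\<eta> (Suc k) \<le> \<eta> k" for k
    using H coeff.alpha_pos[of "k * B"] coeff.alpha_mono[of "k * B" "Suc k * B"]
    unfolding \<eta>_def by (auto intro: mult_left_mono)
  have prod_nonneg: "0 \<le> (\<Prod>j = r..<k. coeff.f j)" for r k
    using coeff.phi11_pos by (intro prod_nonneg) (auto intro: less_imp_le)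
  have x_le: "x (Suc k) \<le> (\<Prod>j = 0..<Suc k. coeff.f j) * (x 0 + c * \<eta> 0 * y 0)
      + (1 + c * (H * D)) * (\<Sum>r = 1..<Suc k. (\<Prod>j = r..<Suc k. coeff.f j) * coeff.p (r - 1))
      + coeff.p k" for k
    unfolding c_def
  proof (rule coupled_recursion[where g="phi22 coeff.A L \<rho> \<alpha> B" and q=coeff.q and h="phi12 coeff.A B"])
    show "\<eta> (Suc k) * coeff.q k \<le> H * D * coeff.p k" for k
      using mult_left_mono[OF D(2) H, of k] by (simp add: \<eta>_def mult.assoc)
    show "phi12 coeff.A B k \<le> \<eta> k" for k
      using coeff.phi12_le[of k] by (simp add: \<eta>_def H_def)
    show "x (Suc k) \<le> coeff.f k * x k + phi12 coeff.A B k * y k + coeff.p k" for k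
      unfolding x_def y_def by (rule opt_err_block)
    show "y (Suc k) \<le> phi22 coeff.A L \<rho> \<alpha> B k * y k + coeff.q k" for k
      unfolding y_def by (rule cons_err_block_le)
  qed (use f0 \<theta> \<eta> xy coeff.phi22_bounds coeff.phi11_bounds in \<open>auto simp: f0_def\<close>)
  \<comment> \<open>The claim for switching index 0 has products of \<open>phi11\<close> only, so
    the smaller \<open>phi22\<close> is replaced by it.\<close>
  have y_le: "y (Suc k) \<le> (\<Prod>j = 0..<Suc k. coeff.f j) * y 0
      + (\<Sum>r = 1..<Suc k. (\<Prod>j = r..<Suc k. coeff.f j) * coeff.q (r - 1)) + coeff.q k" for k
  proof -
    have "y (Suc j) \<le> coeff.f j * y j + coeff.q j" for j
    proof -
      have "phi22 coeff.A L \<rho> \<alpha> B j * y j \<le> coeff.f j * y j"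
        using coeff.phi22_less_phi11[of j] xy by (intro mult_right_mono) auto
      then show ?thesis using cons_err_block_le[of j] unfolding y_def by linarith
    qed
    then have "y (Suc k) \<le> (\<Prod>j = 0..<Suc k. coeff.f j) * y 0
      + (\<Sum>r = 1..<Suc (Suc k). (\<Prod>j = r..<Suc k. coeff.f j) * coeff.q (r - 1))"
      by (rule scalar_recursion_unroll) (rule less_imp_le[OF coeff.phi11_pos])
    then show ?thesis by simp
  qed
  define z where "z = c * \<eta> 0 * y 0"
  have z: "0 \<le> z" using c \<eta> xy by (simp add: z_def)
  \<comment> \<open>For \<open>x 0 = 0\<close> the quotient is 0, so the constant is one and
    \<open>c\<^sub>5\<close> has to carry \<open>z\<close>.\<close>
  define c\<^sub>1 where "c\<^sub>1 = 1 + z / x 0"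
  define c\<^sub>5 where "c\<^sub>5 = 1 + c * (H * D) + z / coeff.p 0"
  have c\<^sub>1: "1 \<le> c\<^sub>1" using z xy by (simp add: c\<^sub>1_def)
  have c\<^sub>5: "1 + c * (H * D) \<le> c\<^sub>5" "1 \<le> c\<^sub>5"
    using z c H D coeff.psi1_pos[of 0] by (simp_all add: c\<^sub>5_def)
  define S where "S k = (\<Sum>r = 1..<Suc k. (\<Prod>j = r..<Suc k. coeff.f j) * coeff.p (r - 1))" for k
  have S: "0 \<le> S k" for k
    unfolding S_def using coeff.psi1_pos by (intro sum_nonneg mult_nonneg_nonneg prod_nonneg less_imp_le)
  show thesis
  proof
    show "0 \<le> c\<^sub>1" "0 \<le> c\<^sub>5" using c\<^sub>1 c\<^sub>5 by auto
    fix k and e :: 2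
    assume nondeg: "\<not> degenerate_entry (error_vector M W wopt 0) (Suc k) e"
    let ?\<Pi> = "\<Prod>j = 0..<Suc k. coeff.f j"
    consider "e = 1" | "e = 2" using exhaust_2 by blast
    then show "error_vector M W wopt (Suc k * B) $ e
        \<le> c\<^sub>1 * ?\<Pi> * error_vector M W wopt 0 $ e
          + c\<^sub>5 * (\<Sum>r = 1..<Suc k. (\<Prod>j = r..<Suc k. coeff.f j)
              * Psi coeff.A coeff.C (real CARD('m)) L \<delta> \<sigma> \<rho> \<alpha> B (r - 1) $ e)
          + Psi coeff.A coeff.C (real CARD('m)) L \<delta> \<sigma> \<rho> \<alpha> B k $ e"
    proof cases
      case 1
      have "?\<Pi> * (x 0 + z) + (1 + c * (H * D)) * S k \<le> c\<^sub>1 * ?\<Pi> * x 0 + c\<^sub>5 * S k"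
      proof (cases "x 0 = 0 \<and> z \<noteq> 0")
        case False
        then have "?\<Pi> * (x 0 + z) = c\<^sub>1 * ?\<Pi> * x 0" by (auto simp: c\<^sub>1_def field_simps)
        then show ?thesis using c\<^sub>5(1) S by (simp only: add_left_mono mult_right_mono)
      next
        case True
        then have "y 0 \<noteq> 0" by (auto simp: z_def)
        then have k: "0 < k"
          using nondeg True 1 by (simp add: degenerate_entry_def error_vector_entries x_def y_def)
        \<comment> \<open>The full product is compared with the coefficient of
          \<open>coeff.p 0\<close>, which lacks the factor of block 0; that factor is at most
          one.\<close>
        have "?\<Pi> = coeff.f 0 * (\<Prod>j = 1..<Suc k. coeff.f j)"
          by (subst prod.atLeast_Suc_lessThan) simp_all
        also have "\<dots> \<le> 1 * (\<Prod>j = 1..<Suc k. coeff.f j)"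
          using coeff.phi11_bounds(2)[of 0] prod_nonneg by (intro mult_right_mono)
        finally have "?\<Pi> * coeff.p 0 \<le> (\<Prod>j = 1..<Suc k. coeff.f j) * coeff.p (1 - 1)"
          using coeff.psi1_pos[of 0] by simp
        also have "\<dots> \<le> S k"
          unfolding S_def using k coeff.psi1_pos
          by (intro member_le_sum[where f="\<lambda>r. (\<Prod>j = r..<Suc k. coeff.f j) * coeff.p (r - 1)"]
              mult_nonneg_nonneg prod_nonneg less_imp_le) auto
        finally have "z / coeff.p 0 * (?\<Pi> * coeff.p 0) \<le> z / coeff.p 0 * S k"
          using z coeff.psi1_pos[of 0] by (intro mult_left_mono) auto
        then have "?\<Pi> * z \<le> z / coeff.p 0 * S k"
          using coeff.psi1_pos[of 0] by (simp add: mult.commute)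
        then show ?thesis using True by (simp add: c\<^sub>5_def distrib_right)
      qed
      then show ?thesis
        using x_le[of k] 1
        by (simp add: error_vector_entries Psi_def x_def z_def[unfolded x_def] S_def)
    next
      case 2
      have "?\<Pi> * y 0 \<le> c\<^sub>1 * (?\<Pi> * y 0)"
        using mult_right_mono[OF c\<^sub>1 mult_nonneg_nonneg[OF prod_nonneg xy(2)]] by (simp only: mult_1)
      moreover have "0 \<le> (\<Sum>r = 1..<Suc k. (\<Prod>j = r..<Suc k. coeff.f j) * coeff.q (r - 1))"
        by (intro sum_nonneg mult_nonneg_nonneg prod_nonneg coeff.psi2_nonneg)
      note mult_right_mono[OF c\<^sub>5(2) this]
      ultimately show ?thesis
        using y_le[of k] 2
        by (simp add: error_vector_entries Psi_def y_def mult.assoc)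
    qed
  qed
qed

end

theorem mainTheorem2:
  fixes F :: "'m::finite \<Rightarrow> real^'n \<Rightarrow> real"
    and M :: "'w measure"
    and W \<epsilon> :: "nat \<Rightarrow> 'w \<Rightarrow> real^'n^'m"
    and P :: "nat \<Rightarrow> real^'m^'m"
    and E :: "nat \<Rightarrow> ('m \<times> 'm) set"
    and v :: "nat \<Rightarrow> 'm \<Rightarrow> nat"
    and \<alpha> :: "nat \<Rightarrow> real"
    and Lc \<mu>c \<delta>c \<sigma>c :: "'m \<Rightarrow> real"
    and m L \<mu> \<delta> \<sigma> \<rho> :: real
    and B\<^sub>1 B\<^sub>2 l B :: nat
    and wopt :: "real^'n"
    and \<Xi> \<Psi> :: "nat \<Rightarrow> real^2"
    and A \<Phi> :: "nat \<Rightarrow> real^2^2"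
    and \<phi>11 \<phi>22 \<nu> :: "nat \<Rightarrow> real"
  assumes "prob_space M"
    \<comment> \<open>losses\<close>
    and "\<And>i w. F i differentiable (at w)"
    and "\<And>i. (Lc i)-lipschitz_on UNIV (grad (F i))"
    and "\<And>i. 0 < \<mu>c i"
    and "\<And>i w w'. \<mu>c i * (norm (w - w'))\<^sup>2 \<le> (grad (F i) w - grad (F i) w') \<bullet> (w - w')"
    and "\<And>i. 0 < \<delta>c i"
    and "\<And>i w. norm (grad (F i) w - grad (avg_loss F) w) \<le> \<delta>c i"
    and "unique_minimizer (avg_loss F) wopt"
    \<comment> \<open>gradient errors and initial models\<close>
    and "W 0 \<in> borel_measurable M"
    and "integrable M (\<lambda>\<omega>. (norm (W 0 \<omega>))\<^sup>2)"
    and "\<And>i. 0 \<le> \<sigma>c i"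
    and "gradient_errors M (W 0) \<epsilon> \<sigma>c"
    \<comment> \<open>constants\<close>
    and "m = real CARD('m)"
    and "L = Max (range Lc)"
    and "\<mu> = Min (range \<mu>c)"
    and "\<delta> = Max (range \<delta>c)"
    and "\<sigma> = Max (range \<sigma>c)"
    \<comment> \<open>graphs and weights\<close>
    and "\<And>k. sym (E k)"
    and "\<And>k. irrefl (E k)"
    and "\<And>k i. v k i \<in> {0, 1}"
    and "\<And>k. weight_conditions (P k) (flow_graph E v k)"
    and "connectivity_conditions E v B\<^sub>1 B\<^sub>2"
    and "l * B\<^sub>1 \<le> B\<^sub>2"
    and "B\<^sub>2 \<le> (l + 1) * B\<^sub>1 - 1"
    and "B = (l + 2) * B\<^sub>1"
    and "\<rho> = contraction_factor P B"
    and "0 < \<rho>"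
    and "\<rho> < 1"
    \<comment> \<open>iterates\<close>
    and "\<And>k \<omega>. \<omega> \<in> space M \<Longrightarrow>
           W (Suc k) \<omega> = P k ** W k \<omega> - \<alpha> k *\<^sub>R noisy_grads F (W k \<omega>) (\<epsilon> k \<omega>)"
    \<comment> \<open>step sizes\<close>
    and "\<And>k. 0 < \<alpha> k"
    and "\<And>k. \<alpha> (Suc k) \<le> \<alpha> k"
    and "\<alpha> 0 \<le> (1 - \<rho>\<^sup>2) / (8 * real B * L * (1 + Gamma1 \<rho> B) ^ (B - 1))"
    \<comment> \<open>abbreviated quantities\<close>
    and "\<Xi> = error_vector M W wopt"
    and "A = coeff_A m \<mu> L \<alpha>"
    and "\<phi>11 = phi11 A B"
    and "\<phi>22 = phi22 A L \<rho> \<alpha> B"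
    and "\<Phi> = Phi A L \<rho> \<alpha> B"
    and "\<Psi> = Psi A (coeff_C m L \<delta> \<sigma> \<alpha>) m L \<delta> \<sigma> \<rho> \<alpha> B"
    and "\<nu> = nu \<mu> L \<delta> \<sigma> \<rho> \<alpha> B"
  shows "(\<forall>k. spectral_radius (\<Phi> k) < 1) \<and>
    (\<exists>!K. switch_index \<phi>11 \<phi>22 K) \<and>
    (\<forall>K. switch_index \<phi>11 \<phi>22 K \<longrightarrow>
      (\<exists>q\<^sub>1 q\<^sub>2 q\<^sub>3 q\<^sub>4 q\<^sub>5.
        nonneg_bigO {max K 1..} q\<^sub>1 (\<lambda>k. \<Prod>j = K..<k. \<phi>11 j) \<and>
        nonneg_bigO {max K 1..} q\<^sub>2 (\<lambda>k. \<Prod>j = 0..<K. \<phi>22 j) \<and>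
        nonneg_bigO {max K 1..} q\<^sub>3 (\<lambda>k. \<Prod>j = K..<k. \<phi>11 j) \<and>
        nonneg_bigO {(k, r). max K 1 \<le> k \<and> 1 \<le> r \<and> r < K} q\<^sub>4
          (\<lambda>(k, r). \<Prod>j = r..<K. \<phi>22 j) \<and>
        nonneg_bigO {(k, r). max K 1 \<le> k \<and> max K 1 \<le> r \<and> r < k} q\<^sub>5
          (\<lambda>(k, r). \<Prod>j = r..<k. \<phi>11 j) \<and>
        (\<forall>k\<ge>max K 1. \<forall>e. \<not> degenerate_entry (\<Xi> 0) k e \<longrightarrow>
          \<Xi> (k * B) $ e \<le>
            ((q\<^sub>1 k * q\<^sub>2 k) *\<^sub>R \<Xi> 0
              + q\<^sub>3 k *\<^sub>R (\<Sum>r = 1..<K. q\<^sub>4 (k, r) *\<^sub>R \<Psi> (r - 1))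
              + (\<Sum>r = max K 1..<k. q\<^sub>5 (k, r) *\<^sub>R \<Psi> (r - 1))
              + \<Psi> (k - 1)) $ e))) \<and>
    (\<forall>k. \<Psi> k \<le> ((\<alpha> (k * B))\<^sup>2 * real B) *\<^sub>R vector
      [\<sigma>\<^sup>2 / m + \<nu> (k * B),
       2 * m * real B * (2 * ((\<delta>\<^sup>2 + 2 * \<mu> * \<alpha> (k * B) * \<nu> (k * B)) / (1 - \<rho>\<^sup>2)) + \<sigma>\<^sup>2)])"
proof -
  interpret prob_space M by fact
  have le_Max: "Lc i \<le> L" "\<delta>c i \<le> \<delta>" "\<sigma>c i \<le> \<sigma>" and Min_le: "\<mu> \<le> \<mu>c i" for i
    unfolding assms(14-17) by simp_all
  have "\<mu> \<in> range \<mu>c" "\<delta> \<in> range \<delta>c" unfolding assms(15,16) by (intro Min_in Max_in; simp)+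
  then have pos: "0 < \<mu>" "0 < \<delta>" using assms(4,6) by auto
  interpret losses: heterogeneous_losses F L \<mu> \<delta> wopt
  proof
    show "norm (grad (F i) w - grad (F i) w') \<le> L * norm (w - w')" for i w w'
    proof -
      have "norm (grad (F i) w - grad (F i) w') \<le> Lc i * norm (w - w')"
        using lipschitz_onD[OF assms(3)[of i], of w w'] by (simp add: dist_norm)
      also have "\<dots> \<le> L * norm (w - w')" by (intro mult_right_mono le_Max) simp
      finally show ?thesis .
    qed
    show "\<mu> * (norm (w - w'))\<^sup>2 \<le> (grad (F i) w - grad (F i) w') \<bullet> (w - w')" for i w w'
      using mult_right_mono[OF Min_le, of "(norm (w - w'))\<^sup>2" i] assms(5)[of i w w'] by simp
    show "norm (grad (F i) w - grad (avg_loss F) w) \<le> \<delta>" for i w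
      using assms(7)[of i w] le_Max(2)[of i] by linarith
  qed (use assms pos in auto)
  have B: "2 \<le> B"
  proof -
    have "1 \<le> B\<^sub>1" using assms(22) by (simp add: connectivity_conditions_def)
    then have "2 * 1 \<le> (l + 2) * B\<^sub>1" by (intro mult_le_mono) auto
    then show ?thesis by (simp add: assms(25))
  qed
  interpret coeffs: step_size_coefficients "real CARD('m)" L \<mu> \<delta> \<sigma> \<rho> \<alpha> B
    using pos losses.mu_le_L B assms by unfold_locales auto
  have noise: "gradient_errors M (W 0) \<epsilon> (\<lambda>_. \<sigma>)"
  proof -
    have "(\<sigma>c i)\<^sup>2 \<le> \<sigma>\<^sup>2" for i using assms(11)[of i] le_Max(3)[of i] by (intro power_mono)
    then have "(LINT \<omega>|M. (norm (\<epsilon> k \<omega> $ i))\<^sup>2) \<le> \<sigma>\<^sup>2" for k i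
      using assms(12) order_trans unfolding gradient_errors_def by blast
    then show ?thesis using assms(12) unfolding gradient_errors_def by simp
  qed
  have alpha_L: "\<alpha> k * L \<le> 1 / 2" for k
  proof -
    have "(1 - \<rho>\<^sup>2) / (8 * real B) \<le> 1 / 2" using coeffs.gap B by (intro frac_le) auto
    then show ?thesis using coeffs.alpha_L_le[of k] by linarith
  qed
  interpret block_sgd M F L \<mu> \<delta> wopt W \<epsilon> P \<alpha> \<sigma> \<rho> B
  proof unfold_locales
    show "doubly_stochastic (P k)" for k using assms(21)[of k] by (simp add: weight_conditions_def)
    show "contraction_factor P B \<le> \<rho>" by (simp only: assms(26))
  qed (fact assms noise alpha_L)+
  note defs = assms(13,33-39)
  \<comment> \<open>A positive \<open>K\<close> would demand the reverse strict inequality at index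
    0.\<close>
  have switch: "switch_index \<phi>11 \<phi>22 K \<longleftrightarrow> K = 0" for K
  proof -
    have "\<phi>22 k < \<phi>11 k" for k unfolding defs by (rule coeffs.phi22_less_phi11)
    then show ?thesis unfolding switch_index_def by (metis less_asym less_imp_le neq0_conv not_less0)
  qed
  obtain c\<^sub>1 c\<^sub>5 where c: "0 \<le> c\<^sub>1" "0 \<le> c\<^sub>5"
    and bound: "\<And>k e. \<not> degenerate_entry (\<Xi> 0) (Suc k) e \<Longrightarrow>
      \<Xi> (Suc k * B) $ e \<le> c\<^sub>1 * (\<Prod>j = 0..<Suc k. \<phi>11 j) * \<Xi> 0 $ e
        + c\<^sub>5 * (\<Sum>r = 1..<Suc k. (\<Prod>j = r..<Suc k. \<phi>11 j) * \<Psi> (r - 1) $ e) + \<Psi> k $ e"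
    unfolding defs by (rule error_bound) blast
  have prod_nonneg: "0 \<le> (\<Prod>j = r..<k. \<phi>11 j)" for r k
    unfolding defs using coeffs.phi11_pos by (intro prod_nonneg) (auto intro: less_imp_le)
  show ?thesis
  proof (intro conjI allI impI)
    show "spectral_radius (\<Phi> k) < 1" for k unfolding defs by (rule coeffs.spectral_radius_Phi)
    show "\<exists>!K. switch_index \<phi>11 \<phi>22 K" by (simp add: switch)
  next
    fix K assume "switch_index \<phi>11 \<phi>22 K"
    then have K: "K = 0" by (simp add: switch)
    \<comment> \<open>For \<open>K = 0\<close> the products of \<open>\<phi>22\<close> are empty, so
      \<open>q\<^sub>2\<close> can be one, and the sum before the switch is empty, so
      \<open>q\<^sub>3\<close> and \<open>q\<^sub>4\<close> can be zero.\<close>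
    let ?q\<^sub>1 = "\<lambda>k. c\<^sub>1 * (\<Prod>j = 0..<k. \<phi>11 j)"
    let ?q\<^sub>5 = "\<lambda>(k, r). c\<^sub>5 * (\<Prod>j = r..<k. \<phi>11 j)"
    have "\<Xi> (k * B) $ e \<le> ((?q\<^sub>1 k * 1) *\<^sub>R \<Xi> 0 + 0 *\<^sub>R (\<Sum>r = 1..<0. 0 *\<^sub>R \<Psi> (r - 1))
        + (\<Sum>r = max 0 1..<k. ?q\<^sub>5 (k, r) *\<^sub>R \<Psi> (r - 1)) + \<Psi> (k - 1)) $ e"
      if k: "max 0 1 \<le> k" and nondeg: "\<not> degenerate_entry (\<Xi> 0) k e" for k e
    proof -
      obtain j where "k = Suc j" using k by (cases k) auto
      then show ?thesis
        using bound[of j e] nondeg by (simp add: sum_component sum_distrib_left mult.assoc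
            del: sum.op_ivl_Suc prod.op_ivl_Suc)
    qed
    moreover have "nonneg_bigO {max 0 1..} ?q\<^sub>1 (\<lambda>k. \<Prod>j = 0..<k. \<phi>11 j)"
      using c prod_nonneg unfolding nonneg_bigO_def by (intro exI[of _ c\<^sub>1]) simp
    moreover have "nonneg_bigO {max 0 1..} (\<lambda>k. 1) (\<lambda>k. \<Prod>j = 0..<0. \<phi>22 j)"
      unfolding nonneg_bigO_def by (intro exI[of _ 1]) simp
    moreover have "nonneg_bigO {max 0 1..} (\<lambda>k. 0) (\<lambda>k. \<Prod>j = 0..<k. \<phi>11 j)"
      unfolding nonneg_bigO_def by (intro exI[of _ 0]) simp
    moreover have "nonneg_bigO {(k, r). max 0 1 \<le> k \<and> 1 \<le> r \<and> r < 0} (\<lambda>_. 0)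
        (\<lambda>(k, r). \<Prod>j = r..<0. \<phi>22 j)"
      unfolding nonneg_bigO_def by simp
    moreover have "nonneg_bigO {(k, r). max 0 1 \<le> k \<and> max 0 1 \<le> r \<and> r < k} ?q\<^sub>5
        (\<lambda>(k, r). \<Prod>j = r..<k. \<phi>11 j)"
      using c prod_nonneg unfolding nonneg_bigO_def by (intro exI[of _ c\<^sub>5]) auto
    ultimately show "\<exists>q\<^sub>1 q\<^sub>2 q\<^sub>3 q\<^sub>4 q\<^sub>5.
        nonneg_bigO {max K 1..} q\<^sub>1 (\<lambda>k. \<Prod>j = K..<k. \<phi>11 j) \<and>
        nonneg_bigO {max K 1..} q\<^sub>2 (\<lambda>k. \<Prod>j = 0..<K. \<phi>22 j) \<and>
        nonneg_bigO {max K 1..} q\<^sub>3 (\<lambda>k. \<Prod>j = K..<k. \<phi>11 j) \<and>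
        nonneg_bigO {(k, r). max K 1 \<le> k \<and> 1 \<le> r \<and> r < K} q\<^sub>4
          (\<lambda>(k, r). \<Prod>j = r..<K. \<phi>22 j) \<and>
        nonneg_bigO {(k, r). max K 1 \<le> k \<and> max K 1 \<le> r \<and> r < k} q\<^sub>5
          (\<lambda>(k, r). \<Prod>j = r..<k. \<phi>11 j) \<and>
        (\<forall>k\<ge>max K 1. \<forall>e. \<not> degenerate_entry (\<Xi> 0) k e \<longrightarrow>
          \<Xi> (k * B) $ e \<le>
            ((q\<^sub>1 k * q\<^sub>2 k) *\<^sub>R \<Xi> 0
              + q\<^sub>3 k *\<^sub>R (\<Sum>r = 1..<K. q\<^sub>4 (k, r) *\<^sub>R \<Psi> (r - 1))
              + (\<Sum>r = max K 1..<k. q\<^sub>5 (k, r) *\<^sub>R \<Psi> (r - 1))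
              + \<Psi> (k - 1)) $ e)"
      unfolding K
      by (intro exI[of _ ?q\<^sub>1] exI[of _ "\<lambda>_. 1"] exI[of _ "\<lambda>_. 0"] exI[of _ ?q\<^sub>5] conjI allI impI)
  next
    fix k
    show "\<Psi> k \<le> ((\<alpha> (k * B))\<^sup>2 * real B) *\<^sub>R vector
      [\<sigma>\<^sup>2 / m + \<nu> (k * B),
       2 * m * real B * (2 * ((\<delta>\<^sup>2 + 2 * \<mu> * \<alpha> (k * B) * \<nu> (k * B)) / (1 - \<rho>\<^sup>2)) + \<sigma>\<^sup>2)]"
      using coeffs.psi1_le[of k] coeffs.psi2_le[of k]
      unfolding defs by (simp add: less_eq_vec_def forall_2 Psi_def)
  qed
qed

end
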